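(* Let $d\ge 2$ and let $\phi,j,L$ be as in the context. Let $\Omega\subset\mathbf{R}^d$ be a bounded $C^{1,1}$ open set, $F\in L^1_{\mathrm{loc}}(\Omega)$, and let $u\in L^1(\mathbf{R}^d,(1\wedge j(|x|))dx)$ be a distributional solution to the linear problem $-Lu=F$ in $\Omega$, i.e. $\int_{\mathbf{R}^d}u\,(-L\xi)\,dx=\int_\Omega F\,\xi\,dx$ for every $\xi\in C_c^\infty(\Omega)$. Then for every $\xi\in C_c^\infty(\Omega)$ with $\xi\ge0$, $$\int_{\mathbf{R}^d}|u|\,(-L\xi)\,dx\le\int_\Omega \xi\,\mathrm{sgn}(u)\,F\,dx.$$
   Context: $\phi:[0,\infty)\to[0,\infty)$ is a complete Bernstein function with zero drift, i.e. $\phi(\lambda)=\int_0^\infty(1-e^{-\lambda s})\nu(s)\,ds$ with $\nu$ a completely monotone Lévy density, satisfying the scaling condition: there are $a_1,a_2>0$ and $0<\delta_1\le\delta_2<1$ with $a_1\lambda^{\delta_1}\le \phi(\lambda t)/\phi(t)\le a_2\lambda^{\delta_2}$ for all $\lambda\ge1$, $t\ge1$. $L=-\phi(-\Delta)$ is the operator $Lu(x)=\mathrm{P.V.}\int_{\mathbf{R}^d}(u(y)-u(x))\,j(|y-x|)\,dy$, where $j(r)=\int_0^\infty(4\pi s)^{-d/2}e^{-r^2/(4s)}\nu(s)\,ds$. $\mathrm{sgn}(t)=1$ for $t>0$, $-1$ for $t<0$, and $\mathrm{sgn}(0)=0$. *)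

theory Defs
  imports "HOL-Analysis.Analysis"
begin

definition completely_monotone :: "(real \<Rightarrow> real) \<Rightarrow> bool" where
  "completely_monotone \<nu> \<longleftrightarrow>
     (\<forall>n. \<forall>s>0. (deriv ^^ n) \<nu> field_differentiable (at s) \<and> 0 \<le> (-1) ^ n * (deriv ^^ n) \<nu> s)"

definition levy_density :: "(real \<Rightarrow> real) \<Rightarrow> bool" where
  "levy_density \<nu> \<longleftrightarrow>
     (\<forall>s>0. 0 \<le> \<nu> s) \<and> set_integrable lebesgue {0<..} (\<lambda>s. min 1 s * \<nu> s)"

text \<open>Only the values of \<phi> on \<open>[0,\<infinity>)\<close> and of \<nu> on \<open>(0,\<infinity>)\<close> are meaningful.\<close>

definition complete_bernstein_no_drift :: "(real \<Rightarrow> real) \<Rightarrow> (real \<Rightarrow> real) \<Rightarrow> bool" where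
  "complete_bernstein_no_drift \<phi> \<nu> \<longleftrightarrow>
     completely_monotone \<nu> \<and> levy_density \<nu> \<and>
     (\<forall>x\<ge>0. \<phi> x = (LINT s:{0<..}|lebesgue. (1 - exp (- (x * s))) * \<nu> s))"

text \<open>The lower bound excludes zeros of \<phi> on \<open>[1,\<infinity>)\<close>, so the quotient is a genuine one.\<close>

definition weak_scaling :: "(real \<Rightarrow> real) \<Rightarrow> bool" where
  "weak_scaling \<phi> \<longleftrightarrow>
     (\<exists>a1 a2 \<delta>1 \<delta>2. 0 < a1 \<and> 0 < a2 \<and> 0 < \<delta>1 \<and> \<delta>1 \<le> \<delta>2 \<and> \<delta>2 < 1 \<and>
       (\<forall>x\<ge>1. \<forall>t\<ge>1. a1 * x powr \<delta>1 \<le> \<phi> (x * t) / \<phi> t \<and>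
                      \<phi> (x * t) / \<phi> t \<le> a2 * x powr \<delta>2))"

text \<open>The integral may diverge at \<open>r = 0\<close>, where the formal value is then \<open>0\<close>; below, the kernel
  at \<open>0\<close> only matters on a null set.\<close>

definition jump_kernel :: "nat \<Rightarrow> (real \<Rightarrow> real) \<Rightarrow> real \<Rightarrow> real" where
  "jump_kernel d \<nu> r =
     (LINT s:{0<..}|lebesgue. (4 * pi * s) powr (- real d / 2) * exp (- r\<^sup>2 / (4 * s)) * \<nu> s)"

definition nonlocal_op :: "(real \<Rightarrow> real) \<Rightarrow> ('a::euclidean_space \<Rightarrow> real) \<Rightarrow> 'a \<Rightarrow> real" where
  "nonlocal_op \<nu> u x =
     Lim (at_right 0) (\<lambda>\<epsilon>. LINT y:{y. \<epsilon> < norm (y - x)}|lebesgue.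
                              (u y - u x) * jump_kernel DIM('a) \<nu> (norm (y - x)))"

definition weighted_L1 :: "(real \<Rightarrow> real) \<Rightarrow> ('a::euclidean_space \<Rightarrow> real) set" where
  "weighted_L1 \<nu> =
     {u. integrable (density lebesgue (\<lambda>x. ennreal (min 1 (jump_kernel DIM('a) \<nu> (norm x))))) u}"

text \<open>Around each boundary point \<open>z\<close>, the domain lies above the graph of a \<open>C\<^sup>1\<^sup>,\<^sup>1\<close> function
  in orthonormal coordinates with origin \<open>z\<close> and last axis \<open>e\<close>. For \<open>y = x - z\<close> the last coordinate
  is \<open>e \<bullet> y\<close>, and the remaining ones are represented by the projection \<open>y - (e \<bullet> y) *\<^sub>R e\<close> onto the
  hyperplane orthogonal to \<open>e\<close>. The graph function, defined on that hyperplane, is taken to be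
  extended to the whole space, which is no restriction: extending it constantly in the direction
  \<open>e\<close> preserves all bounds. The radius \<open>R\<close> and the constant \<open>\<Lambda>\<close> do not depend on \<open>z\<close>.\<close>

definition C11_open :: "'a::euclidean_space set \<Rightarrow> bool" where
  "C11_open \<Omega> \<longleftrightarrow> open \<Omega> \<and>
     (\<exists>R>0. \<exists>\<Lambda>\<ge>0. \<forall>z\<in>frontier \<Omega>. \<exists>e \<Gamma> G.
        norm e = 1 \<and> \<Gamma> 0 = (0::real) \<and> G 0 = 0 \<and>
        (\<forall>y. (\<Gamma> has_derivative (\<lambda>h. G y \<bullet> h)) (at y)) \<and>
        (\<forall>y. norm (G y) \<le> \<Lambda>) \<and> \<Lambda>-lipschitz_on UNIV G \<and>
        \<Omega> \<inter> ball z R =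
          {x \<in> ball z R. \<Gamma> ((x - z) - (e \<bullet> (x - z)) *\<^sub>R e) < e \<bullet> (x - z)})"

primrec Ck :: "nat \<Rightarrow> ('a::euclidean_space \<Rightarrow> real) \<Rightarrow> bool" where
  "Ck 0 f \<longleftrightarrow> continuous_on UNIV f"
| "Ck (Suc k) f \<longleftrightarrow> (\<forall>x. f differentiable (at x)) \<and>
     (\<forall>b\<in>Basis. Ck k (\<lambda>x. frechet_derivative f (at x) b))"

definition test_functions :: "'a::euclidean_space set \<Rightarrow> ('a \<Rightarrow> real) set" where
  "test_functions \<Omega> =
     {\<xi>. (\<forall>k. Ck k \<xi>) \<and> compact (closure {x. \<xi> x \<noteq> 0}) \<and> closure {x. \<xi> x \<noteq> 0} \<subseteq> \<Omega>}"

definition L1_loc :: "'a::euclidean_space set \<Rightarrow> ('a \<Rightarrow> real) set" where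
  "L1_loc \<Omega> = {F. \<forall>K. compact K \<and> K \<subseteq> \<Omega> \<longrightarrow> set_integrable lebesgue K F}"

definition distributional_solution ::
    "(real \<Rightarrow> real) \<Rightarrow> 'a::euclidean_space set \<Rightarrow> ('a \<Rightarrow> real) \<Rightarrow> ('a \<Rightarrow> real) \<Rightarrow> bool" where
  "distributional_solution \<nu> \<Omega> F u \<longleftrightarrow>
     (\<forall>\<xi>\<in>test_functions \<Omega>.
        (LINT x|lebesgue. u x * (- nonlocal_op \<nu> \<xi> x)) = (LINT x:\<Omega>|lebesgue. F x * \<xi> x))"

end

theory Submission
  imports Defs "HOL-Probability.Distributions"
begin

text \<open>
  The inequality holds for a formal reason: the operator \<open>L\<close> is an average of increments, so that
  \<open>L (\<beta> \<circ> v) \<ge> (\<beta>' \<circ> v) L v\<close> for every convex \<open>\<beta>\<close>, and \<open>|t|\<close> is a limit of smooth convex functions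
  whose derivatives tend to \<open>sgn t\<close>, with the value \<open>0\<close> at \<open>t = 0\<close>. As \<open>u\<close> is only integrable, the
  argument is applied to mollifications \<open>v = u * \<eta>\<close>.

  Let \<open>J(z) = j(|z|)\<close> and let \<open>L\<^sub>\<delta>\<close> be the operator with jumps of length at most \<open>\<delta>\<close> discarded. For every
  \<open>\<delta> > 0\<close> all integrals converge absolutely, \<open>L\<^sub>\<delta>\<close> is symmetric (\<open>trunc_symmetric\<close>), it commutes with
  convolutions (\<open>trunc_conv\<close>) and the convexity inequality is pointwise (\<open>trunc_convex\<close>). Hence
  \<open>\<integral> \<beta>(v) L\<^sub>\<delta> \<xi> = \<integral> \<xi> L\<^sub>\<delta> (\<beta>(v)) \<ge> \<integral> \<xi> \<beta>'(v) (u * L\<^sub>\<delta> \<eta>)\<close>. Here only test functions carry the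
  operator, and for these \<open>L\<^sub>\<delta>\<close> tends to \<open>L\<close> dominatedly (\<open>trunc_le_W\<close>, \<open>trunc_tendsto_Lop\<close>). Testing the
  equation with \<open>\<eta>(x - \<cdot>)\<close> gives \<open>- u * L \<eta> = F * \<eta>\<close> where \<open>\<xi> \<noteq> 0\<close>, so that \<open>\<delta> \<rightarrow> 0\<close> yields
  \<open>\<integral> \<beta>(u * \<eta>) (- L \<xi>) \<le> \<integral> \<xi> \<beta>'(u * \<eta>) (F * \<eta>)\<close>, which is \<open>convex_mollified_inequality\<close>. Then \<open>\<eta>\<close> runs
  through an approximate identity (\<open>conv_approx_identity\<close>, \<open>convex_inequality\<close>) and finally \<open>\<beta>\<close> tends to
  the absolute value (\<open>Kato_inequality\<close>). Dilates of \<open>\<xi>\<close> itself serve as mollifiers.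

  Domination takes place against the weight \<open>W(x) = j(|x| + 2)\<close>, which is bounded, is at most a constant
  times the given weight \<open>1 \<and> j(|x|)\<close>, and changes at most by a factor under bounded translations. The
  last property amounts to \<open>j(r) \<le> C j(r + 1)\<close> for \<open>r \<ge> 1\<close> (\<open>jump_kernel_le_shift\<close>). It depends on
  \<open>\<nu>(s) \<le> C \<nu>(s + 1)\<close> for \<open>s\<close> away from \<open>0\<close>, which excludes a decay of \<open>\<nu>\<close> faster than exponential and
  follows from the logarithmic convexity of completely monotone functions
  (\<open>completely_monotone_midpoint_log_convex\<close>).
\<close>

section \<open>Completely monotone functions\<close>

text \<open>The sign is opposite to that of the forward difference, so that completely monotone functions have
  nonnegative iterated decrements.\<close>

definition decrement :: "real \<Rightarrow> (real \<Rightarrow> real) \<Rightarrow> real \<Rightarrow> real" where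
  "decrement h f s = f s - f (s + h)"

lemma decrement_power_deriv:
  assumes "h > 0" "\<And>s. s > 0 \<Longrightarrow> (f has_real_derivative f' s) (at s)" "s > 0"
  shows "((decrement h ^^ m) f has_real_derivative (decrement h ^^ m) f' s) (at s)"
  using assms(3)
proof (induction m arbitrary: s)
  case 0
  then show ?case using assms(2) by simp
next
  case (Suc m)
  have "((decrement h ^^ m) f has_real_derivative (decrement h ^^ m) f' (s + h)) (at (s + h))"
    using Suc.IH[of "s + h"] Suc.prems assms(1) by simp
  then have "((\<lambda>s. (decrement h ^^ m) f (s + h)) has_real_derivative (decrement h ^^ m) f' (s + h)) (at s)"
    using DERIV_shift by blast
  then have "((\<lambda>s. (decrement h ^^ m) f s - (decrement h ^^ m) f (s + h)) has_real_derivative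
      (decrement h ^^ m) f' s - (decrement h ^^ m) f' (s + h)) (at s)"
    by (intro DERIV_diff Suc.IH Suc.prems)
  then show ?case
    by (simp add: decrement_def[abs_def])
qed

text \<open>By the mean value theorem each decrement can be traded for one more derivative.\<close>

lemma completely_monotone_decrement_deriv_nonneg:
  assumes "completely_monotone f" "h > 0" "s > 0"
  shows "0 \<le> (-1) ^ n * (decrement h ^^ m) ((deriv ^^ n) f) s"
  using assms(3)
proof (induction m arbitrary: n s)
  case 0
  then show ?case using assms(1) by (simp add: completely_monotone_def)
next
  case (Suc m)
  have D: "((deriv ^^ n) f has_real_derivative (deriv ^^ Suc n) f t) (at t)" if "t > 0" for t
    using assms(1) that by (simp add: completely_monotone_def DERIV_deriv_iff_field_differentiable)
  define G where "G = (decrement h ^^ m) ((deriv ^^ n) f)"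
  define G' where "G' = (decrement h ^^ m) ((deriv ^^ Suc n) f)"
  have DG: "(G has_real_derivative G' t) (at t)" if "t > 0" for t
    unfolding G_def G'_def by (rule decrement_power_deriv[OF assms(2) D that])
  have "\<exists>z>s. z < s + h \<and> G (s + h) - G s = (s + h - s) * G' z"
    by (rule MVT2) (use Suc.prems assms(2) DG in auto)
  then obtain z where z: "z > s" "G (s + h) - G s = h * G' z" by auto
  have "0 \<le> (-1) ^ Suc n * G' z"
    unfolding G'_def by (rule Suc.IH) (use z Suc.prems in auto)
  with assms(2) have "0 \<le> h * ((-1) ^ Suc n * G' z)"
    by (metis less_imp_le mult_nonneg_nonneg)
  also have "\<dots> = (-1) ^ n * (G s - G (s + h))"
    using z(2) by (simp add: algebra_simps)
  finally show ?case by (simp add: G_def decrement_def[of h "(decrement h ^^ m) _"])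
qed

lemma completely_monotone_decrement_nonneg:
  assumes "completely_monotone f" "h > 0" "s > 0"
  shows "0 \<le> (decrement h ^^ m) f s"
  using completely_monotone_decrement_deriv_nonneg[OF assms, of 0 m] by simp

text \<open>With the shift \<open>E f(s) = f(s + h)\<close> and \<open>D = 1 - E\<close> this is \<open>D\<^sup>m = (E + D)\<^sup>N D\<^sup>m\<close>, expanded.\<close>

lemma decrement_binomial_expansion:
  "(decrement h ^^ m) f s = (\<Sum>i\<le>N. real (N choose i) * (decrement h ^^ (m + (N - i))) f (s + real i * h))"
proof (induction N arbitrary: m s)
  case 0
  then show ?case by simp
next
  case (Suc N)
  let ?a = "\<lambda>m i. (decrement h ^^ m) f (s + real i * h)"
  have split: "(decrement h ^^ m) f s = (decrement h ^^ Suc m) f s + (decrement h ^^ m) f (s + h)"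
    by (simp add: decrement_def)
  have 1: "(decrement h ^^ Suc m) f s = (\<Sum>i\<le>N. real (N choose i) * ?a (m + (Suc N - i)) i)"
    by (subst Suc.IH) (auto intro!: sum.cong simp: Suc_diff_le)
  have 2: "(decrement h ^^ m) f (s + h) = (\<Sum>i\<le>N. real (N choose i) * ?a (m + (N - i)) (Suc i))"
    by (subst Suc.IH) (auto intro!: sum.cong simp: algebra_simps)
  have "(\<Sum>i\<le>Suc N. real (Suc N choose i) * ?a (m + (Suc N - i)) i) =
      ?a (m + Suc N) 0 + (\<Sum>i\<le>N. (real (N choose i) + real (N choose Suc i)) * ?a (m + (N - i)) (Suc i))"
    by (subst sum.atMost_Suc_shift) (simp add: Suc_diff_le)
  also have "\<dots> = (\<Sum>i\<le>N. real (N choose i) * ?a (m + (N - i)) (Suc i)) +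
     (?a (m + Suc N) 0 + (\<Sum>i\<le>N. real (N choose Suc i) * ?a (m + (N - i)) (Suc i)))"
    by (simp add: algebra_simps sum.distrib)
  also have "?a (m + Suc N) 0 + (\<Sum>i\<le>N. real (N choose Suc i) * ?a (m + (N - i)) (Suc i)) =
      (\<Sum>i\<le>Suc N. real (N choose i) * ?a (m + (Suc N - i)) i)"
    by (subst sum.atMost_Suc_shift) simp
  also have "\<dots> = (\<Sum>i\<le>N. real (N choose i) * ?a (m + (Suc N - i)) i)"
    by simp
  finally show ?case
    unfolding split 1 2 by simp
qed

text \<open>The binomial expansion provides weights \<open>w\<^sub>i \<ge> 0\<close> such that \<open>f(s) = \<Sum> w\<^sub>i\<close>,
  \<open>N f(s + h) = \<Sum> i w\<^sub>i\<close> and \<open>N (N - 1) f(s + 2h) = \<Sum> i (i - 1) w\<^sub>i\<close>. The Cauchy-Schwarz inequality, followed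
  by \<open>N \<rightarrow> \<infinity>\<close>, gives the claim without recourse to Bernstein's integral representation.\<close>

lemma completely_monotone_midpoint_log_convex:
  assumes "completely_monotone f" "h > 0" "s > 0"
  shows "(f (s + h))\<^sup>2 \<le> f s * f (s + 2 * h)"
proof -
  have fin: "real (n + 2) * (f (s + h))\<^sup>2 \<le> f s * (real (n + 1) * f (s + 2 * h) + f (s + h))" for n
  proof -
    define N where "N = n + 2"
    define w where "w i = real (N choose i) * (decrement h ^^ (N - i)) f (s + real i * h)" for i
    have w: "0 \<le> w i" for i

    proof -
      have "s + real i * h > 0" using assms by (simp add: add_pos_nonneg)
      from completely_monotone_decrement_nonneg[OF assms(1,2) this] show ?thesis
        by (simp add: w_def)
    qed
    have b0: "f s = (\<Sum>i\<le>N. w i)"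
      unfolding w_def using decrement_binomial_expansion[where m=0 and N=N, unfolded funpow_0 add_0] .
    have b1: "real N * f (s + h) = (\<Sum>i\<le>N. real i * w i)"
    proof -
      have "real (n + 2) * (real (n + 1 choose i)) = real (Suc i) * real (n + 2 choose Suc i)" for i
      proof -
        have "Suc (Suc n) * (Suc n choose i) = Suc i * (Suc (Suc n) choose Suc i)"
          using Suc_times_binomial_eq[of "Suc n" i] by (simp only: mult.commute)
        then have "real (Suc (Suc n) * (Suc n choose i)) = real (Suc i * (Suc (Suc n) choose Suc i))"
          by (simp only:)
        then show ?thesis by (simp only: of_nat_mult add_2_eq_Suc' Suc_eq_plus1[symmetric])
      qed
      note absorb = this
      have "f (s + h) = (\<Sum>i\<le>n+1. real (n + 1 choose i) * (decrement h ^^ (n + 1 - i)) f (s + h + real i * h))"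
        using decrement_binomial_expansion[where m=0 and N="n+1", unfolded funpow_0 add_0] .
      from arg_cong[OF this, of "\<lambda>x. real N * x"]
      have "real N * f (s + h) = (\<Sum>i\<le>n+1. (real (n + 2) * (real (n + 1 choose i))) * (decrement h ^^ (n + 1 - i)) f (s + h + real i * h))"
        by (simp only: N_def sum_distrib_left mult.assoc)
      also have "\<dots> = (\<Sum>i\<le>n+1. real (Suc i) * w (Suc i))"
        unfolding absorb by (intro sum.cong refl) (simp add: w_def N_def algebra_simps)
      also have "\<dots> = (\<Sum>i\<le>N. real i * w i)"
        using sum.atMost_Suc_shift[of "\<lambda>i. real i * w i" "n + 1"] by (simp add: N_def)
      finally show ?thesis .
    qed
    have b2: "real N * real (n + 1) * f (s + 2 * h) = (\<Sum>i\<le>N. real i * (real i - 1) * w i)"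
    proof -
      have absorb: "real (n + 2) * real (n + 1) * (real (n choose i)) = real (Suc (Suc i)) * real (Suc i) * real (n + 2 choose Suc (Suc i))" for i
      proof -
        have "Suc i * (Suc n choose Suc i) = Suc n * (n choose i)"
          "Suc (Suc i) * (Suc (Suc n) choose Suc (Suc i)) = Suc (Suc n) * (Suc n choose Suc i)"
          using Suc_times_binomial_eq[of n i] Suc_times_binomial_eq[of "Suc n" "Suc i"] by (simp_all only: mult.commute)
        then have "Suc (Suc i) * Suc i * (Suc (Suc n) choose Suc (Suc i)) = Suc (Suc n) * Suc n * (n choose i)"
          by (metis mult.assoc mult.left_commute)
        then have "real (Suc (Suc n) * Suc n * (n choose i)) = real (Suc (Suc i) * Suc i * (Suc (Suc n) choose Suc (Suc i)))"
          by (simp only:)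
        then show ?thesis
          by (simp only: of_nat_mult add_2_eq_Suc' Suc_eq_plus1[symmetric])
      qed
      have "f (s + 2 * h) = (\<Sum>i\<le>n. real (n choose i) * (decrement h ^^ (n - i)) f (s + 2 * h + real i * h))"
        using decrement_binomial_expansion[where m=0 and N=n, unfolded funpow_0 add_0] .
      from arg_cong[OF this, of "\<lambda>x. real N * real (n + 1) * x"]
      have "real N * real (n + 1) * f (s + 2 * h) = (\<Sum>i\<le>n. (real (n + 2) * real (n + 1) * (real (n choose i))) * (decrement h ^^ (n - i)) f (s + 2 * h + real i * h))"
        by (simp only: N_def sum_distrib_left mult.assoc)
      also have "\<dots> = (\<Sum>i\<le>n. real (Suc (Suc i)) * (real (Suc (Suc i)) - 1) * w (Suc (Suc i)))"
        unfolding absorb by (intro sum.cong refl) (simp add: w_def N_def algebra_simps)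
      also have "\<dots> = (\<Sum>i\<le>N. real i * (real i - 1) * w i)"
        using sum.atMost_Suc_shift[of "\<lambda>i. real i * (real i - 1) * w i" "n + 1"]
          sum.atMost_Suc_shift[of "\<lambda>i. real (Suc i) * (real (Suc i) - 1) * w (Suc i)" "n"] by (simp add: N_def)
      finally show ?thesis .
    qed
    have "(\<Sum>i\<le>N. sqrt (w i) * (real i * sqrt (w i)))\<^sup>2 \<le> (\<Sum>i\<le>N. (sqrt (w i))\<^sup>2) * (\<Sum>i\<le>N. (real i * sqrt (w i))\<^sup>2)"
      by (rule Cauchy_Schwarz_ineq_sum)
    then have "(\<Sum>i\<le>N. real i * w i)\<^sup>2 \<le> (\<Sum>i\<le>N. w i) * (\<Sum>i\<le>N. (real i)\<^sup>2 * w i)"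
      using w by (simp add: power_mult_distrib algebra_simps power2_eq_square)
    also have "(\<Sum>i\<le>N. (real i)\<^sup>2 * w i) = real N * real (n + 1) * f (s + 2 * h) + real N * f (s + h)"
      unfolding b1 b2 sum.distrib[symmetric] by (intro sum.cong) (auto simp: algebra_simps power2_eq_square)
    finally have "(real N * f (s + h))\<^sup>2 \<le> f s * (real N * real (n + 1) * f (s + 2 * h) + real N * f (s + h))"
      unfolding b0[symmetric] b1[symmetric] .
    then have "real N * (real N * (f (s + h))\<^sup>2) \<le> real N * (f s * (real (n + 1) * f (s + 2 * h) + f (s + h)))"
      by (simp add: algebra_simps power2_eq_square)
    then show ?thesis
      unfolding N_def by (subst (asm) mult_le_cancel_left_pos) auto
  qed
  have lim: "(\<lambda>n. f s * (real (n + 1) / real (n + 2) * f (s + 2 * h) + f (s + h) * (1 / real (n + 2)))) \<longlonglongrightarrow> f s * (1 * f (s + 2 * h) + f (s + h) * 0)"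
  proof (intro tendsto_intros)
    show "(\<lambda>n. 1 / real (n + 2)) \<longlonglongrightarrow> 0"
      using LIMSEQ_ignore_initial_segment[OF lim_1_over_n, of 2] by simp
    have "(\<lambda>n. 1 - 1 / real (n + 2)) \<longlonglongrightarrow> 1 - 0"
      using LIMSEQ_ignore_initial_segment[OF lim_1_over_n, of 2] by (intro tendsto_intros) simp
    moreover have "1 - 1 / real (n + 2) = real (n + 1) / real (n + 2)" for n
      by (simp add: field_simps)
    ultimately show "(\<lambda>n. real (n + 1) / real (n + 2)) \<longlonglongrightarrow> 1"
      by simp
  qed
  have "(f (s + h))\<^sup>2 \<le> f s * (real (n + 1) / real (n + 2) * f (s + 2 * h) + f (s + h) * (1 / real (n + 2)))" for n
  proof -
    have "real (n + 2) * (f s * (real (n + 1) / real (n + 2) * f (s + 2 * h) + f (s + h) * (1 / real (n + 2))))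
        = f s * (real (n + 1) * f (s + 2 * h) + f (s + h))"
      by (simp add: divide_simps)
    with fin[of n] have "real (n + 2) * (f (s + h))\<^sup>2 \<le> real (n + 2) *
        (f s * (real (n + 1) / real (n + 2) * f (s + 2 * h) + f (s + h) * (1 / real (n + 2))))"
      by (simp only:)
    then show ?thesis by (subst (asm) mult_le_cancel_left_pos) auto
  qed
  then have "(f (s + h))\<^sup>2 \<le> f s * (1 * f (s + 2 * h) + f (s + h) * 0)"
    by (intro LIMSEQ_le_const[OF lim]) blast
  then show ?thesis by simp
qed

lemma completely_monotone_nonneg:
  assumes "completely_monotone f" "s > 0"
  shows "0 \<le> f s"
proof -
  have "0 \<le> (-1) ^ 0 * (deriv ^^ 0) f s"
    using assms unfolding completely_monotone_def by blast
  then show ?thesis by simp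
qed

lemma completely_monotone_antimono:
  assumes "completely_monotone f" "0 < s" "s \<le> t"
  shows "f t \<le> f s"
  using completely_monotone_decrement_nonneg[of f "t - s" s 1] assms
  by (cases "s = t") (auto simp: decrement_def)

lemma completely_monotone_continuous_on:
  assumes "completely_monotone f"
  shows "continuous_on {0<..} f"
proof (rule continuous_at_imp_continuous_on, safe)
  fix s :: real assume "s > 0"
  then have "(deriv ^^ 0) f field_differentiable (at s)"
    using assms unfolding completely_monotone_def by blast
  then show "isCont f s"
    by (simp add: field_differentiable_imp_continuous_at)
qed

text \<open>To the right of a zero \<open>s\<close> this is monotonicity; to the left, logarithmic convexity shows that \<open>f\<close>
  vanishes beyond \<open>s / 2\<close>, beyond \<open>s / 4\<close>, and so on.\<close>

lemma completely_monotone_zero_spreads: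
  assumes "completely_monotone f" "s > 0" "f s = 0" "t > 0"
  shows "f t = 0"
proof -
  have down: "f t = 0" if "t > s / 2 ^ n" for n t
    using that
  proof (induction n arbitrary: t)
    case 0
    then have "f t \<le> f s" "0 \<le> f t"
      using completely_monotone_antimono[OF assms(1,2), of t] completely_monotone_nonneg[OF assms(1), of t] assms(2)
      by auto
    then show ?case using assms by simp
  next
    case (Suc n)
    define h where "h = s / 2 ^ n / 2"
    have h: "h > 0" "t - h > 0" "t + h > s / 2 ^ n"
      using Suc.prems assms(2) by (auto simp: h_def field_simps)
    then have "f (t + h) = 0" by (intro Suc.IH)
    then have "(f t)\<^sup>2 \<le> 0"
      using completely_monotone_midpoint_log_convex[OF assms(1) h(1,2)] by (simp add: algebra_simps)
    then show ?case by simp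
  qed
  obtain n where "s / t < 2 ^ n"
    using real_arch_pow[of 2 "s / t"] by auto
  then show ?thesis
    using assms by (intro down[of n]) (simp add: field_simps)
qed

text \<open>By logarithmic convexity the quotients \<open>f(s + 1) / f(s)\<close> increase along \<open>s, s + 1, s + 2, \<dots>\<close>, so it is
  enough to bound them for \<open>s \<in> [a, a + 1]\<close>.\<close>

lemma completely_monotone_shift_comparison:
  assumes "completely_monotone f" "a > 0" "f a > 0"
  shows "\<exists>C>0. \<forall>s\<ge>a. f s \<le> C * f (s + 1)"
proof (intro exI[of _ "f a / f (a + 2)"] conjI allI impI)
  have pos: "f t > 0" if "t > 0" for t
    using completely_monotone_zero_spreads[OF assms(1) that _ assms(2)] assms
      completely_monotone_nonneg[OF assms(1) that] by fastforce
  show "0 < f a / f (a + 2)"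
    using pos assms by simp
  have step: "f (s + real k) * f (s + 1) \<le> f s * f (s + real k + 1)" if "s > 0" for s k
  proof (induction k)
    case 0
    then show ?case by simp
  next
    case (Suc k)
    let ?t = "s + real k"
    have t: "?t > 0" using that by simp
    have "f (?t + 1) * f (s + 1) * f (?t + 1) \<le> f (s + 1) * (f ?t * f (?t + 2))"
      using mult_left_mono[OF completely_monotone_midpoint_log_convex[OF assms(1) _ t, of 1], of "f (s + 1)"]
        pos[of "s + 1"] that by (simp add: power2_eq_square algebra_simps)
    also have "\<dots> = (f ?t * f (s + 1)) * f (?t + 2)" by simp
    also have "\<dots> \<le> (f s * f (?t + 1)) * f (?t + 2)"
      using Suc.IH pos[of "?t + 2"] t by (intro mult_right_mono) auto
    finally have "f (?t + 1) * (f (?t + 1) * f (s + 1)) \<le> f (?t + 1) * (f s * f (?t + 2))"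
      by (simp add: algebra_simps)
    then have "f (?t + 1) * f (s + 1) \<le> f s * f (?t + 2)"
      using pos[of "?t + 1"] t by (subst (asm) mult_le_cancel_left_pos) auto
    then show ?case by (simp add: algebra_simps)
  qed
  fix s assume "a \<le> s"
  define k where "k = nat \<lfloor>s - a\<rfloor>"
  define s0 where "s0 = s - real k"
  have k: "real k \<le> s - a" "s - a < real k + 1"
    using \<open>a \<le> s\<close> by (auto simp: k_def of_nat_nat)
  have s0: "a \<le> s0" "s0 \<le> a + 1" using k by (auto simp: s0_def)
  have "f s * f (a + 2) \<le> f s * f (s0 + 1)"
    using s0 assms pos[of s] \<open>a \<le> s\<close> by (intro mult_left_mono completely_monotone_antimono[OF assms(1)]) auto
  also have "\<dots> \<le> f s0 * f (s + 1)"
    using step[of s0 k] s0 assms by (simp add: s0_def)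
  also have "\<dots> \<le> f a * f (s + 1)"
    using s0 assms pos[of "s + 1"] \<open>a \<le> s\<close> by (intro mult_right_mono completely_monotone_antimono[OF assms(1)]) auto
  finally show "f s \<le> f a / f (a + 2) * f (s + 1)"
    using pos[of "a + 2"] assms by (simp add: field_simps)
qed

section \<open>The heat kernel\<close>

text \<open>Near \<open>s = 0\<close> the exponential absorbs any negative power of \<open>s\<close>.\<close>

lemma heat_factor_le:
  fixes c :: real
  assumes "c > 0"
  shows "\<exists>C>0. \<forall>s>0. (4 * pi * s) powr (- real d / 2) * exp (- (c / s)) \<le> C * min 1 s"
proof -
  define n where "n = d + 1"
  define C where "C = max 1 ((real n / c) ^ n)"
  have n: "n > 0" by (simp add: n_def)
  have "(4 * pi * s) powr (- real d / 2) * exp (- (c / s)) \<le> C * min 1 s" if s: "s > 0" for s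
  proof (cases "s \<le> 1")
    case True
    have "(c / (s * n)) ^ n \<le> (1 + (c / s) / n) ^ n"
      using assms s n by (intro power_mono) (auto simp: field_simps)
    also have "\<dots> \<le> exp (c / s)"
      using n assms s by (intro exp_ge_one_plus_x_over_n_power_n) (auto intro: order_trans[of _ 0])
    finally have "exp (- (c / s)) \<le> 1 / (c / (s * n)) ^ n"
      using assms s n unfolding exp_minus inverse_eq_divide by (intro divide_left_mono) auto
    also have "\<dots> = (real n / c) ^ n * s ^ n"
      by (simp add: power_divide power_mult_distrib)
    finally have e: "exp (- (c / s)) \<le> (real n / c) ^ n * s ^ n" .
    have "(4 * pi * s) powr (- real d / 2) \<le> s powr (- real d / 2)"
      using s pi_gt3 by (intro powr_mono2') auto
    also have "\<dots> \<le> s powr (- real d)"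
      using s True by (intro powr_mono') auto
    also have "\<dots> = 1 / s ^ d"
      using s by (simp add: powr_minus powr_realpow divide_inverse)
    finally have "(4 * pi * s) powr (- real d / 2) * exp (- (c / s)) \<le> 1 / s ^ d * ((real n / c) ^ n * s ^ n)"
      using e s by (intro mult_mono) auto
    also have "\<dots> = (real n / c) ^ n * s"
      using s by (simp add: n_def)
    also have "\<dots> \<le> C * s"
      using s by (intro mult_right_mono) (auto simp: C_def)
    finally show ?thesis using True by simp
  next
    case False
    have "4 * pi * s \<ge> 1"
      using False pi_gt3 mult_mono[of 1 "4 * pi" 1 s] by simp
    then have "(4 * pi * s) powr (- real d / 2) \<le> 1 powr (- real d / 2)"
      by (intro powr_mono2') auto
    moreover have "exp (- (c / s)) \<le> 1" using assms s by simp
    ultimately have "(4 * pi * s) powr (- real d / 2) * exp (- (c / s)) \<le> 1 * 1"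
      by (intro mult_mono) auto
    also have "\<dots> \<le> C * min 1 s" using False by (simp add: C_def)
    finally show ?thesis .
  qed
  then show ?thesis by (intro exI[of _ C]) (auto simp: C_def)
qed

text \<open>The transition density at time \<open>s\<close> of the Brownian motion with generator \<open>\<Delta>\<close>.\<close>

definition heat_kernel :: "real \<Rightarrow> 'a::euclidean_space \<Rightarrow> real" where
  "heat_kernel s z = (4 * pi * s) powr (- real DIM('a) / 2) * exp (- (norm z)\<^sup>2 / (4 * s))"

lemma heat_kernel_nonneg: "0 \<le> heat_kernel s z"
  by (simp add: heat_kernel_def)

text \<open>Each coordinate is normal with variance \<open>2 s\<close>.\<close>

lemma heat_kernel_eq_prod:
  fixes z :: "'a::euclidean_space"
  assumes "s > 0"
  shows "heat_kernel s z = (\<Prod>b\<in>Basis. normal_density 0 (sqrt (2 * s)) (z \<bullet> b))"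
proof -
  have "(\<Prod>b\<in>Basis. normal_density 0 (sqrt (2 * s)) (z \<bullet> b)) =
      (1 / sqrt (4 * pi * s)) ^ DIM('a) * (\<Prod>b\<in>Basis. exp (- (z \<bullet> b)\<^sup>2 / (4 * s)))"
    using assms by (simp add: normal_density_def prod.distrib prod_dividef mult.assoc power_divide)
  also have "(\<Prod>b\<in>Basis. exp (- (z \<bullet> b)\<^sup>2 / (4 * s))) = exp (\<Sum>b\<in>Basis. - (z \<bullet> b)\<^sup>2 / (4 * s))"
    by (simp add: exp_sum)
  also have "(\<Sum>b\<in>Basis. - (z \<bullet> b)\<^sup>2 / (4 * s)) = - (norm z)\<^sup>2 / (4 * s)"
    unfolding power2_norm_eq_inner euclidean_inner[of z z]
    by (simp add: sum_divide_distrib sum_negf power2_eq_square)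
  also have "(1 / sqrt (4 * pi * s)) ^ DIM('a) = (4 * pi * s) powr (- real DIM('a) / 2)"
  proof -
    have e: "1 / sqrt (4 * pi * s) = (4 * pi * s) powr (- (1 / 2))"
      using powr_minus_divide[of "4 * pi * s" "1 / 2"] powr_half_sqrt[of "4 * pi * s"] assms by (simp only:) simp
    have "((4 * pi * s) powr (- (1 / 2))) ^ DIM('a) = ((4 * pi * s) powr (- (1 / 2))) powr (real DIM('a))"
      using assms by (intro powr_realpow[symmetric]) simp
    also have "\<dots> = (4 * pi * s) powr (- real DIM('a) / 2)"
      unfolding powr_powr by simp
    finally show ?thesis unfolding e .
  qed
  finally show ?thesis by (simp add: heat_kernel_def)
qed

lemma nn_integral_heat_kernel:
  assumes "s > 0"
  shows "(\<integral>\<^sup>+ z. ennreal (heat_kernel s (z :: 'a::euclidean_space)) \<partial>lborel) = 1"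
proof -
  have 1: "(\<integral>\<^sup>+ x. ennreal (normal_density 0 (sqrt (2 * s)) x) \<partial>lborel) = 1"
    using assms by (subst nn_integral_eq_integral) auto
  have "(\<integral>\<^sup>+ z. ennreal (heat_kernel s (z :: 'a)) \<partial>lborel) =
      (\<integral>\<^sup>+ z. (\<Prod>b\<in>Basis. ennreal (normal_density 0 (sqrt (2 * s)) ((z :: 'a) \<bullet> b))) \<partial>lborel)"
    by (simp add: heat_kernel_eq_prod[OF assms] prod_ennreal)
  also have "\<dots> = 1"
    by (subst nn_integral_lborel_prod) (auto simp: 1)
  finally show ?thesis .
qed

lemma nn_integral_heat_kernel_second_moment:
  assumes "s > 0"
  shows "(\<integral>\<^sup>+ z. ennreal ((norm z)\<^sup>2 * heat_kernel s (z :: 'a::euclidean_space)) \<partial>lborel) =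
    ennreal (2 * real DIM('a) * s)"
proof -
  let ?n = "normal_density 0 (sqrt (2 * s))"
  have 1: "(\<integral>\<^sup>+ x. ennreal (?n x) \<partial>lborel) = 1"
    using assms by (subst nn_integral_eq_integral) auto
  have "has_bochner_integral lborel (\<lambda>x. ?n x * (x - 0) ^ (2 * 1)) (fact (2 * 1) / ((2 / (sqrt (2 * s))\<^sup>2) ^ 1 * fact 1))"
    using assms by (intro normal_moment_even) simp
  then have "has_bochner_integral lborel (\<lambda>x. ?n x * x\<^sup>2) (2 * s)"
    using assms by simp
  then have 2: "(\<integral>\<^sup>+ x. ennreal (?n x * x\<^sup>2) \<partial>lborel) = ennreal (2 * s)"
    by (subst nn_integral_eq_integral) (auto simp: has_bochner_integral_iff)
  have one: "(\<integral>\<^sup>+ z. ennreal ((z \<bullet> c)\<^sup>2 * heat_kernel s (z :: 'a)) \<partial>lborel) = ennreal (2 * s)"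
    if c: "c \<in> Basis" for c :: 'a
  proof -
    define f where "f b x = (if b = c then ?n x * x\<^sup>2 else ?n x)" for b :: 'a and x
    have "(z \<bullet> c)\<^sup>2 * heat_kernel s z = (\<Prod>b\<in>Basis. f b (z \<bullet> b))" for z :: 'a
    proof -
      have "(\<Prod>b\<in>Basis. f b (z \<bullet> b)) = (\<Prod>b\<in>Basis. ?n (z \<bullet> b) * (if b = c then (z \<bullet> b)\<^sup>2 else 1))"
        by (intro prod.cong) (auto simp: f_def)
      also have "\<dots> = heat_kernel s z * (z \<bullet> c)\<^sup>2"
        using c by (simp add: prod.distrib heat_kernel_eq_prod[OF assms])
      finally show ?thesis by simp
    qed
    then have "(\<integral>\<^sup>+ z. ennreal ((z \<bullet> c)\<^sup>2 * heat_kernel s (z :: 'a)) \<partial>lborel) =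
        (\<integral>\<^sup>+ z. (\<Prod>b\<in>Basis. ennreal (f b ((z :: 'a) \<bullet> b))) \<partial>lborel)"
      by (simp add: prod_ennreal f_def)
    also have "\<dots> = (\<Prod>b\<in>Basis. (\<integral>\<^sup>+ x. ennreal (f b x) \<partial>lborel))"
      by (subst nn_integral_lborel_prod) (auto simp: f_def)
    also have "\<dots> = (\<Prod>b\<in>Basis. if b = c then ennreal (2 * s) else 1)"
      by (intro prod.cong) (auto simp: f_def 1 2)
    also have "\<dots> = ennreal (2 * s)" using c by simp
    finally show ?thesis .
  qed
  have m: "heat_kernel s \<in> borel_measurable (borel :: 'a measure)"
    unfolding heat_kernel_def by measurable
  have "(norm z)\<^sup>2 = (\<Sum>c\<in>Basis. (z \<bullet> c)\<^sup>2)" for z :: 'a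
    unfolding power2_norm_eq_inner euclidean_inner[of z z] by (simp add: power2_eq_square)
  then have "ennreal ((norm z)\<^sup>2 * heat_kernel s z) = (\<Sum>c\<in>Basis. ennreal ((z \<bullet> c)\<^sup>2 * heat_kernel s z))" for z :: 'a
    by (simp add: sum_distrib_right sum_ennreal heat_kernel_nonneg)
  then have "(\<integral>\<^sup>+ z. ennreal ((norm z)\<^sup>2 * heat_kernel s (z :: 'a)) \<partial>lborel) =
     (\<Sum>c\<in>Basis. \<integral>\<^sup>+ z. ennreal ((z \<bullet> c)\<^sup>2 * heat_kernel s (z :: 'a)) \<partial>lborel)"
    using m by (simp add: nn_integral_sum)
  also have "\<dots> = (\<Sum>c\<in>(Basis :: 'a set). ennreal (2 * s))"
    by (intro sum.cong refl one)
  also have "\<dots> = ennreal (2 * real DIM('a) * s)"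
    using assms by (simp add: one ennreal_of_nat_eq_real_of_nat ennreal_mult[symmetric] mult_ac)
  finally show ?thesis .
qed

section \<open>The jump kernel\<close>

text \<open>A completely monotone Levy density that does not vanish identically; by
  \<open>completely_monotone_zero_spreads\<close> it then has no zeros.\<close>

locale cm_levy_density =
  fixes \<nu> :: "real \<Rightarrow> real"
  assumes cm: "completely_monotone \<nu>"
    and levy: "levy_density \<nu>"
    and pos: "\<And>s. s > 0 \<Longrightarrow> \<nu> s > 0"
begin

text \<open>The density extended by \<open>0\<close>. It is a Borel function on the line, so that Lebesgue integrals over the
  half line become integrals with respect to \<open>lborel\<close>, for which Tonelli's theorem is available.\<close>

definition ext :: "real \<Rightarrow> real" where
  "ext s = indicator {0<..} s * \<nu> s"

lemma ext_nonneg: "0 \<le> ext s"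
  using pos[of s] by (auto simp: ext_def indicator_def)

lemma ext_measurable [measurable]: "ext \<in> borel_measurable borel"
  using borel_measurable_continuous_on_indicator[OF _ completely_monotone_continuous_on[OF cm]]
  by (simp add: ext_def[abs_def])

lemma ext_integrable: "integrable lborel (\<lambda>s. min 1 s * ext s)"
proof -
  have "integrable lebesgue (\<lambda>s. min 1 s * ext s)"
    using levy unfolding levy_density_def set_integrable_def ext_def by (simp add: mult_ac)
  then show ?thesis by (subst (asm) integrable_completion) auto
qed

text \<open>The integrand in the definition of the jump kernel \<open>j(r)\<close> in dimension \<open>d\<close>.\<close>

definition dens :: "nat \<Rightarrow> real \<Rightarrow> real \<Rightarrow> real" where
  "dens d r s = (4 * pi * s) powr (- real d / 2) * exp (- r\<^sup>2 / (4 * s)) * ext s"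

lemma dens_nonneg: "0 \<le> dens d r s"
  by (simp add: dens_def ext_nonneg)

lemma dens_measurable [measurable]: "(\<lambda>(r, s). dens d r s) \<in> borel_measurable (borel \<Otimes>\<^sub>M borel)"
  unfolding dens_def by measurable

lemma dens_measurable1 [measurable]: "dens d r \<in> borel_measurable borel"
  unfolding dens_def[abs_def] by measurable

lemma dens_le:
  assumes "c > 0"
  shows "\<exists>C>0. \<forall>r s. r\<^sup>2 / 4 \<ge> c \<longrightarrow> dens d r s \<le> C * (min 1 s * ext s)"
proof -
  obtain C where C: "C > 0" "\<And>s. s > 0 \<Longrightarrow> (4 * pi * s) powr (- real d / 2) * exp (- (c / s)) \<le> C * min 1 s"
    using heat_factor_le[OF assms, of d] by auto
  have "dens d r s \<le> C * (min 1 s * ext s)" if "r\<^sup>2 / 4 \<ge> c" for r s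
  proof (cases "s > 0")
    case True
    have "exp (- r\<^sup>2 / (4 * s)) \<le> exp (- (c / s))"
      using True that by (simp add: field_simps)
    then have "(4 * pi * s) powr (- real d / 2) * exp (- r\<^sup>2 / (4 * s)) \<le> C * min 1 s"
      using C(2)[OF True] by (meson mult_left_mono order_trans powr_ge_zero)
    from mult_right_mono[OF this ext_nonneg[of s]] show ?thesis
      unfolding dens_def by (simp add: mult.assoc)
  next
    case False
    then show ?thesis by (simp add: dens_def ext_def)
  qed
  then show ?thesis using C(1) by auto
qed

lemma dens_integrable:
  assumes "r \<noteq> 0"
  shows "integrable lborel (dens d r)"
proof -
  obtain C where C: "\<And>s. dens d r s \<le> C * (min 1 s * ext s)"
    using dens_le[of "r\<^sup>2 / 4" d] assms by auto
  show ?thesis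
  proof (rule Bochner_Integration.integrable_bound)
    show "integrable lborel (\<lambda>s. C * (min 1 s * ext s))" using ext_integrable by simp
    show "AE s in lborel. norm (dens d r s) \<le> norm (C * (min 1 s * ext s))"
      using C dens_nonneg by (intro always_eventually) (smt (verit) real_norm_def)
  qed simp
qed

lemma jump_kernel_eq: "jump_kernel d \<nu> r = (LBINT s. dens d r s)"
proof -
  have "jump_kernel d \<nu> r = (\<integral>s. dens d r s \<partial>lebesgue)"
    unfolding jump_kernel_def set_lebesgue_integral_def dens_def ext_def
    by (intro Bochner_Integration.integral_cong) (auto simp: indicator_def)
  then show ?thesis by (simp add: integral_completion)
qed

lemma jump_kernel_measurable [measurable]: "jump_kernel d \<nu> \<in> borel_measurable borel"
proof -
  have "(\<lambda>r. LBINT s. dens d r s) \<in> borel_measurable borel"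
    by (rule lborel.borel_measurable_lebesgue_integral) simp
  then show ?thesis by (simp add: jump_kernel_eq[abs_def])
qed

lemma jump_kernel_nonneg: "0 \<le> jump_kernel d \<nu> r"
  unfolding jump_kernel_eq by (intro Bochner_Integration.integral_nonneg dens_nonneg)

text \<open>The part \<open>s \<in> [a, a + 1]\<close> of the defining integral.\<close>

lemma jump_kernel_ge:
  assumes "a > 0" "r > 0"
  shows "(4 * pi * (a + 1)) powr (- real d / 2) * exp (- r\<^sup>2 / (4 * a)) * \<nu> (a + 1) \<le> jump_kernel d \<nu> r"
proof -
  let ?c = "(4 * pi * (a + 1)) powr (- real d / 2) * exp (- r\<^sup>2 / (4 * a)) * \<nu> (a + 1)"
  have "?c = (LBINT s. ?c * indicator {a..a+1} s)"
    by simp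
  also have "\<dots> \<le> (LBINT s. dens d r s)"
  proof (rule integral_mono)
    show "integrable lborel (\<lambda>s. ?c * indicator {a..a + 1} s)"
      by (intro integrable_mult_right) (simp add: integrable_indicator_iff)
    show "integrable lborel (dens d r)" using assms by (intro dens_integrable) simp
    fix s
    show "?c * indicator {a..a + 1} s \<le> dens d r s"
    proof (cases "s \<in> {a..a+1}")
      case True
      have "(4 * pi * (a + 1)) powr (- real d / 2) \<le> (4 * pi * s) powr (- real d / 2)"
        using True assms by (intro powr_mono2') auto
      moreover have "exp (- r\<^sup>2 / (4 * a)) \<le> exp (- r\<^sup>2 / (4 * s))"
        using True assms by (simp add: frac_le)
      moreover have "\<nu> (a + 1) \<le> ext s"
        using True assms completely_monotone_antimono[OF cm, of s "a + 1"] by (simp add: ext_def)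
      ultimately have "?c \<le> dens d r s"
        unfolding dens_def using pos[of "a + 1"] assms by (intro mult_mono) auto
      then show ?thesis using True by simp
    next
      case False
      then show ?thesis by (simp add: dens_nonneg)
    qed
  qed
  finally show ?thesis by (simp add: jump_kernel_eq)
qed

lemma jump_kernel_pos:
  assumes "r > 0"
  shows "0 < jump_kernel d \<nu> r"
proof -
  have "0 < (4 * pi * (1 + 1)) powr (- real d / 2) * exp (- r\<^sup>2 / (4 * 1)) * \<nu> (1 + 1)"
    using pos[of 2] by simp
  then show ?thesis
    using jump_kernel_ge[of 1 r d] assms by linarith
qed

lemma jump_kernel_antimono:
  assumes "0 < r" "r \<le> r'"
  shows "jump_kernel d \<nu> r' \<le> jump_kernel d \<nu> r"
  unfolding jump_kernel_eq
proof (rule integral_mono)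
  fix s
  show "dens d r' s \<le> dens d r s"
  proof (cases "s > 0")
    case True
    have "r\<^sup>2 \<le> r'\<^sup>2" using assms by (intro power_mono) auto
    then have "exp (- r'\<^sup>2 / (4 * s)) \<le> exp (- r\<^sup>2 / (4 * s))"
      using True by (simp add: divide_right_mono)
    then show ?thesis
      unfolding dens_def using ext_nonneg by (intro mult_right_mono mult_left_mono) auto
  next
    case False
    then show ?thesis by (simp add: dens_def ext_def)
  qed
qed (use assms in \<open>auto intro: dens_integrable\<close>)

text \<open>The inequality \<open>j(r) \<le> C j(r + 1)\<close> is obtained from a pointwise bound of the integrands. For \<open>s > r / 3\<close>
  the Gaussian factors at \<open>r\<close> and \<open>r + 1\<close> are comparable. For \<open>1/6 < s \<le> r / 3\<close> the integrand of \<open>j(r)\<close> at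
  \<open>s\<close> is compared with the integrand of \<open>j(r + 1)\<close> at \<open>s + 1\<close>: there \<open>(r + 1)\<^sup>2 / (s + 1) \<le> r\<^sup>2 / s\<close>, and
  \<open>\<nu>(s) \<le> C \<nu>(s + 1)\<close> holds by complete monotonicity. For \<open>s \<le> 1/6\<close>, where \<open>\<nu>\<close> may be singular, the Gaussian
  factor is so small that the contribution is at most a multiple of \<open>exp (- (r + 1)\<^sup>2 / (4 \<cdot> 7/6))\<close>, which
  the range \<open>s \<in> [7/6, 13/6]\<close> of \<open>j(r + 1)\<close> dominates.\<close>

lemma jump_kernel_le_shift:
  "\<exists>C>0. \<forall>r\<ge>1. jump_kernel d \<nu> r \<le> C * jump_kernel d \<nu> (r + 1)"
proof -
  define p where "p s = (4 * pi * s) powr (- real d / 2)" for s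
  obtain C0 where C0: "C0 > 0" "\<And>s. s \<ge> 1/6 \<Longrightarrow> \<nu> s \<le> C0 * \<nu> (s + 1)"
    using completely_monotone_shift_comparison[OF cm, of "1/6"] pos[of "1/6"] by auto
  obtain C1 where C1: "C1 > 0" "\<And>s. s > 0 \<Longrightarrow> p s * exp (- (3 / 28 / s)) \<le> C1 * min 1 s"
    using heat_factor_le[of "3/28" d] by (auto simp: p_def)
  define I where "I = (LBINT s. min 1 s * ext s)"
  have I: "0 \<le> I"
    unfolding I_def by (intro Bochner_Integration.integral_nonneg) (simp add: ext_def indicator_def pos less_imp_le)
  define C2 where "C2 = 7 powr (real d / 2) * C0"
  define c3 where "c3 = p (7/6 + 1) * \<nu> (7/6 + 1)"
  have c3: "c3 > 0" using pos by (simp add: c3_def p_def)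
  define E where "E r = exp (- (r + 1)\<^sup>2 / (4 * (7/6)))" for r :: real
  have key: "dens d r s \<le> exp (9/4) * dens d (r + 1) s + C2 * dens d (r + 1) (s + 1) + C1 * E r * (min 1 s * ext s)"
    if r: "r \<ge> 1" for r s
  proof (cases "s > 0")
    case False
    then have "dens d r s = 0" "ext s = 0" by (auto simp: dens_def ext_def)
    then show ?thesis using dens_nonneg C0 by (simp add: C2_def)
  next
    case s: True
    have n1: "0 \<le> exp (9/4) * dens d (r + 1) s" using dens_nonneg by simp
    have n2: "0 \<le> C2 * dens d (r + 1) (s + 1)" using dens_nonneg C0 by (simp add: C2_def)
    have n3: "0 \<le> C1 * E r * (min 1 s * ext s)" using ext_nonneg s C1 by (simp add: E_def)
    have rr: "r \<le> r\<^sup>2" using r by (simp add: power2_eq_square)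
    consider "s \<le> 1/6" | "1/6 < s" "s \<le> r / 3" | "s > r / 3" by linarith
    then show ?thesis
    proof cases
      case 1
      have "- r\<^sup>2 / (4 * s) \<le> - (3 / 28 / s) - (r + 1)\<^sup>2 / (4 * (7/6))"
      proof -
        have "(r + 1)\<^sup>2 \<le> (2 * r)\<^sup>2" using r by (intro power_mono) auto
        then have a: "(r + 1)\<^sup>2 / (4 * (7/6)) \<le> 6 / 7 * r\<^sup>2" by simp
        have "r\<^sup>2 * (24 * s) \<le> r\<^sup>2 * 4" using 1 by (intro mult_left_mono) auto
        then have b: "6 / 7 * r\<^sup>2 \<le> 4 / 7 * (r\<^sup>2 / (4 * s))" using s by (simp add: field_simps)
        have "1 \<le> r\<^sup>2" using r rr by linarith
        then have c: "3 / 28 / s \<le> 3 / 7 * (r\<^sup>2 / (4 * s))" using s by (simp add: field_simps)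
        show ?thesis using a b c by linarith
      qed
      then have "exp (- r\<^sup>2 / (4 * s)) \<le> exp (- (3 / 28 / s)) * E r"
        unfolding E_def exp_add[symmetric] by simp
      then have "p s * exp (- r\<^sup>2 / (4 * s)) \<le> p s * (exp (- (3 / 28 / s)) * E r)"
        by (intro mult_left_mono) (simp_all add: p_def)
      also have "\<dots> \<le> C1 * min 1 s * E r"
        using mult_right_mono[OF C1(2)[OF s], of "E r"] by (simp add: E_def mult.assoc)
      finally have "dens d r s \<le> C1 * min 1 s * E r * ext s"
        unfolding dens_def p_def[symmetric] using ext_nonneg by (intro mult_right_mono) auto
      then show ?thesis using n1 n2 by (simp add: mult_ac)
    next
      case 2
      have "(s + 1) / 7 \<le> s" using 2 by simp
      then have "p s \<le> (4 * pi * ((s + 1) / 7)) powr (- real d / 2)"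
        unfolding p_def using s by (intro powr_mono2') auto
      also have "\<dots> = 7 powr (real d / 2) * p (s + 1)"
        unfolding p_def using s by (simp add: powr_divide powr_minus field_simps powr_mult)
      finally have a: "p s \<le> 7 powr (real d / 2) * p (s + 1)" .
      have "s * (2 * r + 1) \<le> s * (3 * r)" using s r by (intro mult_left_mono) auto
      also have "\<dots> \<le> r / 3 * (3 * r)" using 2 r by (intro mult_right_mono) auto
      finally have "s * (r + 1)\<^sup>2 \<le> (s + 1) * r\<^sup>2"
        by (simp add: power2_eq_square algebra_simps)
      then have b: "exp (- r\<^sup>2 / (4 * s)) \<le> exp (- (r + 1)\<^sup>2 / (4 * (s + 1)))"
        using s by (simp add: divide_simps) (simp add: algebra_simps)
      have c: "ext s \<le> C0 * ext (s + 1)" using C0(2)[of s] 2 s by (simp add: ext_def)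
      have "dens d r s \<le> (7 powr (real d / 2) * p (s + 1)) * exp (- (r + 1)\<^sup>2 / (4 * (s + 1))) * (C0 * ext (s + 1))"
        unfolding dens_def p_def[symmetric] using a b c ext_nonneg
        by (intro mult_mono) (auto simp: p_def)
      also have "\<dots> = C2 * dens d (r + 1) (s + 1)"
        by (simp add: C2_def dens_def p_def)
      finally show ?thesis using n1 n3 by simp
    next
      case 3
      have "- r\<^sup>2 / (4 * s) \<le> 9/4 + - (r + 1)\<^sup>2 / (4 * s)"
        using 3 s r by (simp add: field_simps power2_eq_square)
      then have "exp (- r\<^sup>2 / (4 * s)) \<le> exp (9/4) * exp (- (r + 1)\<^sup>2 / (4 * s))"
        unfolding exp_add[symmetric] by simp
      then have "dens d r s \<le> (4 * pi * s) powr (- real d / 2) * (exp (9/4) * exp (- (r + 1)\<^sup>2 / (4 * s))) * ext s"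
        unfolding dens_def using ext_nonneg by (intro mult_right_mono mult_left_mono) auto
      also have "\<dots> = exp (9/4) * dens d (r + 1) s" by (simp add: dens_def)
      finally show ?thesis using n2 n3 by simp
    qed
  qed
  define C where "C = exp (9/4) + C2 + C1 * I / c3"
  have "jump_kernel d \<nu> r \<le> C * jump_kernel d \<nu> (r + 1)" if r: "r \<ge> 1" for r
  proof -
    have i1: "integrable lborel (dens d r)" "integrable lborel (dens d (r + 1))"
      using r by (auto intro!: dens_integrable)
    have i2: "integrable lborel (\<lambda>s. dens d (r + 1) (s + 1))"
      using lborel_integrable_real_affine[OF i1(2), of 1 1] by (simp add: add.commute)
    have shift: "(LBINT s. dens d (r + 1) (s + 1)) = jump_kernel d \<nu> (r + 1)"
      unfolding jump_kernel_eq using lborel_integral_real_affine[of 1 "dens d (r + 1)" 1] by (simp add: add.commute)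
    have "jump_kernel d \<nu> r \<le> (LBINT s. exp (9/4) * dens d (r + 1) s + C2 * dens d (r + 1) (s + 1) + C1 * E r * (min 1 s * ext s))"
      unfolding jump_kernel_eq
      using key[OF r] i1 i2 ext_integrable
      by (intro integral_mono Bochner_Integration.integrable_add integrable_mult_right) auto
    also have "\<dots> = exp (9/4) * jump_kernel d \<nu> (r + 1) + C2 * jump_kernel d \<nu> (r + 1) + C1 * E r * I"
      using i1 i2 ext_integrable shift unfolding I_def by (simp add: jump_kernel_eq)
    also have "E r \<le> jump_kernel d \<nu> (r + 1) / c3"
      using jump_kernel_ge[of "7/6" "r + 1" d] r c3 unfolding c3_def E_def p_def
      by (simp add: field_simps)
    then have "C1 * E r * I \<le> C1 * (jump_kernel d \<nu> (r + 1) / c3) * I"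
      using I C1 by (intro mult_right_mono mult_left_mono) auto
    finally show ?thesis by (simp add: C_def algebra_simps)
  qed
  moreover have "C > 0"
    using C0 C1 I c3 by (simp add: C_def C2_def add_pos_nonneg)
  ultimately show ?thesis by blast
qed

lemma jump_kernel_comparison:
  assumes "\<delta> > 0"
  shows "\<exists>C>0. \<forall>r>\<delta>. jump_kernel d \<nu> r \<le> C * jump_kernel d \<nu> (r + real n)"
proof -
  obtain C where C: "C > 0" "\<And>r. r \<ge> 1 \<Longrightarrow> jump_kernel d \<nu> r \<le> C * jump_kernel d \<nu> (r + 1)"
    using jump_kernel_le_shift[of d] by auto
  have far: "jump_kernel d \<nu> r \<le> C ^ n * jump_kernel d \<nu> (r + real n)" if "r \<ge> 1" for r n
  proof (induction n)
    case (Suc n)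
    have "jump_kernel d \<nu> (r + real n) \<le> C * jump_kernel d \<nu> (r + real n + 1)"
      using that by (intro C) auto
    then have "C ^ n * jump_kernel d \<nu> (r + real n) \<le> C ^ n * (C * jump_kernel d \<nu> (r + real n + 1))"
      using C(1) by (intro mult_left_mono) auto
    with Suc show ?case by (simp add: algebra_simps)
  qed simp
  define C' where "C' = max (C ^ n) (jump_kernel d \<nu> \<delta> / jump_kernel d \<nu> (1 + real n))"
  have "jump_kernel d \<nu> r \<le> C' * jump_kernel d \<nu> (r + real n)" if "r > \<delta>" for r
  proof (cases "r \<ge> 1")
    case True
    have "C ^ n * jump_kernel d \<nu> (r + real n) \<le> C' * jump_kernel d \<nu> (r + real n)"
      by (intro mult_right_mono jump_kernel_nonneg) (simp add: C'_def)
    then show ?thesis using far[OF True, of n] by linarith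
  next
    case False
    have p: "0 < jump_kernel d \<nu> (1 + real n)" by (intro jump_kernel_pos) simp
    have "jump_kernel d \<nu> r \<le> jump_kernel d \<nu> \<delta>"
      using that assms by (intro jump_kernel_antimono) auto
    also have "\<dots> = jump_kernel d \<nu> \<delta> / jump_kernel d \<nu> (1 + real n) * jump_kernel d \<nu> (1 + real n)"
      using p by simp
    also have "\<dots> \<le> C' * jump_kernel d \<nu> (r + real n)"
      using False that assms C by (intro mult_mono jump_kernel_antimono jump_kernel_nonneg) (auto simp: C'_def le_max_iff_disj)
    finally show ?thesis .
  qed
  moreover have "C' > 0" using C by (simp add: C'_def less_max_iff_disj)
  ultimately show ?thesis by blast
qed

text \<open>By Tonelli's theorem and the second moment of the heat kernel, the integral is at most
  \<open>2 d \<integral> (1 \<and> s) \<nu>(s) ds\<close>.\<close>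

lemma integrable_min_square_jump_kernel:
  "integrable lborel (\<lambda>z :: 'a::euclidean_space. min 1 ((norm z)\<^sup>2) * jump_kernel DIM('a) \<nu> (norm z))"
proof (rule integrableI_bounded)
  let ?D = "DIM('a)"
  have m [measurable]: "(\<lambda>(z :: 'a, s). dens ?D (norm z) s) \<in> borel_measurable (borel \<Otimes>\<^sub>M borel)"
    unfolding dens_def by measurable
  have "(\<integral>\<^sup>+ z. ennreal (norm (min 1 ((norm (z :: 'a))\<^sup>2) * jump_kernel ?D \<nu> (norm z))) \<partial>lborel)
      = (\<integral>\<^sup>+ z. (\<integral>\<^sup>+ s. ennreal (min 1 ((norm (z :: 'a))\<^sup>2) * dens ?D (norm z) s) \<partial>lborel) \<partial>lborel)"
  proof (intro nn_integral_cong)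
    fix z :: 'a
    show "ennreal (norm (min 1 ((norm z)\<^sup>2) * jump_kernel ?D \<nu> (norm z))) =
        (\<integral>\<^sup>+ s. ennreal (min 1 ((norm z)\<^sup>2) * dens ?D (norm z) s) \<partial>lborel)"
    proof (cases "z = 0")
      case False
      then have "integrable lborel (dens ?D (norm z))" by (intro dens_integrable) simp
      then show ?thesis
        by (subst nn_integral_eq_integral)
          (auto simp: dens_nonneg jump_kernel_eq intro!: abs_of_nonneg mult_nonneg_nonneg Bochner_Integration.integral_nonneg)
    qed simp
  qed
  also have "\<dots> = (\<integral>\<^sup>+ s. (\<integral>\<^sup>+ z. ennreal (min 1 ((norm (z :: 'a))\<^sup>2) * dens ?D (norm z) s) \<partial>lborel) \<partial>lborel)"
    by (rule lborel_pair.Fubini'[symmetric]) measurable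
  also have "\<dots> \<le> (\<integral>\<^sup>+ s. ennreal (2 * real ?D * (min 1 s * ext s)) \<partial>lborel)"
  proof (intro nn_integral_mono)
    fix s
    show "(\<integral>\<^sup>+ z. ennreal (min 1 ((norm (z :: 'a))\<^sup>2) * dens ?D (norm z) s) \<partial>lborel)
       \<le> ennreal (2 * real ?D * (min 1 s * ext s))"
    proof (cases "s > 0")
      case False
      then show ?thesis by (simp add: dens_def ext_def)
    next
      case True
      have hm [measurable]: "heat_kernel s \<in> borel_measurable (borel :: 'a measure)"
        unfolding heat_kernel_def by measurable
      have "(\<integral>\<^sup>+ z. ennreal (min 1 ((norm (z :: 'a))\<^sup>2) * heat_kernel s z) \<partial>lborel) \<le> 1"
        unfolding nn_integral_heat_kernel[OF True, where 'a='a, symmetric]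
        by (intro nn_integral_mono ennreal_leI mult_left_le_one_le heat_kernel_nonneg) auto
      moreover have "(\<integral>\<^sup>+ z. ennreal (min 1 ((norm (z :: 'a))\<^sup>2) * heat_kernel s z) \<partial>lborel) \<le> ennreal (2 * real ?D * s)"
        unfolding nn_integral_heat_kernel_second_moment[OF True, where 'a='a, symmetric]
        by (intro nn_integral_mono ennreal_leI mult_right_mono heat_kernel_nonneg) auto
      ultimately have "(\<integral>\<^sup>+ z. ennreal (min 1 ((norm (z :: 'a))\<^sup>2) * heat_kernel s z) \<partial>lborel) \<le> ennreal (min 1 (2 * real ?D * s))"
        by (simp add: min_def)
      also have "\<dots> \<le> ennreal (2 * real ?D * min 1 s)"
        using True DIM_positive[where 'a='a]
        by (intro ennreal_leI) (smt (verit, best) mult_left_mono mult_le_cancel_left1 of_nat_0_le_iff of_nat_1 of_nat_le_iff Suc_leI One_nat_def)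
      finally have b: "(\<integral>\<^sup>+ z. ennreal (min 1 ((norm (z :: 'a))\<^sup>2) * heat_kernel s z) \<partial>lborel) \<le> ennreal (2 * real ?D * min 1 s)" .
      have "(\<integral>\<^sup>+ z. ennreal (min 1 ((norm (z :: 'a))\<^sup>2) * dens ?D (norm z) s) \<partial>lborel)
        = (\<integral>\<^sup>+ z. ennreal (ext s) * ennreal (min 1 ((norm (z :: 'a))\<^sup>2) * heat_kernel s z) \<partial>lborel)"
        by (intro nn_integral_cong) (simp add: ennreal_mult'[symmetric] ext_nonneg dens_def heat_kernel_def mult_ac)
      also have "\<dots> = ennreal (ext s) * (\<integral>\<^sup>+ z. ennreal (min 1 ((norm (z :: 'a))\<^sup>2) * heat_kernel s z) \<partial>lborel)"
        by (rule nn_integral_cmult) measurable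
      also have "\<dots> \<le> ennreal (ext s) * ennreal (2 * real ?D * min 1 s)"
        by (intro mult_left_mono b) simp
      finally show ?thesis
        using True by (simp add: ennreal_mult'[symmetric] ext_nonneg mult_ac)
    qed
  qed
  also have "\<dots> < \<infinity>"
  proof -
    have "integrable lborel (\<lambda>s. 2 * real ?D * (min 1 s * ext s))"
      using ext_integrable by simp
    moreover have "0 \<le> 2 * real ?D * (min 1 s * ext s)" for s
      by (simp add: ext_def indicator_def pos less_imp_le)
    ultimately show ?thesis
      by (subst nn_integral_eq_integral) auto
  qed
  finally show "(\<integral>\<^sup>+ z. ennreal (norm (min 1 ((norm (z :: 'a))\<^sup>2) * jump_kernel ?D \<nu> (norm z))) \<partial>lborel) < \<infinity>" .
qed measurable

end

section \<open>Convolutions and functions of compact support\<close>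

lemma distr_lborel_minus:
  fixes a :: "'a::euclidean_space"
  shows "distr lborel borel (\<lambda>x. a - x) = lborel"
  using lborel_affine[of "-1" a] by (simp add: density_1)

lemma lborel_integral_translate:
  fixes f :: "'a::euclidean_space \<Rightarrow> real"
  assumes [measurable]: "f \<in> borel_measurable borel"
  shows "(LBINT x. f (a + x)) = (LBINT x. f x)"
  by (subst (2) lborel_distr_plus[of a, symmetric]) (simp add: integral_distr)

lemma lborel_integral_reflect:
  fixes f :: "'a::euclidean_space \<Rightarrow> real"
  assumes [measurable]: "f \<in> borel_measurable borel"
  shows "(LBINT x. f (a - x)) = (LBINT x. f x)"
  by (subst (2) distr_lborel_minus[of a, symmetric]) (simp add: integral_distr)

lemma lborel_integrable_translate:
  fixes f :: "'a::euclidean_space \<Rightarrow> real"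
  assumes "integrable lborel f"
  shows "integrable lborel (\<lambda>x. f (a + x))"
proof -
  have "integrable (distr lborel borel ((+) a)) f"
    unfolding lborel_distr_plus by (rule assms)
  then show ?thesis by (rule integrable_distr[rotated]) simp
qed

lemma lborel_integrable_reflect:
  fixes f :: "'a::euclidean_space \<Rightarrow> real"
  assumes "integrable lborel f"
  shows "integrable lborel (\<lambda>x. f (a - x))"
proof -
  have "integrable (distr lborel borel (\<lambda>x. a - x)) f"
    unfolding distr_lborel_minus by (rule assms)
  then show ?thesis by (rule integrable_distr[rotated]) simp
qed

lemma integrable_pair_mult:
  fixes f g :: "'a::euclidean_space \<Rightarrow> real"
  assumes f: "integrable lborel f" and g: "integrable lborel g"
  shows "integrable (lborel \<Otimes>\<^sub>M lborel) (\<lambda>(x, y). f x * g y)"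
proof (rule lborel_pair.Fubini_integrable)
  have [measurable]: "f \<in> borel_measurable borel" "g \<in> borel_measurable borel"
    using f g by auto
  show "(\<lambda>(x, y). f x * g y) \<in> borel_measurable (lborel \<Otimes>\<^sub>M lborel)" by measurable
  show "integrable lborel (\<lambda>x. LBINT y. norm (case (x, y) of (x, y) \<Rightarrow> f x * g y))"
    using f g by (simp add: abs_mult)
  show "AE x in lborel. integrable lborel (\<lambda>y. case (x, y) of (x, y) \<Rightarrow> f x * g y)"
    using g by simp
qed

lemma integrable_pair_convolution:
  fixes f g :: "'a::euclidean_space \<Rightarrow> real"
  assumes f: "integrable lborel f" and g: "integrable lborel g"
  shows "integrable (lborel \<Otimes>\<^sub>M lborel) (\<lambda>(x, y). f x * g (y - x))"
proof (rule lborel_pair.Fubini_integrable)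
  have [measurable]: "f \<in> borel_measurable borel" "g \<in> borel_measurable borel"
    using f g by auto
  show "(\<lambda>(x, y). f x * g (y - x)) \<in> borel_measurable (lborel \<Otimes>\<^sub>M lborel)" by measurable
  have "(LBINT y. \<bar>g (y - x)\<bar>) = (LBINT y. \<bar>g y\<bar>)" for x
    using lborel_integral_translate[of "\<lambda>y. \<bar>g y\<bar>" "- x"] by simp
  then show "integrable lborel (\<lambda>x. LBINT y. norm (case (x, y) of (x, y) \<Rightarrow> f x * g (y - x)))"
    using f by (simp add: abs_mult)
  show "AE x in lborel. integrable lborel (\<lambda>y. case (x, y) of (x, y) \<Rightarrow> f x * g (y - x))"
    using lborel_integrable_translate[OF g, of "- _"] by simp
qed

lemma integrable_bounded_support:
  fixes g :: "'a::euclidean_space \<Rightarrow> real"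
  assumes [measurable]: "g \<in> borel_measurable borel"
    and "\<And>x. \<bar>g x\<bar> \<le> B" and "\<And>x. norm x > r \<Longrightarrow> g x = 0"
  shows "integrable lborel g"
proof (rule Bochner_Integration.integrable_bound[where f="\<lambda>x. B * indicator (cball 0 r) x"])
  show "integrable lborel (\<lambda>x. B * indicator (cball (0 :: 'a) r) x)"
    using emeasure_compact_finite[of "cball (0 :: 'a) r"]
    by (intro integrable_mult_right) (simp add: integrable_indicator_iff)
  show "AE x in lborel. norm (g x) \<le> norm (B * indicator (cball 0 r) x)"
    using assms(2,3) by (intro always_eventually allI) (auto simp: indicator_def intro: order_trans[OF _ abs_ge_self])
qed simp

text \<open>Convolution of functions; the value is \<open>0\<close> at points where the integral diverges.\<close>

definition conv :: "('a::euclidean_space \<Rightarrow> real) \<Rightarrow> ('a \<Rightarrow> real) \<Rightarrow> 'a \<Rightarrow> real" where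
  "conv f g x = (LBINT y. f y * g (x - y))"

text \<open>Bounded Borel functions supported in the ball of radius \<open>r\<close>; no sign or smoothness is required.\<close>

definition bump :: "real \<Rightarrow> ('a::euclidean_space \<Rightarrow> real) \<Rightarrow> bool" where
  "bump r g \<longleftrightarrow> g \<in> borel_measurable borel \<and> (\<exists>B. \<forall>x. \<bar>g x\<bar> \<le> B) \<and> (\<forall>x. norm x > r \<longrightarrow> g x = 0)"

text \<open>Of the smoothness of a test function only a quadratic bound for second differences is used: it makes
  the singular integral converge after symmetrisation.\<close>

definition tame :: "real \<Rightarrow> ('a::euclidean_space \<Rightarrow> real) \<Rightarrow> bool" where
  "tame r g \<longleftrightarrow> bump r g \<and> (\<exists>M. \<forall>x z. \<bar>g (x + z) + g (x - z) - 2 * g x\<bar> \<le> M * (norm z)\<^sup>2)"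

lemma bump_integrable: "bump r g \<Longrightarrow> integrable lborel g"
  unfolding bump_def by (elim conjE exE) (rule integrable_bounded_support, auto)

section \<open>Truncated nonlocal operators\<close>

text \<open>A symmetric jump kernel \<open>J\<close> together with a weight \<open>W\<close> that controls it away from the origin and is
  comparable with its translates. The weight is finite and continuous everywhere, while \<open>J\<close> may be
  singular at the origin.\<close>

locale nonlocal_kernel =
  fixes J W :: "'a::euclidean_space \<Rightarrow> real"
  assumes J_measurable [measurable]: "J \<in> borel_measurable borel"
    and J_nonneg: "\<And>z. 0 \<le> J z"
    and J_even: "\<And>z. J (- z) = J z"
    and J_integrable: "integrable lborel (\<lambda>z. min 1 ((norm z)\<^sup>2) * J z)"
    and W_continuous: "\<And>x. isCont W x"
    and W_pos: "\<And>x. 0 < W x"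
    and W_even: "\<And>x. W (- x) = W x"
    and W_integrable: "integrable lborel W"
    and W_shift: "\<And>R. \<exists>C>0. \<forall>x h. norm h \<le> R \<longrightarrow> W (x + h) \<le> C * W x"
    and J_le_W: "\<And>\<delta>. 0 < \<delta> \<Longrightarrow> \<exists>C>0. \<forall>z. \<delta> < norm z \<longrightarrow> J z \<le> C * W z"
begin

text \<open>The kernel without the jumps of length at most \<open>\<delta>\<close>.\<close>

definition K :: "real \<Rightarrow> 'a \<Rightarrow> real" where
  "K \<delta> z = indicator {z. \<delta> < norm z} z * J z"

text \<open>Borel functions that are integrable with respect to the weight \<open>W\<close>.\<close>

definition wL1 :: "('a \<Rightarrow> real) \<Rightarrow> bool" where
  "wL1 f \<longleftrightarrow> f \<in> borel_measurable borel \<and> integrable lborel (\<lambda>x. f x * W x)"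

text \<open>The operator with kernel \<open>K \<delta>\<close>.\<close>

definition trunc :: "real \<Rightarrow> ('a \<Rightarrow> real) \<Rightarrow> 'a \<Rightarrow> real" where
  "trunc \<delta> f x = (LBINT z. (f (x + z) - f x) * K \<delta> z)"

text \<open>The operator with the full kernel, symmetrised: for tame functions the integral converges
  absolutely, and no principal value is needed.\<close>

definition Lop :: "('a \<Rightarrow> real) \<Rightarrow> 'a \<Rightarrow> real" where
  "Lop f x = (LBINT z. (f (x + z) + f (x - z) - 2 * f x) * J z) / 2"

lemma W_measurable [measurable]: "W \<in> borel_measurable borel"
  by (intro borel_measurable_continuous_onI continuous_at_imp_continuous_on ballI W_continuous)

lemma K_measurable [measurable]: "K \<delta> \<in> borel_measurable borel"
  unfolding K_def[abs_def] by measurable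

lemma K_nonneg: "0 \<le> K \<delta> z"
  by (simp add: K_def J_nonneg)

lemma K_even: "K \<delta> (- z) = K \<delta> z"
  by (simp add: K_def J_even indicator_def)

lemma K_le_W:
  assumes "\<delta> > 0"
  shows "\<exists>C>0. \<forall>z. K \<delta> z \<le> C * W z"
proof -
  obtain C where C: "C > 0" "\<And>z. \<delta> < norm z \<Longrightarrow> J z \<le> C * W z"
    using J_le_W[OF assms] by auto
  have "K \<delta> z \<le> C * W z" for z
    using C W_pos[of z] by (auto simp: K_def indicator_def)
  then show ?thesis using C(1) by auto
qed

lemma K_integrable:
  assumes "\<delta> > 0"
  shows "integrable lborel (K \<delta>)"
proof -
  obtain C where C: "C > 0" "\<And>z. K \<delta> z \<le> C * W z"
    using K_le_W[OF assms] by auto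
  show ?thesis
    by (rule Bochner_Integration.integrable_bound[where f="\<lambda>z. C * W z"])
      (use C W_integrable K_nonneg in \<open>auto intro: order_trans[OF _ abs_ge_self]\<close>)
qed

lemma W_shift':
  obtains C where "C > 0" "\<And>x y. norm (x - y) \<le> R \<Longrightarrow> W x \<le> C * W y"
proof -
  obtain C where C: "C > 0" "\<And>x h. norm h \<le> R \<Longrightarrow> W (x + h) \<le> C * W x"
    using W_shift[of R] by auto
  show ?thesis
  proof (rule that[OF C(1)])
    fix x y :: 'a assume "norm (x - y) \<le> R"
    then show "W x \<le> C * W y" using C(2)[of "x - y" y] by simp
  qed
qed

lemma wL1_bump:
  assumes "bump r g"
  shows "wL1 g"
proof -
  obtain B where B: "\<And>x. \<bar>g x\<bar> \<le> B" using assms by (auto simp: bump_def)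
  have [measurable]: "g \<in> borel_measurable borel" using assms by (simp add: bump_def)
  have "integrable lborel (\<lambda>x. g x * W x)"
  proof (rule Bochner_Integration.integrable_bound[where f="\<lambda>z. B * W z"])
    show "AE x in lborel. norm (g x * W x) \<le> norm (B * W x)"
      using B W_pos by (intro always_eventually allI)
        (simp add: abs_mult mult_right_mono order_trans[OF _ abs_ge_self])
  qed (use W_integrable in auto)
  then show ?thesis by (simp add: wL1_def)
qed

lemma integrable_bump_mult:
  assumes f: "wL1 f" and g: "bump r g"
  shows "integrable lborel (\<lambda>x. g x * f x)"
proof -
  obtain B where B: "\<And>x. \<bar>g x\<bar> \<le> B" using g by (auto simp: bump_def)
  have [measurable]: "g \<in> borel_measurable borel" "f \<in> borel_measurable borel"
    using f g by (simp_all add: bump_def wL1_def)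
  obtain C where C: "C > 0" "\<And>x y. norm (x - y) \<le> r \<Longrightarrow> W x \<le> C * W y" using W_shift'[of r] by blast
  have b: "\<bar>g x * f x\<bar> \<le> \<bar>(B * C / W 0) * (f x * W x)\<bar>" for x
  proof (cases "norm x > r")
    case True
    then have "g x = 0" using g by (simp add: bump_def)
    then show ?thesis by simp
  next
    case False
    then have "1 \<le> C * W x / W 0" using C(2)[of 0 x] W_pos[of 0] by simp
    moreover have "0 \<le> B" using B[of 0] by linarith
    ultimately have "\<bar>g x\<bar> * \<bar>f x\<bar> * 1 \<le> B * \<bar>f x\<bar> * (C * W x / W 0)"
      using B[of x] C W_pos[of x] by (intro mult_mono) auto
    also have "\<dots> = \<bar>(B * C / W 0) * (f x * W x)\<bar>"
      using C(1) W_pos[of x] W_pos[of 0] \<open>0 \<le> B\<close> by (simp add: abs_mult)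
    finally show ?thesis by (simp add: abs_mult)
  qed
  show ?thesis
  proof (rule Bochner_Integration.integrable_bound)
    show "integrable lborel (\<lambda>x. (B * C / W 0) * (f x * W x))"
      using f by (intro integrable_mult_right) (simp add: wL1_def)
  qed (use b in auto)
qed

text \<open>The bound is \<open>K \<delta> z \<le> C W(z) \<le> C' W(x + z)\<close>, where \<open>C'\<close> depends on \<open>x\<close>.\<close>

lemma integrable_shift_K:
  assumes f: "wL1 f" and "\<delta> > 0"
  shows "integrable lborel (\<lambda>z. f (x + z) * K \<delta> z)"
proof -
  have [measurable]: "f \<in> borel_measurable borel" using f by (simp add: wL1_def)
  obtain C where C: "C > 0" "\<And>z. K \<delta> z \<le> C * W z" using K_le_W[OF assms(2)] by auto
  obtain C' where C': "C' > 0" "\<And>y z. norm (y - z) \<le> norm x \<Longrightarrow> W y \<le> C' * W z" using W_shift'[of "norm x"] by blast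
  have b: "norm (f (x + z) * K \<delta> z) \<le> norm (C * C' * (f (x + z) * W (x + z)))" for z
  proof -
    have "K \<delta> z \<le> C * (C' * W (x + z))"
      using C(2)[of z] C'(2)[of z "x + z"] C(1) by (smt (verit) mult_left_mono norm_minus_cancel add_diff_cancel_right' diff_add_cancel minus_diff_eq)
    then have "\<bar>f (x + z)\<bar> * K \<delta> z \<le> \<bar>f (x + z)\<bar> * (C * (C' * W (x + z)))"
      by (intro mult_left_mono) auto
    then show ?thesis using K_nonneg[of \<delta> z] C(1) C'(1) W_pos[of "x + z"] by (simp add: abs_mult mult_ac)
  qed
  show ?thesis
  proof (rule Bochner_Integration.integrable_bound)
    show "integrable lborel (\<lambda>z. C * C' * (f (x + z) * W (x + z)))"
      using f lborel_integrable_translate[of "\<lambda>z. f z * W z" x]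
      by (intro integrable_mult_right) (simp add: wL1_def)
  qed (use b in auto)
qed

lemma trunc_split:
  assumes f: "wL1 f" and "\<delta> > 0"
  shows "trunc \<delta> f x = (LBINT z. f (x + z) * K \<delta> z) - f x * (LBINT z. K \<delta> z)"
    and "integrable lborel (\<lambda>z. (f (x + z) - f x) * K \<delta> z)"
  using integrable_shift_K[OF assms, of x] K_integrable[OF assms(2)]
  by (simp_all add: trunc_def left_diff_distrib)

lemma trunc_measurable:
  assumes [measurable]: "f \<in> borel_measurable borel"
  shows "trunc \<delta> f \<in> borel_measurable borel"
  unfolding trunc_def[abs_def] by (rule lborel.borel_measurable_lebesgue_integral) measurable

lemma conv_measurable:
  assumes [measurable]: "f \<in> borel_measurable borel" "g \<in> borel_measurable borel"
  shows "conv f g \<in> borel_measurable borel"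
  unfolding conv_def[abs_def] by (rule lborel.borel_measurable_lebesgue_integral) measurable

lemma Lop_measurable:
  assumes [measurable]: "f \<in> borel_measurable borel"
  shows "Lop f \<in> borel_measurable borel"
  unfolding Lop_def[abs_def] by (intro borel_measurable_divide lborel.borel_measurable_lebesgue_integral) measurable

lemma trunc_symmetric:
  assumes f: "wL1 f" and g: "bump r g" and d: "\<delta> > 0"
  shows "(LBINT x. g x * trunc \<delta> f x) = (LBINT x. f x * trunc \<delta> g x)"
    and "integrable lborel (\<lambda>x. g x * trunc \<delta> f x)"
proof -
  have [measurable]: "g \<in> borel_measurable borel" "f \<in> borel_measurable borel"
    using f g by (simp_all add: bump_def wL1_def)
  obtain C where C: "C > 0" "\<And>z. K \<delta> z \<le> C * W z" using K_le_W[OF d] by auto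
  obtain C' where C': "C' > 0" "\<And>x y. norm (x - y) \<le> r \<Longrightarrow> W x \<le> C' * W y" using W_shift'[of r] by blast
  define H where "H x y = g x * f y * K \<delta> (y - x)" for x y
  have b: "norm (H x y) \<le> norm (g x * (C * C' * (f y * W y)))" for x y
  proof (cases "norm x > r")
    case True
    then have "g x = 0" using g by (simp add: bump_def)
    then show ?thesis by (simp add: H_def)
  next
    case False
    have "K \<delta> (y - x) \<le> C * W (y - x)" by (rule C)
    also have "\<dots> \<le> C * (C' * W y)"
      using False C(1) by (intro mult_left_mono C'(2)) auto
    finally have "\<bar>g x * f y\<bar> * K \<delta> (y - x) \<le> \<bar>g x * f y\<bar> * (C * (C' * W y))"
      by (intro mult_left_mono) auto
    then show ?thesis
      using K_nonneg[of \<delta> "y - x"] C(1) C'(1) W_pos[of y] by (simp add: H_def abs_mult mult_ac)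
  qed
  have H: "integrable (lborel \<Otimes>\<^sub>M lborel) (case_prod H)"
  proof (rule Bochner_Integration.integrable_bound)
    show "integrable (lborel \<Otimes>\<^sub>M lborel) (\<lambda>(x, y). g x * (C * C' * (f y * W y)))"
      using f bump_integrable[OF g] by (intro integrable_pair_mult integrable_mult_right) (auto simp: wL1_def)
    show "case_prod H \<in> borel_measurable (lborel \<Otimes>\<^sub>M lborel)"
      unfolding H_def by measurable
  qed (use b in auto)
  have 1: "(LBINT y. H x y) = g x * (LBINT z. f (x + z) * K \<delta> z)" for x
  proof -
    have "(LBINT y. H x y) = (LBINT z. H x (x + z))"
      by (rule lborel_integral_translate[symmetric]) (simp add: H_def)
    then show ?thesis by (simp add: H_def mult.assoc)
  qed
  have 2: "(LBINT x. H x y) = f y * (LBINT z. g (y + z) * K \<delta> z)" for y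
  proof -
    have "(LBINT x. H x y) = (LBINT z. H (y + z) y)"
      by (rule lborel_integral_translate[symmetric]) (simp add: H_def)
    also have "\<dots> = (LBINT z. f y * (g (y + z) * K \<delta> z))"
      by (intro Bochner_Integration.integral_cong) (auto simp: H_def K_even)
    finally show ?thesis by simp
  qed
  have i1: "integrable lborel (\<lambda>x. g x * (LBINT z. f (x + z) * K \<delta> z))"
    using lborel_pair.integrable_fst'[OF H] by (simp add: 1)
  have i2: "integrable lborel (\<lambda>y. f y * (LBINT z. g (y + z) * K \<delta> z))"
    using lborel_pair.integrable_snd[OF H] by (simp add: 2)
  have i3: "integrable lborel (\<lambda>x. g x * f x)" by (rule integrable_bump_mult[OF f g])
  then have i4: "integrable lborel (\<lambda>x. g x * (f x * c))" "integrable lborel (\<lambda>x. f x * (g x * c))" for c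
    using integrable_mult_left[OF i3, of c] by (simp_all add: mult_ac)
  have eq: "(LBINT x. g x * (LBINT z. f (x + z) * K \<delta> z)) = (LBINT x. f x * (LBINT z. g (x + z) * K \<delta> z))"
    using lborel_pair.Fubini_integral[OF H] by (simp add: 1 2)
  note sf = trunc_split(1)[OF f d] and sg = trunc_split(1)[OF wL1_bump[OF g] d]
  have swap: "(LBINT x. g x * (f x * c)) = (LBINT x. f x * (g x * c))" for c
    by (simp add: mult.left_commute)
  show "(LBINT x. g x * trunc \<delta> f x) = (LBINT x. f x * trunc \<delta> g x)"
    unfolding sf sg right_diff_distrib using i1 i2 i4
    by (simp only: Bochner_Integration.integral_diff eq swap)
  show "integrable lborel (\<lambda>x. g x * trunc \<delta> f x)"
    unfolding sf right_diff_distrib using i1 i4 by simp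
qed

lemma conv_integrable:
  assumes f: "wL1 f" and g: "bump r g"
  shows "integrable lborel (\<lambda>y. f y * g (x - y))"
proof -
  have "bump (norm x + r) (\<lambda>y. g (x - y))"
    unfolding bump_def
  proof (intro conjI allI impI)
    show "(\<lambda>y. g (x - y)) \<in> borel_measurable borel" using g by (auto simp: bump_def)
    show "\<exists>B. \<forall>y. \<bar>g (x - y)\<bar> \<le> B" using g by (auto simp: bump_def)
    fix y :: 'a assume "norm x + r < norm y"
    then have "norm (x - y) > r" using norm_triangle_ineq2[of y x] by (simp add: norm_minus_commute)
    then show "g (x - y) = 0" using g by (simp add: bump_def)
  qed
  from integrable_bump_mult[OF f this] show ?thesis by (simp add: mult.commute)
qed

lemma conv_pair_integrable:
  assumes f: "wL1 f" and g: "bump r g"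
  shows "integrable (lborel \<Otimes>\<^sub>M lborel) (\<lambda>(y, x). f y * g (x - y) * W x)"
proof -
  have [measurable]: "g \<in> borel_measurable borel" "f \<in> borel_measurable borel"
    using f g by (simp_all add: bump_def wL1_def)
  obtain C where C: "C > 0" "\<And>x y. norm (x - y) \<le> r \<Longrightarrow> W x \<le> C * W y" using W_shift'[of r] by blast
  have b: "norm (f y * g (x - y) * W x) \<le> norm (C * (f y * W y) * g (x - y))" for x y
  proof (cases "norm (x - y) > r")
    case True
    then have "g (x - y) = 0" using g by (simp add: bump_def)
    then show ?thesis by simp
  next
    case False
    then have "\<bar>f y * g (x - y)\<bar> * W x \<le> \<bar>f y * g (x - y)\<bar> * (C * W y)"
      by (intro mult_left_mono C(2)) auto
    then show ?thesis
      using C(1) W_pos[of y] W_pos[of x] by (simp add: abs_mult mult_ac)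
  qed
  show ?thesis
  proof (rule Bochner_Integration.integrable_bound)
    show "integrable (lborel \<Otimes>\<^sub>M lborel) (\<lambda>(y, x). C * (f y * W y) * g (x - y))"
      using f bump_integrable[OF g] by (intro integrable_pair_convolution integrable_mult_right) (auto simp: wL1_def)
  qed (use b in auto)
qed

lemma wL1_conv:
  assumes f: "wL1 f" and g: "bump r g"
  shows "wL1 (conv f g)"
  unfolding wL1_def
proof
  show "conv f g \<in> borel_measurable borel"
    using f g by (intro conv_measurable) (simp_all add: bump_def wL1_def)
  have "integrable lborel (\<lambda>x. LBINT y. f y * g (x - y) * W x)"
    using lborel_pair.integrable_snd[of "\<lambda>y x. f y * g (x - y) * W x"] conv_pair_integrable[OF assms] by simp
  then show "integrable lborel (\<lambda>x. conv f g x * W x)"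
    by (simp add: conv_def)
qed

text \<open>By Fubini's theorem. On the support of \<open>g (x + z - y)\<close> the points \<open>z\<close> and \<open>y\<close> are at bounded distance,
  so that \<open>K \<delta> z\<close> is dominated by \<open>W y\<close>.\<close>

lemma trunc_conv:
  assumes f: "wL1 f" and g: "bump r g" and d: "\<delta> > 0"
  shows "trunc \<delta> (conv f g) x = conv f (trunc \<delta> g) x"
proof -
  have [measurable]: "g \<in> borel_measurable borel" "f \<in> borel_measurable borel"
    using f g by (simp_all add: bump_def wL1_def)
  obtain C where C: "C > 0" "\<And>z. K \<delta> z \<le> C * W z" using K_le_W[OF d] by auto
  obtain C1 where C1: "C1 > 0" "\<And>y z. norm (y - z) \<le> norm x + r \<Longrightarrow> W y \<le> C1 * W z" using W_shift'[of "norm x + r"] by blast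
  define H where "H y z = f y * g (x + z - y) * K \<delta> z" for y z
  have b: "norm (H y z) \<le> norm (C * C1 * (f y * W y) * g (x + (z - y)))" for y z
  proof (cases "norm (x + z - y) > r")
    case True
    then have "g (x + z - y) = 0" using g by (simp add: bump_def)
    then show ?thesis by (simp add: H_def)
  next
    case False
    then have "norm (z - y) \<le> norm x + r"
      using norm_triangle_ineq4[of "x + z - y" x] by (simp add: algebra_simps)
    then have "C * W z \<le> C * (C1 * W y)" using C(1) by (intro mult_left_mono C1(2)) auto
    then have "K \<delta> z \<le> C * (C1 * W y)" using C(2)[of z] by linarith
    then have "\<bar>f y * g (x + z - y)\<bar> * K \<delta> z \<le> \<bar>f y * g (x + z - y)\<bar> * (C * (C1 * W y))"
      by (intro mult_left_mono) auto
    then show ?thesis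
      using K_nonneg[of \<delta> z] C(1) C1(1) W_pos[of y] by (simp add: H_def abs_mult mult_ac add_diff_eq)
  qed
  have H: "integrable (lborel \<Otimes>\<^sub>M lborel) (case_prod H)"
  proof (rule Bochner_Integration.integrable_bound)
    show "integrable (lborel \<Otimes>\<^sub>M lborel) (\<lambda>(y, z). C * C1 * (f y * W y) * g (x + (z - y)))"
      using f g integrable_pair_convolution[OF integrable_mult_right lborel_integrable_translate[OF bump_integrable[OF g]]]
      by (auto simp: wL1_def)
    show "case_prod H \<in> borel_measurable (lborel \<Otimes>\<^sub>M lborel)"
      unfolding H_def by measurable
  qed (use b in auto)
  have 1: "(LBINT y. H y z) = conv f g (x + z) * K \<delta> z" for z
    by (simp add: H_def conv_def)
  have 2: "(LBINT z. H y z) = f y * (LBINT z. g (x - y + z) * K \<delta> z)" for y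
    by (simp add: H_def mult.assoc add_diff_eq diff_add_eq)
  have i2: "integrable lborel (\<lambda>y. f y * (LBINT z. g (x - y + z) * K \<delta> z))"
    using lborel_pair.integrable_fst'[OF H] by (simp add: 2)
  have i3: "integrable lborel (\<lambda>y. f y * (g (x - y) * (LBINT z. K \<delta> z)))"
    using integrable_mult_left[OF conv_integrable[OF f g, of x], of "LBINT z. K \<delta> z"] by (simp add: mult.assoc)
  have "trunc \<delta> (conv f g) x = (LBINT z. conv f g (x + z) * K \<delta> z) - conv f g x * (LBINT z. K \<delta> z)"
    by (rule trunc_split(1)[OF wL1_conv[OF f g] d])
  also have "(LBINT z. conv f g (x + z) * K \<delta> z) = (LBINT y. f y * (LBINT z. g (x - y + z) * K \<delta> z))"
    using lborel_pair.Fubini_integral[OF H] by (simp add: 1 2)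
  also have "conv f g x * (LBINT z. K \<delta> z) = (LBINT y. f y * (g (x - y) * (LBINT z. K \<delta> z)))"
    by (simp add: conv_def mult.assoc[symmetric])
  finally show ?thesis
    unfolding conv_def trunc_split(1)[OF wL1_bump[OF g] d] right_diff_distrib using i2 i3 by simp
qed


lemma trunc_second_diff:
  assumes f: "wL1 f" and d: "\<delta> > 0"
  shows "trunc \<delta> f x = (LBINT z. (f (x + z) + f (x - z) - 2 * f x) * K \<delta> z) / 2"
    and "integrable lborel (\<lambda>z. (f (x + z) + f (x - z) - 2 * f x) * K \<delta> z)"
proof -
  have [measurable]: "f \<in> borel_measurable borel" using f by (simp add: wL1_def)
  note i = integrable_shift_K[OF assms, of x] K_integrable[OF d]
  have i': "integrable lborel (\<lambda>z. f (x - z) * K \<delta> z)"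
    using lborel_integrable_reflect[OF i(1), of 0] by (simp add: K_even)
  have r: "(LBINT z. f (x - z) * K \<delta> z) = (LBINT z. f (x + z) * K \<delta> z)"
    using lborel_integral_reflect[of "\<lambda>z. f (x + z) * K \<delta> z" 0] by (simp add: K_even)
  have e: "(f (x + z) + f (x - z) - 2 * f x) * K \<delta> z =
      f (x + z) * K \<delta> z + f (x - z) * K \<delta> z - 2 * f x * K \<delta> z" for z
    by (simp add: algebra_simps)
  show "trunc \<delta> f x = (LBINT z. (f (x + z) + f (x - z) - 2 * f x) * K \<delta> z) / 2"
    unfolding trunc_split(1)[OF assms] e using i i' r by simp
  show "integrable lborel (\<lambda>z. (f (x + z) + f (x - z) - 2 * f x) * K \<delta> z)"
    unfolding e using i i' by simp
qed

lemma tame_second_diff_le: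
  assumes "tame r g"
  obtains A where "A \<ge> 0" "\<And>x z. \<bar>g (x + z) + g (x - z) - 2 * g x\<bar> \<le> A * min 1 ((norm z)\<^sup>2)"
proof -
  obtain B where B: "\<And>x. \<bar>g x\<bar> \<le> B" using assms by (auto simp: tame_def bump_def)
  obtain M where M: "\<And>x z. \<bar>g (x + z) + g (x - z) - 2 * g x\<bar> \<le> M * (norm z)\<^sup>2"
    using assms by (auto simp: tame_def)
  show ?thesis
  proof (rule that[of "max (4 * B) M"])
    have "0 \<le> B" using B[of 0] by linarith
    then show "0 \<le> max (4 * B) M" by simp
    fix x z
    have "\<bar>g (x + z) + g (x - z) - 2 * g x\<bar> \<le> 4 * B"
      using B[of "x + z"] B[of "x - z"] B[of x] by linarith
    then have "\<bar>g (x + z) + g (x - z) - 2 * g x\<bar> \<le> max (4 * B) M * 1" by simp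
    moreover have "\<bar>g (x + z) + g (x - z) - 2 * g x\<bar> \<le> max (4 * B) M * (norm z)\<^sup>2"
      using M[of x z] by (rule order_trans) (intro mult_right_mono, auto)
    ultimately show "\<bar>g (x + z) + g (x - z) - 2 * g x\<bar> \<le> max (4 * B) M * min 1 ((norm z)\<^sup>2)"
      by (simp add: min_def)
  qed
qed

text \<open>For \<open>x\<close> near the support of \<open>g\<close> this is the bound for second differences. If \<open>x\<close> is at distance more than
  \<open>1\<close> from the ball supporting \<open>g\<close>, then only jumps from \<open>x\<close> into this ball contribute, and their intensity is
  comparable with \<open>W x\<close>. The constant does not depend on \<open>\<delta>\<close>.\<close>

lemma trunc_le_W:
  assumes "tame r g"
  obtains C where "C > 0" "\<And>\<delta> x. \<delta> > 0 \<Longrightarrow> \<bar>trunc \<delta> g x\<bar> \<le> C * W x"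
proof -
  have b: "bump r g" using assms by (simp add: tame_def)
  note w = wL1_bump[OF b]
  have [measurable]: "g \<in> borel_measurable borel" using b by (simp add: bump_def)
  obtain A where A: "A \<ge> 0" "\<And>x z. \<bar>g (x + z) + g (x - z) - 2 * g x\<bar> \<le> A * min 1 ((norm z)\<^sup>2)"
    using tame_second_diff_le[OF assms] by blast
  define I where "I = (LBINT z. min 1 ((norm z)\<^sup>2) * J z)"
  have I: "0 \<le> I" unfolding I_def by (intro Bochner_Integration.integral_nonneg) (simp add: J_nonneg)
  have near: "\<bar>trunc \<delta> g x\<bar> \<le> A * I" if d: "\<delta> > 0" for \<delta> x
  proof -
    have "\<bar>LBINT z. (g (x + z) + g (x - z) - 2 * g x) * K \<delta> z\<bar> \<le> (LBINT z. A * (min 1 ((norm z)\<^sup>2) * J z))"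
      proof (rule Bochner_Integration.integral_abs_bound_integral)
      show "integrable lborel (\<lambda>z. (g (x + z) + g (x - z) - 2 * g x) * K \<delta> z)"
        by (rule trunc_second_diff(2)[OF w d])
      show "integrable lborel (\<lambda>z. A * (min 1 ((norm z)\<^sup>2) * J z))" using J_integrable by simp
      fix z
      have "\<bar>g (x + z) + g (x - z) - 2 * g x\<bar> * K \<delta> z \<le> (A * min 1 ((norm z)\<^sup>2)) * J z"
        using A(1) by (intro mult_mono A(2)) (auto simp: K_def J_nonneg indicator_def)
      then show "\<bar>(g (x + z) + g (x - z) - 2 * g x) * K \<delta> z\<bar> \<le> A * (min 1 ((norm z)\<^sup>2) * J z)"
        using K_nonneg[of \<delta> z] by (simp add: abs_mult mult.assoc)
    qed
    also have "\<dots> = A * I" by (simp add: I_def)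
    finally show ?thesis
      unfolding trunc_second_diff(1)[OF w d] using A(1) I by simp
  qed
  obtain C1 where C1: "C1 > 0" "\<And>z. 1 < norm z \<Longrightarrow> J z \<le> C1 * W z" using J_le_W[of 1] by auto
  obtain C2 where C2: "C2 > 0" "\<And>x y. norm (x - y) \<le> r \<Longrightarrow> W x \<le> C2 * W y" using W_shift'[of r] by blast
  obtain C3 where C3: "C3 > 0" "\<And>x y. norm (x - y) \<le> r + 1 \<Longrightarrow> W x \<le> C3 * W y" using W_shift'[of "r + 1"] by blast
  define N where "N = (LBINT z. \<bar>g z\<bar>)"
  have N: "0 \<le> N" by (simp add: N_def)
  have far: "\<bar>trunc \<delta> g x\<bar> \<le> C1 * C2 * N * W x" if d: "\<delta> > 0" and x: "norm x > r + 1" for \<delta> x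
  proof -
    have gx: "g x = 0" using b x by (simp add: bump_def)
    have "\<bar>trunc \<delta> g x\<bar> \<le> (LBINT z. (C1 * C2 * W x) * \<bar>g (x + z)\<bar>)"
      unfolding trunc_def gx
    proof (rule Bochner_Integration.integral_abs_bound_integral)
      show "integrable lborel (\<lambda>z. (g (x + z) - 0) * K \<delta> z)"
        using trunc_split(2)[OF w d, of x] by (simp add: gx)
      show "integrable lborel (\<lambda>z. C1 * C2 * W x * \<bar>g (x + z)\<bar>)"
        using lborel_integrable_translate[OF bump_integrable[OF b], of x] by simp
      fix z
      show "\<bar>(g (x + z) - 0) * K \<delta> z\<bar> \<le> C1 * C2 * W x * \<bar>g (x + z)\<bar>"
      proof (cases "norm (x + z) > r")
        case True
        then have "g (x + z) = 0" using b by (simp add: bump_def)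
        then show ?thesis by simp
      next
        case False
        have "norm x \<le> norm (x + z) + norm z" using norm_triangle_ineq4[of "x + z" z] by simp
        then have "1 < norm z" using False x by linarith
        have "- z - x = - (x + z)" by simp
        then have "norm (- z - x) \<le> r" using False by (simp only: norm_minus_cancel)
        have "K \<delta> z \<le> J z" by (simp add: K_def indicator_def J_nonneg)
        also have "\<dots> \<le> C1 * W (- z)" using C1(2)[OF \<open>1 < norm z\<close>] by (simp add: W_even)
        also have "\<dots> \<le> C1 * (C2 * W x)" using C1(1) C2(2)[OF \<open>norm (- z - x) \<le> r\<close>] by simp
        finally have "\<bar>g (x + z)\<bar> * K \<delta> z \<le> \<bar>g (x + z)\<bar> * (C1 * (C2 * W x))"
          by (intro mult_left_mono) auto
        then show ?thesis using K_nonneg[of \<delta> z] by (simp add: abs_mult mult_ac)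
      qed
    qed
    also have "\<dots> = (C1 * C2 * W x) * N"
      using lborel_integral_translate[of "\<lambda>z. \<bar>g z\<bar>" x] by (simp add: N_def)
    finally show ?thesis by (simp add: mult_ac)
  qed
  define C where "C = A * I * C3 / W 0 + C1 * C2 * N + 1"
  have p: "0 \<le> A * I * C3 / W 0" "0 \<le> C1 * C2 * N"
    using A I C3 C1 C2 N W_pos[of 0] by auto
  show ?thesis
  proof (rule that[of C])
    show "C > 0" using p by (simp add: C_def)
    fix \<delta> :: real and x assume d: "\<delta> > 0"
    show "\<bar>trunc \<delta> g x\<bar> \<le> C * W x"
    proof (cases "norm x > r + 1")
      case True
      have "C1 * C2 * N * W x \<le> C * W x"
        using p W_pos[of x] by (intro mult_right_mono) (auto simp: C_def)
      then show ?thesis using far[OF d True] by linarith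
    next
      case False
      then have "1 \<le> C3 * W x / W 0" using C3(2)[of 0 x] W_pos[of 0] by simp
      then have "A * I * 1 \<le> A * I * (C3 * W x / W 0)" using A I by (intro mult_left_mono) auto
      also have "\<dots> = A * I * C3 / W 0 * W x" by simp
      also have "\<dots> \<le> C * W x"
        using p W_pos[of x] by (intro mult_right_mono) (auto simp: C_def)
      finally show ?thesis using near[OF d, of x] by linarith
    qed
  qed
qed

lemma trunc_tendsto_Lop:
  assumes g: "tame r g" and X: "\<And>i. X i > 0" "X \<longlonglongrightarrow> 0"
  shows "(\<lambda>i. trunc (X i) g x) \<longlonglongrightarrow> Lop g x"
proof -
  have b: "bump r g" using g by (simp add: tame_def)
  note w = wL1_bump[OF b]
  have [measurable]: "g \<in> borel_measurable borel" using b by (simp add: bump_def)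
  obtain A where A: "A \<ge> 0" "\<And>x z. \<bar>g (x + z) + g (x - z) - 2 * g x\<bar> \<le> A * min 1 ((norm z)\<^sup>2)"
    using tame_second_diff_le[OF g] by blast
  have "(\<lambda>i. LBINT z. (g (x + z) + g (x - z) - 2 * g x) * K (X i) z)
     \<longlonglongrightarrow> (LBINT z. (g (x + z) + g (x - z) - 2 * g x) * J z)"
  proof (rule integral_dominated_convergence)
    show "integrable lborel (\<lambda>z. A * (min 1 ((norm z)\<^sup>2) * J z))" using J_integrable by simp
    show "AE z in lborel. (\<lambda>i. (g (x + z) + g (x - z) - 2 * g x) * K (X i) z)
       \<longlonglongrightarrow> (g (x + z) + g (x - z) - 2 * g x) * J z"
    proof (intro always_eventually allI)
      fix z
      show "(\<lambda>i. (g (x + z) + g (x - z) - 2 * g x) * K (X i) z)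
       \<longlonglongrightarrow> (g (x + z) + g (x - z) - 2 * g x) * J z"
      proof (cases "z = 0")
        case False
        then have "\<forall>\<^sub>F i in sequentially. X i < norm z"
          using order_tendstoD(2)[OF X(2), of "norm z"] by simp
        then have "\<forall>\<^sub>F i in sequentially. (g (x + z) + g (x - z) - 2 * g x) * K (X i) z = (g (x + z) + g (x - z) - 2 * g x) * J z"
          by eventually_elim (simp add: K_def)
        then show ?thesis by (rule tendsto_eventually)
      qed simp
    qed
    fix i
    show "AE z in lborel. norm ((g (x + z) + g (x - z) - 2 * g x) * K (X i) z) \<le> A * (min 1 ((norm z)\<^sup>2) * J z)"
    proof (intro always_eventually allI)
      fix z
      have "\<bar>g (x + z) + g (x - z) - 2 * g x\<bar> * K (X i) z \<le> (A * min 1 ((norm z)\<^sup>2)) * J z"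
        using A(1) by (intro mult_mono A(2)) (auto simp: K_def J_nonneg indicator_def)
      then show "norm ((g (x + z) + g (x - z) - 2 * g x) * K (X i) z) \<le> A * (min 1 ((norm z)\<^sup>2) * J z)"
        using K_nonneg[of "X i" z] by (simp add: abs_mult mult.assoc)
    qed
  qed measurable
  then show ?thesis
    unfolding trunc_second_diff(1)[OF w X(1)] Lop_def by (intro tendsto_divide) auto
qed

lemma Lop_le_W:
  assumes "tame r g"
  obtains C where "C > 0" "\<And>\<delta> x. \<delta> > 0 \<Longrightarrow> \<bar>trunc \<delta> g x\<bar> \<le> C * W x" "\<And>x. \<bar>Lop g x\<bar> \<le> C * W x"
proof -
  obtain C where C: "C > 0" "\<And>\<delta> x. \<delta> > 0 \<Longrightarrow> \<bar>trunc \<delta> g x\<bar> \<le> C * W x"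
    using trunc_le_W[OF assms] by blast
  have "\<bar>Lop g x\<bar> \<le> C * W x" for x
  proof (rule Lim_bounded)
    show "(\<lambda>i. \<bar>trunc (inverse (real (Suc i))) g x\<bar>) \<longlonglongrightarrow> \<bar>Lop g x\<bar>"
      by (intro tendsto_rabs trunc_tendsto_Lop[OF assms] LIMSEQ_inverse_real_of_nat) simp
    show "\<forall>n\<ge>0. \<bar>trunc (inverse (real (Suc n))) g x\<bar> \<le> C * W x"
      using C(2) by simp
  qed
  then show ?thesis using C that by blast
qed

lemma wL1_mult_Lop_integrable:
  assumes f: "wL1 f" and g: "tame r g"
  shows "integrable lborel (\<lambda>x. f x * Lop g x)"
proof -
  have [measurable]: "g \<in> borel_measurable borel" "f \<in> borel_measurable borel"
    using f g by (simp_all add: tame_def bump_def wL1_def)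
  note [measurable] = Lop_measurable[of g]
  obtain C where C: "C > 0" "\<And>x. \<bar>Lop g x\<bar> \<le> C * W x" by (rule Lop_le_W[OF g]) (rule that; assumption)
  show ?thesis
  proof (rule Bochner_Integration.integrable_bound)
    show "integrable lborel (\<lambda>x. C * (f x * W x))" using f by (intro integrable_mult_right) (simp add: wL1_def)
    show "AE x in lborel. norm (f x * Lop g x) \<le> norm (C * (f x * W x))"
    proof (intro always_eventually allI)
      fix x
      have "\<bar>f x\<bar> * \<bar>Lop g x\<bar> \<le> \<bar>f x\<bar> * (C * W x)" by (intro mult_left_mono C(2)) auto
      then show "norm (f x * Lop g x) \<le> norm (C * (f x * W x))"
        using C(1) W_pos[of x] by (simp add: abs_mult mult_ac)
    qed
  qed simp
qed

section \<open>Convex functions of mollified solutions\<close>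

lemma trunc_convex:
  fixes \<beta> \<beta>' :: "real \<Rightarrow> real"
  assumes f: "wL1 f" and \<beta>f: "wL1 (\<lambda>x. \<beta> (f x))" and d: "\<delta> > 0"
    and convex: "\<And>a b. \<beta> b - \<beta> a \<ge> \<beta>' a * (b - a)"
  shows "\<beta>' (f x) * trunc \<delta> f x \<le> trunc \<delta> (\<lambda>x. \<beta> (f x)) x"
proof -
  have "\<beta>' (f x) * trunc \<delta> f x = (LBINT z. \<beta>' (f x) * ((f (x + z) - f x) * K \<delta> z))"
    by (simp add: trunc_def)
  also have "\<dots> \<le> trunc \<delta> (\<lambda>x. \<beta> (f x)) x"
    unfolding trunc_def
  proof (rule integral_mono)
    show "integrable lborel (\<lambda>z. \<beta>' (f x) * ((f (x + z) - f x) * K \<delta> z))"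
      using trunc_split(2)[OF f d] by simp
    show "integrable lborel (\<lambda>z. (\<beta> (f (x + z)) - \<beta> (f x)) * K \<delta> z)"
      using trunc_split(2)[OF \<beta>f d] by simp
    fix z
    show "\<beta>' (f x) * ((f (x + z) - f x) * K \<delta> z) \<le> (\<beta> (f (x + z)) - \<beta> (f x)) * K \<delta> z"
      unfolding mult.assoc[symmetric] by (intro mult_right_mono convex K_nonneg)
  qed
  finally show ?thesis .
qed

lemma wL1_comp:
  assumes f: "wL1 f" and [measurable]: "\<beta> \<in> borel_measurable borel" and b: "\<And>t. \<bar>\<beta> t\<bar> \<le> \<bar>t\<bar>"
  shows "wL1 (\<lambda>x. \<beta> (f x))"
proof -
  have [measurable]: "f \<in> borel_measurable borel" using f by (simp add: wL1_def)
  have "integrable lborel (\<lambda>x. \<beta> (f x) * W x)"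
    by (rule Bochner_Integration.integrable_bound[where f="\<lambda>x. f x * W x"])
      (use f b W_pos in \<open>auto simp: wL1_def abs_mult intro!: mult_right_mono\<close>)
  then show ?thesis by (simp add: wL1_def)
qed

text \<open>For \<open>v = u * \<eta>\<close>, convexity and symmetry give \<open>\<integral> \<xi> \<beta>'(v) L\<^sub>\<delta> v \<le> \<integral> \<beta>(v) L\<^sub>\<delta> \<xi>\<close> for every \<open>\<delta> > 0\<close>. As
  \<open>L\<^sub>\<delta> v = u * L\<^sub>\<delta> \<eta>\<close>, both sides converge for \<open>\<delta> \<rightarrow> 0\<close> by dominated convergence.\<close>

lemma convex_mollified_inequality:
  fixes \<beta> \<beta>' :: "real \<Rightarrow> real" and u \<eta> \<xi> G :: "'a \<Rightarrow> real"
  assumes u: "wL1 u" and \<eta>: "tame r \<eta>" and \<xi>: "tame R \<xi>" and \<xi>_nonneg: "\<And>x. 0 \<le> \<xi> x"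
    and convex: "\<And>a b. \<beta> b - \<beta> a \<ge> \<beta>' a * (b - a)"
    and \<beta>_le: "\<And>t. \<bar>\<beta> t\<bar> \<le> \<bar>t\<bar>" and \<beta>'_le: "\<And>t. \<bar>\<beta>' t\<bar> \<le> 1"
    and [measurable]: "\<beta> \<in> borel_measurable borel" "\<beta>' \<in> borel_measurable borel"
    and eq: "\<And>x. \<xi> x \<noteq> 0 \<Longrightarrow> - conv u (Lop \<eta>) x = G x"
  shows "(LBINT x. \<beta> (conv u \<eta> x) * (- Lop \<xi> x)) \<le> (LBINT x. \<xi> x * \<beta>' (conv u \<eta> x) * G x)"
proof -
  define v where "v = conv u \<eta>"
  have b\<eta>: "bump r \<eta>" and b\<xi>: "bump R \<xi>" using \<eta> \<xi> by (simp_all add: tame_def)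
  have v: "wL1 v" unfolding v_def by (rule wL1_conv[OF u b\<eta>])
  note \<beta>v = wL1_comp[OF v \<open>\<beta> \<in> _\<close> \<beta>_le]
  have m [measurable]: "\<xi> \<in> borel_measurable borel" "v \<in> borel_measurable borel" "\<eta> \<in> borel_measurable borel" "u \<in> borel_measurable borel"
    using b\<eta> b\<xi> v u by (simp_all add: bump_def wL1_def)
  note [measurable] = trunc_measurable[OF m(3)] Lop_measurable[OF m(3)] trunc_measurable[OF m(1)] Lop_measurable[OF m(1)]
  define X where "X i = inverse (real (Suc i))" for i
  have X: "\<And>i. X i > 0" "X \<longlonglongrightarrow> 0"
    using LIMSEQ_inverse_real_of_nat by (simp_all add: X_def[abs_def])
  obtain C where C: "C > 0" "\<And>\<delta> x. \<delta> > 0 \<Longrightarrow> \<bar>trunc \<delta> \<eta> x\<bar> \<le> C * W x" "\<And>x. \<bar>Lop \<eta> x\<bar> \<le> C * W x"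
    using Lop_le_W[OF \<eta>] by blast
  obtain C' where C': "C' > 0" "\<And>\<delta> x. \<delta> > 0 \<Longrightarrow> \<bar>trunc \<delta> \<xi> x\<bar> \<le> C' * W x" "\<And>x. \<bar>Lop \<xi> x\<bar> \<le> C' * W x"
    using Lop_le_W[OF \<xi>] by blast
  obtain C1 where C1: "C1 > 0" "\<And>x y. norm (x - y) \<le> R \<Longrightarrow> W x \<le> C1 * W y" using W_shift'[of R] by blast
  have uW: "integrable lborel (\<lambda>y. \<bar>u y * W y\<bar>)" using u by (simp add: wL1_def)
  define T where "T i x = \<xi> x * \<beta>' (v x) * trunc (X i) v x" for i x
  have dom: "\<bar>u y * trunc (X i) \<eta> (x - y)\<bar> \<le> C * C1 * \<bar>u y * W y\<bar>" if "norm x \<le> R" for x y i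
  proof -
    have "\<bar>trunc (X i) \<eta> (x - y)\<bar> \<le> C * W (y - x)" using C(2)[OF X(1), of i "x - y"] W_even[of "x - y"] by simp
    also have "\<dots> \<le> C * (C1 * W y)" using that C(1) by (intro mult_left_mono C1(2)) auto
    finally have "\<bar>u y\<bar> * \<bar>trunc (X i) \<eta> (x - y)\<bar> \<le> \<bar>u y\<bar> * (C * (C1 * W y))"
      by (intro mult_left_mono) auto
    then show ?thesis using W_pos[of y] by (simp add: abs_mult mult_ac)
  qed
  have lim_v: "(\<lambda>i. trunc (X i) v x) \<longlonglongrightarrow> conv u (Lop \<eta>) x" if "norm x \<le> R" for x
    unfolding v_def trunc_conv[OF u b\<eta> X(1)] unfolding conv_def
  proof (rule integral_dominated_convergence)
    show "integrable lborel (\<lambda>y. C * C1 * \<bar>u y * W y\<bar>)" using uW by simp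
    show "AE y in lborel. (\<lambda>i. u y * trunc (X i) \<eta> (x - y)) \<longlonglongrightarrow> u y * Lop \<eta> (x - y)"
      by (intro always_eventually allI tendsto_mult tendsto_const trunc_tendsto_Lop[OF \<eta> X])
    show "AE y in lborel. norm (u y * trunc (X i) \<eta> (x - y)) \<le> C * C1 * \<bar>u y * W y\<bar>" for i
      using dom[OF that] by simp
  qed measurable
  have bound_v: "\<bar>trunc (X i) v x\<bar> \<le> C * C1 * (LBINT y. \<bar>u y * W y\<bar>)" if "norm x \<le> R" for x i
  proof -
    have "\<bar>conv u (trunc (X i) \<eta>) x\<bar> \<le> (LBINT y. C * C1 * \<bar>u y * W y\<bar>)"
      unfolding conv_def
    proof (rule Bochner_Integration.integral_abs_bound_integral)
      show "integrable lborel (\<lambda>y. C * C1 * \<bar>u y * W y\<bar>)" using uW by simp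
      show "integrable lborel (\<lambda>y. u y * trunc (X i) \<eta> (x - y))"
      proof (rule Bochner_Integration.integrable_bound)
        show "integrable lborel (\<lambda>y. C * C1 * \<bar>u y * W y\<bar>)" using uW by simp
        show "AE y in lborel. norm (u y * trunc (X i) \<eta> (x - y)) \<le> norm (C * C1 * \<bar>u y * W y\<bar>)"
          using dom[OF that] by (auto intro!: always_eventually order_trans[OF _ abs_ge_self])
      qed measurable
    qed (use dom[OF that] in auto)
    then show ?thesis by (simp add: v_def trunc_conv[OF u b\<eta> X(1)])
  qed
  define D where "D = C * C1 * (LBINT y. \<bar>u y * W y\<bar>)"
  have T_le: "\<bar>T i x\<bar> \<le> \<xi> x * D" for i x
  proof (cases "norm x \<le> R")
    case True
    have "\<xi> x * \<bar>\<beta>' (v x)\<bar> * \<bar>trunc (X i) v x\<bar> \<le> \<xi> x * 1 * D"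
      using bound_v[OF True, of i] \<beta>'_le \<xi>_nonneg unfolding D_def
      by (intro mult_mono) auto
    then show ?thesis by (simp add: T_def abs_mult \<xi>_nonneg)
  next
    case False
    then have "\<xi> x = 0" using b\<xi> by (simp add: bump_def)
    then show ?thesis by (simp add: T_def)
  qed
  have \<xi>D: "integrable lborel (\<lambda>x. \<xi> x * D)" using bump_integrable[OF b\<xi>] by simp
  have T_meas [measurable]: "T i \<in> borel_measurable borel" for i
    unfolding T_def[abs_def] using trunc_measurable[OF m(2)] by measurable
  have lim_T: "(\<lambda>i. LBINT x. T i x) \<longlonglongrightarrow> (LBINT x. \<xi> x * \<beta>' (v x) * conv u (Lop \<eta>) x)"
  proof (rule integral_dominated_convergence[OF _ _ \<xi>D])
    show "(\<lambda>x. \<xi> x * \<beta>' (v x) * conv u (Lop \<eta>) x) \<in> borel_measurable lborel"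
      using conv_measurable[OF m(4) Lop_measurable[OF m(3)]] by measurable
    show "AE x in lborel. (\<lambda>i. T i x) \<longlonglongrightarrow> \<xi> x * \<beta>' (v x) * conv u (Lop \<eta>) x"
    proof (intro always_eventually allI)
      fix x
      show "(\<lambda>i. T i x) \<longlonglongrightarrow> \<xi> x * \<beta>' (v x) * conv u (Lop \<eta>) x"
      proof (cases "norm x \<le> R")
        case True
        then show ?thesis unfolding T_def by (intro tendsto_mult tendsto_const lim_v)
      next
        case False
        then have "\<xi> x = 0" using b\<xi> by (simp add: bump_def)
        then show ?thesis by (simp add: T_def)
      qed
    qed
  qed (use T_le in auto)
  have lim_\<xi>: "(\<lambda>i. LBINT x. \<beta> (v x) * trunc (X i) \<xi> x) \<longlonglongrightarrow> (LBINT x. \<beta> (v x) * Lop \<xi> x)"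
  proof (rule integral_dominated_convergence)
    show "integrable lborel (\<lambda>x. C' * \<bar>\<beta> (v x) * W x\<bar>)" using \<beta>v by (simp add: wL1_def)
    show "AE x in lborel. (\<lambda>i. \<beta> (v x) * trunc (X i) \<xi> x) \<longlonglongrightarrow> \<beta> (v x) * Lop \<xi> x"
      by (intro always_eventually allI tendsto_mult tendsto_const trunc_tendsto_Lop[OF \<xi> X])
    fix i
    show "AE x in lborel. norm (\<beta> (v x) * trunc (X i) \<xi> x) \<le> C' * \<bar>\<beta> (v x) * W x\<bar>"
    proof (intro always_eventually allI)
      fix x
      have "\<bar>\<beta> (v x)\<bar> * \<bar>trunc (X i) \<xi> x\<bar> \<le> \<bar>\<beta> (v x)\<bar> * (C' * W x)"
        by (intro mult_left_mono C'(2) X) auto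
      then show "norm (\<beta> (v x) * trunc (X i) \<xi> x) \<le> C' * \<bar>\<beta> (v x) * W x\<bar>"
        using W_pos[of x] by (simp add: abs_mult mult_ac)
    qed
  qed measurable
  have "(LBINT x. T i x) \<le> (LBINT x. \<beta> (v x) * trunc (X i) \<xi> x)" for i
  proof -
    have "(LBINT x. T i x) \<le> (LBINT x. \<xi> x * trunc (X i) (\<lambda>x. \<beta> (v x)) x)"
    proof (rule integral_mono)
      show "integrable lborel (T i)"
        by (rule Bochner_Integration.integrable_bound[OF \<xi>D])
          (use T_le in \<open>auto intro!: always_eventually order_trans[OF _ abs_ge_self]\<close>)
      show "integrable lborel (\<lambda>x. \<xi> x * trunc (X i) (\<lambda>x. \<beta> (v x)) x)"
        by (rule trunc_symmetric(2)[OF \<beta>v b\<xi> X(1)])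
      show "T i x \<le> \<xi> x * trunc (X i) (\<lambda>x. \<beta> (v x)) x" for x
        unfolding T_def mult.assoc
        by (intro mult_left_mono trunc_convex[OF v \<beta>v X(1) convex] \<xi>_nonneg)
    qed
    also have "\<dots> = (LBINT x. \<beta> (v x) * trunc (X i) \<xi> x)"
      by (rule trunc_symmetric(1)[OF \<beta>v b\<xi> X(1)])
    finally show ?thesis .
  qed
  then have "(LBINT x. \<xi> x * \<beta>' (v x) * conv u (Lop \<eta>) x) \<le> (LBINT x. \<beta> (v x) * Lop \<xi> x)"
    by (intro LIMSEQ_le[OF lim_T lim_\<xi>]) auto
  moreover have "(LBINT x. \<xi> x * \<beta>' (v x) * G x) = - (LBINT x. \<xi> x * \<beta>' (v x) * conv u (Lop \<eta>) x)"
  proof -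
    have "\<xi> x * \<beta>' (v x) * G x = - (\<xi> x * \<beta>' (v x) * conv u (Lop \<eta>) x)" for x
      by (cases "\<xi> x = 0") (simp_all add: eq[symmetric])
    then show ?thesis by simp
  qed
  moreover have "(LBINT x. \<beta> (v x) * (- Lop \<xi> x)) = - (LBINT x. \<beta> (v x) * Lop \<xi> x)"
    by simp
  ultimately show ?thesis unfolding v_def by linarith
qed

end

section \<open>Continuity of translations and approximate identities\<close>

text \<open>The functions with translations continuous in \<open>L\<^sup>1\<close> form a closed set.\<close>

lemma L1_translation_aux:
  fixes f g :: "'a::euclidean_space \<Rightarrow> real"
  assumes f: "integrable lborel f"
    and approx: "\<And>e. e > 0 \<Longrightarrow> \<exists>g. integrable lborel g \<and> (LBINT x. \<bar>f x - g x\<bar>) < e \<and>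
      (\<lambda>n. LBINT x. \<bar>g (h n + x) - g x\<bar>) \<longlonglongrightarrow> 0"
  shows "(\<lambda>n. LBINT x. \<bar>f (h n + x) - f x\<bar>) \<longlonglongrightarrow> 0"
proof (rule LIMSEQ_I)
  fix e :: real assume "e > 0"
  then obtain g where g: "integrable lborel g" "(LBINT x. \<bar>f x - g x\<bar>) < e / 3"
      "(\<lambda>n. LBINT x. \<bar>g (h n + x) - g x\<bar>) \<longlonglongrightarrow> 0"
    using approx[of "e / 3"] by auto
  have [measurable]: "f \<in> borel_measurable borel" "g \<in> borel_measurable borel"
    using f g(1) by auto
  obtain n0 where n0: "\<And>n. n \<ge> n0 \<Longrightarrow> norm ((LBINT x. \<bar>g (h n + x) - g x\<bar>) - 0) < e / 3"
    using LIMSEQ_D[OF g(3), of "e / 3"] \<open>e > 0\<close> by auto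
  have "norm ((LBINT x. \<bar>f (h n + x) - f x\<bar>) - 0) < e" if n: "n \<ge> n0" for n
  proof -
    note i = f g(1) lborel_integrable_translate[OF f, of "h n"] lborel_integrable_translate[OF g(1), of "h n"]
    have "(LBINT x. \<bar>f (h n + x) - f x\<bar>)
      \<le> (LBINT x. \<bar>f (h n + x) - g (h n + x)\<bar> + \<bar>g (h n + x) - g x\<bar> + \<bar>f x - g x\<bar>)"
      using i by (intro integral_mono) auto
    also have "\<dots> = (LBINT x. \<bar>f (h n + x) - g (h n + x)\<bar>) + (LBINT x. \<bar>g (h n + x) - g x\<bar>) + (LBINT x. \<bar>f x - g x\<bar>)"
      using i by simp
    also have "(LBINT x. \<bar>f (h n + x) - g (h n + x)\<bar>) = (LBINT x. \<bar>f x - g x\<bar>)"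
      using lborel_integral_translate[of "\<lambda>x. \<bar>f x - g x\<bar>"] by simp
    finally have "(LBINT x. \<bar>f (h n + x) - f x\<bar>) < e"
      using g(2) n0[OF n] by simp
    moreover have "0 \<le> (LBINT x. \<bar>f (h n + x) - f x\<bar>)" by simp
    ultimately show ?thesis by simp
  qed
  then show "\<exists>no. \<forall>n\<ge>no. norm ((LBINT x. \<bar>f (h n + x) - f x\<bar>) - 0) < e" by blast
qed

text \<open>As \<open>U\<close> and its translates have the same measure, their symmetric difference has twice the measure
  of the part of \<open>U\<close> outside the translate; the indicator of this part tends to \<open>0\<close> pointwise because \<open>U\<close> is open.\<close>

lemma L1_translation_open:
  fixes U :: "'a::euclidean_space set"
  assumes U: "open U" and fin: "emeasure lborel U < \<infinity>" and h: "h \<longlonglongrightarrow> 0"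
  shows "(\<lambda>n. LBINT x. \<bar>indicator U (h n + x) - indicator U x :: real\<bar>) \<longlonglongrightarrow> 0"
proof -
  let ?i = "indicator U :: 'a \<Rightarrow> real"
  have [measurable]: "U \<in> sets borel" using U by simp
  have i: "integrable lborel ?i" using fin by (simp add: integrable_indicator_iff)
  have i': "integrable lborel (\<lambda>x. ?i (h n + x))" for n by (rule lborel_integrable_translate[OF i])
  have e: "\<bar>?i (h n + x) - ?i x\<bar> = 2 * (?i x * (1 - ?i (h n + x))) + (?i (h n + x) - ?i x)" for n x
    by (simp add: indicator_def)
  have i2: "integrable lborel (\<lambda>x. ?i x * (1 - ?i (h n + x)))" for n
    by (rule Bochner_Integration.integrable_bound[OF i]) (auto simp: indicator_def)
  have "(\<lambda>n. LBINT x. ?i x * (1 - ?i (h n + x))) \<longlonglongrightarrow> (LBINT x::'a. (0 :: real))"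
  proof (rule integral_dominated_convergence[OF _ _ i])
    show "AE x in lborel. (\<lambda>n. ?i x * (1 - ?i (h n + x))) \<longlonglongrightarrow> 0"
    proof (intro always_eventually allI)
      fix x
      show "(\<lambda>n. ?i x * (1 - ?i (h n + x))) \<longlonglongrightarrow> 0"
      proof (cases "x \<in> U")
        case True
        have "(\<lambda>n. h n + x) \<longlonglongrightarrow> 0 + x" using h by (intro tendsto_intros)
        then have "\<forall>\<^sub>F n in sequentially. h n + x \<in> U"
          using True U by (simp add: topological_tendstoD)
        then have "\<forall>\<^sub>F n in sequentially. ?i x * (1 - ?i (h n + x)) = 0"
          by eventually_elim simp
        then show ?thesis by (rule tendsto_eventually)
      qed simp
    qed
  qed (auto simp: indicator_def)
  then have "(\<lambda>n. 2 * (LBINT x. ?i x * (1 - ?i (h n + x)))) \<longlonglongrightarrow> 2 * 0"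
    by (intro tendsto_intros) simp
  moreover have "(LBINT x. \<bar>?i (h n + x) - ?i x\<bar>) = 2 * (LBINT x. ?i x * (1 - ?i (h n + x)))" for n
    unfolding e using i i'[of n] i2[of n] lborel_integral_translate[of ?i "h n"] by simp
  ultimately show ?thesis by simp
qed

lemma L1_translation_tendsto:
  fixes f :: "'a::euclidean_space \<Rightarrow> real"
  assumes "integrable lborel f" and h: "h \<longlonglongrightarrow> 0"
  shows "(\<lambda>n. LBINT x. \<bar>f (h n + x) - f x\<bar>) \<longlonglongrightarrow> 0"
  using assms(1)
proof (induction rule: integrable_induct)
  case (base A c)
  have A [measurable]: "A \<in> sets borel" using base by simp
  have iA: "integrable lborel (indicator A :: 'a \<Rightarrow> real)"
    using base by (simp add: integrable_indicator_iff)
  have "(\<lambda>n. LBINT x. \<bar>indicator A (h n + x) - indicator A x :: real\<bar>) \<longlonglongrightarrow> 0"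
  proof (rule L1_translation_aux[OF iA])
    fix e :: real assume e: "e > 0"
    obtain U where U: "open U" "A \<subseteq> U" "emeasure lborel (U - A) < ennreal e"
      using outer_regular_lborel[OF A e] by auto
    have [measurable]: "U \<in> sets borel" using U by simp
    have nt: "emeasure lborel (U - A) \<noteq> top"
    proof
      assume "emeasure lborel (U - A) = top"
      with U(3) show False by simp
    qed
    have "emeasure lborel U = emeasure lborel A + emeasure lborel (U - A)"
      using U(2) by (subst plus_emeasure) (auto simp: Un_absorb1)
    also have "\<dots> < \<infinity>" using base(2) nt by (simp add: less_top)
    finally have fin: "emeasure lborel U < \<infinity>" .
    have "(LBINT x. \<bar>indicator A x - indicator U x :: real\<bar>) = (LBINT x. indicator (U - A) x)"
      using U(2) by (intro Bochner_Integration.integral_cong) (auto simp: indicator_def)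
    also have "\<dots> = measure lborel (U - A)" by simp
    also have "\<dots> < e"
      using U(3) nt e by (simp add: emeasure_eq_ennreal_measure ennreal_less_iff)
    finally have "(LBINT x. \<bar>indicator A x - indicator U x :: real\<bar>) < e" .
    moreover have "integrable lborel (indicator U :: 'a \<Rightarrow> real)"
      using fin by (simp add: integrable_indicator_iff)
    ultimately show "\<exists>g. integrable lborel g \<and> (LBINT x. \<bar>indicator A x - g x\<bar>) < e \<and>
      (\<lambda>n. LBINT x. \<bar>g (h n + x) - g x\<bar>) \<longlonglongrightarrow> 0"
      using L1_translation_open[OF U(1) fin h] by blast
  qed
  then have "(\<lambda>n. (LBINT x. \<bar>indicator A (h n + x) - indicator A x :: real\<bar>) * \<bar>c\<bar>) \<longlonglongrightarrow> 0"
    by (rule tendsto_mult_left_zero)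
  moreover have "(LBINT x. \<bar>indicator A (h n + x) - indicator A x :: real\<bar>) * \<bar>c\<bar>
      = (LBINT x. \<bar>indicator A (h n + x) *\<^sub>R c - indicator A x *\<^sub>R c\<bar>)" for n
    by (simp add: left_diff_distrib[symmetric] abs_mult)
  ultimately show ?case by simp
next
  case (add f g)
  note i = add.hyps(1) add.hyps(2) lborel_integrable_translate[OF add.hyps(1)] lborel_integrable_translate[OF add.hyps(2)]
  show ?case
  proof (rule tendsto_sandwich[OF _ _ tendsto_const])
    show "(\<lambda>n. (LBINT x. \<bar>f (h n + x) - f x\<bar>) + (LBINT x. \<bar>g (h n + x) - g x\<bar>)) \<longlonglongrightarrow> 0"
      using tendsto_add[OF add.IH(1) add.IH(2)] by simp
    have "(LBINT x. \<bar>f (h n + x) + g (h n + x) - (f x + g x)\<bar>)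
        \<le> (LBINT x. \<bar>f (h n + x) - f x\<bar> + \<bar>g (h n + x) - g x\<bar>)" for n
      using i by (intro integral_mono) auto
    then show "\<forall>\<^sub>F n in sequentially. (LBINT x. \<bar>f (h n + x) + g (h n + x) - (f x + g x)\<bar>)
       \<le> (LBINT x. \<bar>f (h n + x) - f x\<bar>) + (LBINT x. \<bar>g (h n + x) - g x\<bar>)"
      using i by (intro always_eventually allI) simp
  qed simp
next
  case (lim f s)
  show ?case
  proof (rule L1_translation_aux[OF lim.hyps(4)])
    fix e :: real assume e: "e > 0"
    have "(\<lambda>i. LBINT x. \<bar>f x - s i x\<bar>) \<longlonglongrightarrow> (LBINT x::'a. (0 :: real))"
    proof (rule integral_dominated_convergence)
      show "integrable lborel (\<lambda>x. 3 * \<bar>f x\<bar>)" using lim.hyps(4) by simp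
      have "(\<lambda>i. \<bar>f x - s i x\<bar>) \<longlonglongrightarrow> 0" for x
        using tendsto_rabs[OF tendsto_diff[OF tendsto_const lim.hyps(2)[of x]], of "f x"] by simp
      then show "AE x in lborel. (\<lambda>i. \<bar>f x - s i x\<bar>) \<longlonglongrightarrow> 0" by simp
      fix i
      have "norm \<bar>f x - s i x\<bar> \<le> 3 * \<bar>f x\<bar>" for x
        using lim.hyps(3)[of x i] by simp
      then show "AE x in lborel. norm \<bar>f x - s i x\<bar> \<le> 3 * \<bar>f x\<bar>" by simp
    qed (use lim.hyps(1,4) in auto)
    then have "(\<lambda>i. LBINT x. \<bar>f x - s i x\<bar>) \<longlonglongrightarrow> 0" by simp
    from LIMSEQ_D[OF this e] obtain i where "norm ((LBINT x. \<bar>f x - s i x\<bar>) - 0) < e"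
      by blast
    then have "(LBINT x. \<bar>f x - s i x\<bar>) < e" by simp
    then show "\<exists>g. integrable lborel g \<and> (LBINT x. \<bar>f x - g x\<bar>) < e \<and>
      (\<lambda>n. LBINT x. \<bar>g (h n + x) - g x\<bar>) \<longlonglongrightarrow> 0"
      using lim.hyps(1) lim.IH by blast
  qed
qed

context nonlocal_kernel begin

lemma wL1_translate:
  assumes "wL1 f"
  shows "integrable lborel (\<lambda>x. f (h + x) * W x)"
proof -
  have [measurable]: "f \<in> borel_measurable borel" using assms by (simp add: wL1_def)
  obtain C where C: "C > 0" "\<And>x y. norm (x - y) \<le> norm h \<Longrightarrow> W x \<le> C * W y" using W_shift'[of "norm h"] by blast
  show ?thesis
  proof (rule Bochner_Integration.integrable_bound)
    show "integrable lborel (\<lambda>x. C * (f (h + x) * W (h + x)))"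
      using lborel_integrable_translate[of "\<lambda>x. f x * W x" h] assms
      by (intro integrable_mult_right) (simp add: wL1_def)
    have "norm (f (h + x) * W x) \<le> norm (C * (f (h + x) * W (h + x)))" for x
    proof -
      have "W x \<le> C * W (h + x)" by (rule C(2)) simp
      then have "\<bar>f (h + x)\<bar> * W x \<le> \<bar>f (h + x)\<bar> * (C * W (h + x))" by (intro mult_left_mono) auto
      then show ?thesis using C(1) W_pos[of x] W_pos[of "h + x"] by (simp add: abs_mult mult_ac)
    qed
    then show "AE x in lborel. norm (f (h + x) * W x) \<le> norm (C * (f (h + x) * W (h + x)))" by simp
  qed measurable
qed

text \<open>Write \<open>(f(h + x) - f(x)) W(x)\<close> as the increment of \<open>f W\<close> plus \<open>f(h + x) (W(x) - W(h + x))\<close>. The second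
  term is treated by dominated convergence after a translation.\<close>

lemma wL1_translation_tendsto:
  assumes f: "wL1 f" and h: "h \<longlonglongrightarrow> 0"
  shows "(\<lambda>n. LBINT x. \<bar>f (h n + x) - f x\<bar> * W x) \<longlonglongrightarrow> 0"
proof -
  have [measurable]: "f \<in> borel_measurable borel" using f by (simp add: wL1_def)
  have fW: "integrable lborel (\<lambda>x. f x * W x)" using f by (simp add: wL1_def)
  obtain M where M: "\<And>n. norm (h n) \<le> M"
    using Bseq_eq_bounded[of h] convergent_imp_Bseq[of h] h by (auto simp: convergent_def Bseq_def)
  obtain C where C: "C > 0" "\<And>x y. norm (x - y) \<le> M \<Longrightarrow> W x \<le> C * W y" using W_shift'[of M] by blast
  have b: "\<bar>\<bar>f x\<bar> * \<bar>W (x - h n) - W x\<bar>\<bar> \<le> (C + 1) * \<bar>f x * W x\<bar>" for x n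
  proof -
    have "W (x - h n) \<le> C * W x" using M[of n] by (intro C(2)) simp
    then have "\<bar>W (x - h n) - W x\<bar> \<le> (C + 1) * W x"
      using W_pos[of x] W_pos[of "x - h n"] C(1) by (simp add: algebra_simps abs_le_iff)
    then have "\<bar>f x\<bar> * \<bar>W (x - h n) - W x\<bar> \<le> \<bar>f x\<bar> * ((C + 1) * W x)" by (intro mult_left_mono) auto
    then show ?thesis using W_pos[of x] by (simp add: abs_mult mult_ac)
  qed
  have lim2: "(\<lambda>n. LBINT x. \<bar>f x\<bar> * \<bar>W (x - h n) - W x\<bar>) \<longlonglongrightarrow> (LBINT x::'a. (0 :: real))"
  proof (rule integral_dominated_convergence)
    show "integrable lborel (\<lambda>x. (C + 1) * \<bar>f x * W x\<bar>)" using fW by simp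
    have "(\<lambda>n. \<bar>f x\<bar> * \<bar>W (x - h n) - W x\<bar>) \<longlonglongrightarrow> 0" for x
    proof -
      have "(\<lambda>n. x - h n) \<longlonglongrightarrow> x - 0" using h by (intro tendsto_intros)
      then have "(\<lambda>n. W (x - h n)) \<longlonglongrightarrow> W x"
        using isCont_tendsto_compose[OF W_continuous[of x]] by simp
      then have "(\<lambda>n. \<bar>f x\<bar> * \<bar>W (x - h n) - W x\<bar>) \<longlonglongrightarrow> \<bar>f x\<bar> * \<bar>W x - W x\<bar>" by (intro tendsto_intros)
      then show ?thesis by simp
    qed
    then show "AE x in lborel. (\<lambda>n. \<bar>f x\<bar> * \<bar>W (x - h n) - W x\<bar>) \<longlonglongrightarrow> 0" by simp
    show "AE x in lborel. norm (\<bar>f x\<bar> * \<bar>W (x - h n) - W x\<bar>) \<le> (C + 1) * \<bar>f x * W x\<bar>" for n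
      using b by simp
  qed measurable
  have lim1: "(\<lambda>n. LBINT x. \<bar>f (h n + x) * W (h n + x) - f x * W x\<bar>) \<longlonglongrightarrow> 0"
    by (rule L1_translation_tendsto[OF fW h])
  show ?thesis
  proof (rule tendsto_sandwich[OF _ _ tendsto_const])
    show "(\<lambda>n. (LBINT x. \<bar>f (h n + x) * W (h n + x) - f x * W x\<bar>) + (LBINT x. \<bar>f x\<bar> * \<bar>W (x - h n) - W x\<bar>)) \<longlonglongrightarrow> 0"
      using tendsto_add[OF lim1 lim2] by simp
    show "\<forall>\<^sub>F n in sequentially. (LBINT x. \<bar>f (h n + x) - f x\<bar> * W x)
       \<le> (LBINT x. \<bar>f (h n + x) * W (h n + x) - f x * W x\<bar>) + (LBINT x. \<bar>f x\<bar> * \<bar>W (x - h n) - W x\<bar>)"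
    proof (intro always_eventually allI)
      fix n
      have i1: "integrable lborel (\<lambda>x. \<bar>f (h n + x) * W (h n + x) - f x * W x\<bar>)"
        using lborel_integrable_translate[OF fW, of "h n"] fW by auto
      have i2: "integrable lborel (\<lambda>x. \<bar>f x\<bar> * \<bar>W (x - h n) - W x\<bar>)"
        by (rule Bochner_Integration.integrable_bound[where f="\<lambda>x. (C + 1) * \<bar>f x * W x\<bar>"])
          (use fW order_trans[OF b abs_ge_self] in auto)
      have i2': "integrable lborel (\<lambda>x. \<bar>f (h n + x)\<bar> * \<bar>W x - W (h n + x)\<bar>)"
        using lborel_integrable_translate[OF i2, of "h n"] by simp
      have e2: "(LBINT x. \<bar>f (h n + x)\<bar> * \<bar>W x - W (h n + x)\<bar>) = (LBINT x. \<bar>f x\<bar> * \<bar>W (x - h n) - W x\<bar>)"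
        using lborel_integral_translate[of "\<lambda>x. \<bar>f x\<bar> * \<bar>W (x - h n) - W x\<bar>" "h n"] by simp
      have i0: "integrable lborel (\<lambda>x. \<bar>f (h n + x) - f x\<bar> * W x)"
      proof -
        have "integrable lborel (\<lambda>x. \<bar>f (h n + x) * W x - f x * W x\<bar>)"
          using wL1_translate[OF f, of "h n"] fW by auto
        then show ?thesis using W_pos by (simp add: left_diff_distrib[symmetric] abs_mult abs_of_pos)
      qed
      have "(LBINT x. \<bar>f (h n + x) - f x\<bar> * W x)
        \<le> (LBINT x. \<bar>f (h n + x) * W (h n + x) - f x * W x\<bar> + \<bar>f (h n + x)\<bar> * \<bar>W x - W (h n + x)\<bar>)"
      proof (rule integral_mono[OF i0 Bochner_Integration.integrable_add[OF i1 i2']])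
        fix x
        have "\<bar>f (h n + x) - f x\<bar> * W x = \<bar>(f (h n + x) * W (h n + x) - f x * W x) + f (h n + x) * (W x - W (h n + x))\<bar>"
          using W_pos[of x] by (simp add: algebra_simps) (metis abs_mult abs_of_pos left_diff_distrib mult.commute)
        also have "\<dots> \<le> \<bar>f (h n + x) * W (h n + x) - f x * W x\<bar> + \<bar>f (h n + x)\<bar> * \<bar>W x - W (h n + x)\<bar>"
          unfolding abs_mult[symmetric] by (rule abs_triangle_ineq)
        finally show "\<bar>f (h n + x) - f x\<bar> * W x \<le> \<bar>f (h n + x) * W (h n + x) - f x * W x\<bar> + \<bar>f (h n + x)\<bar> * \<bar>W x - W (h n + x)\<bar>" .
      qed
      then show "(LBINT x. \<bar>f (h n + x) - f x\<bar> * W x)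
       \<le> (LBINT x. \<bar>f (h n + x) * W (h n + x) - f x * W x\<bar>) + (LBINT x. \<bar>f x\<bar> * \<bar>W (x - h n) - W x\<bar>)"
        using i1 i2' e2 by simp
    qed
    show "\<forall>\<^sub>F n in sequentially. 0 \<le> (LBINT x. \<bar>f (h n + x) - f x\<bar> * W x)"
      using W_pos by (intro always_eventually allI Bochner_Integration.integral_nonneg) (simp add: less_imp_le)
  qed
qed

lemma wL1_translation_small:
  assumes f: "wL1 f" and e: "e > 0"
  obtains d where "d > 0" "\<And>z. norm z < d \<Longrightarrow> (LBINT x. \<bar>f (x - z) - f x\<bar> * W x) < e"
proof -
  have "((\<lambda>z. LBINT x. \<bar>f (z + x) - f x\<bar> * W x) \<longlongrightarrow> 0) (at 0)"
    unfolding tendsto_at_iff_sequentially comp_def using wL1_translation_tendsto[OF f] by blast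
  then have "\<forall>\<^sub>F z in at 0. (LBINT x. \<bar>f (z + x) - f x\<bar> * W x) < e"
    using order_tendstoD(2) e by blast
  then obtain d where d: "d > 0" "\<And>z. z \<noteq> 0 \<Longrightarrow> norm z < d \<Longrightarrow> (LBINT x. \<bar>f (z + x) - f x\<bar> * W x) < e"
    unfolding eventually_at by (auto simp: dist_norm)
  show ?thesis
  proof (rule that[OF d(1)])
    fix z :: 'a assume z: "norm z < d"
    show "(LBINT x. \<bar>f (x - z) - f x\<bar> * W x) < e"
    proof (cases "z = 0")
      case False
      then show ?thesis using d(2)[of "- z"] z by simp
    qed (use e in simp)
  qed
qed

text \<open>By Fubini's theorem the integral is at most the \<open>\<eta>\<^sub>n\<close>-average of the translation errors \<open>\<tau>(z)\<close>.\<close>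

lemma conv_approx_identity:
  fixes \<eta> :: "nat \<Rightarrow> 'a \<Rightarrow> real"
  assumes f: "wL1 f" and \<eta>: "\<And>n. bump (\<rho> n) (\<eta> n)" and nn: "\<And>n z. 0 \<le> \<eta> n z"
    and one: "\<And>n. (LBINT z. \<eta> n z) = 1" and \<rho>: "\<rho> \<longlonglongrightarrow> 0"
  shows "(\<lambda>n. LBINT x. \<bar>conv f (\<eta> n) x - f x\<bar> * W x) \<longlonglongrightarrow> 0"
proof -
  have [measurable]: "f \<in> borel_measurable borel" using f by (simp add: wL1_def)
  have fW: "integrable lborel (\<lambda>x. f x * W x)" using f by (simp add: wL1_def)
  define \<tau> where "\<tau> z = (LBINT x. \<bar>f (x - z) - f x\<bar> * W x)" for z
  have main: "(LBINT x. \<bar>conv f (\<eta> n) x - f x\<bar> * W x) \<le> (LBINT z. \<eta> n z * \<tau> z)"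
    and i\<tau>: "integrable lborel (\<lambda>z. \<eta> n z * \<tau> z)" for n
  proof -
    have [measurable]: "\<eta> n \<in> borel_measurable borel" using \<eta>[of n] by (simp add: bump_def)
    have i\<eta>: "integrable lborel (\<eta> n)" using bump_integrable[OF \<eta>] .
    obtain C where C: "C > 0" "\<And>x y. norm (x - y) \<le> \<rho> n \<Longrightarrow> W x \<le> C * W y" using W_shift'[of "\<rho> n"] by blast
    have b: "norm (\<eta> n z * f (x - z) * W x) \<le> norm (\<eta> n z * (C * (f (x - z) * W (x - z))))" for z x
    proof (cases "norm z > \<rho> n")
      case True
      then have "\<eta> n z = 0" using \<eta>[of n] by (simp add: bump_def)
      then show ?thesis by simp
    next
      case False
      then have "W x \<le> C * W (x - z)" by (intro C(2)) simp
      then have "\<bar>\<eta> n z * f (x - z)\<bar> * W x \<le> \<bar>\<eta> n z * f (x - z)\<bar> * (C * W (x - z))"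
        by (intro mult_left_mono) auto
      then show ?thesis using C(1) W_pos[of x] W_pos[of "x - z"] by (simp add: abs_mult mult_ac)
    qed
    have "integrable (lborel \<Otimes>\<^sub>M lborel) (\<lambda>(z, x). \<eta> n z * f (x - z) * W x)"
    proof (rule Bochner_Integration.integrable_bound)
      show "integrable (lborel \<Otimes>\<^sub>M lborel) (\<lambda>(z, x). \<eta> n z * (C * (f (x - z) * W (x - z))))"
        using integrable_pair_convolution[OF i\<eta>, of "\<lambda>x. C * (f x * W x)"] fW by simp
      show "(\<lambda>(z, x). \<eta> n z * f (x - z) * W x) \<in> borel_measurable (lborel \<Otimes>\<^sub>M lborel)" by measurable
      show "AE x in lborel \<Otimes>\<^sub>M lborel. norm (case x of (z, x) \<Rightarrow> \<eta> n z * f (x - z) * W x)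
          \<le> norm (case x of (z, x) \<Rightarrow> \<eta> n z * (C * (f (x - z) * W (x - z))))"
        using b by (intro always_eventually) auto
    qed
    moreover have "integrable (lborel \<Otimes>\<^sub>M lborel) (\<lambda>(z, x). \<eta> n z * (f x * W x))"
      by (rule integrable_pair_mult[OF i\<eta> fW])
    ultimately have "integrable (lborel \<Otimes>\<^sub>M lborel) (\<lambda>p. \<bar>(case p of (z, x) \<Rightarrow> \<eta> n z * f (x - z) * W x) - (case p of (z, x) \<Rightarrow> \<eta> n z * (f x * W x))\<bar>)"
      by (intro Bochner_Integration.integrable_abs Bochner_Integration.integrable_diff)
    also have "(\<lambda>p. \<bar>(case p of (z, x) \<Rightarrow> \<eta> n z * f (x - z) * W x) - (case p of (z, x) \<Rightarrow> \<eta> n z * (f x * W x))\<bar>)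
        = (\<lambda>(z, x). \<eta> n z * (\<bar>f (x - z) - f x\<bar> * W x))"
    proof -
      have "\<bar>\<eta> n z * f (x - z) * W x - \<eta> n z * (f x * W x)\<bar> = \<eta> n z * (\<bar>f (x - z) - f x\<bar> * W x)" for z x
      proof -
        have "\<eta> n z * f (x - z) * W x - \<eta> n z * (f x * W x) = \<eta> n z * (f (x - z) - f x) * W x"
          by (simp add: algebra_simps)
        then show ?thesis using nn W_pos[of x] by (simp add: abs_mult)
      qed
      then show ?thesis by (auto simp: fun_eq_iff)
    qed
    finally have H: "integrable (lborel \<Otimes>\<^sub>M lborel) (\<lambda>(z, x). \<eta> n z * (\<bar>f (x - z) - f x\<bar> * W x))" .
    show "integrable lborel (\<lambda>z. \<eta> n z * \<tau> z)"
      using lborel_pair.integrable_fst'[OF H] by (simp add: \<tau>_def)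
    have i2: "integrable lborel (\<lambda>x. LBINT z. \<eta> n z * (\<bar>f (x - z) - f x\<bar> * W x))"
      using lborel_pair.integrable_snd[OF H] by simp
    have pt: "\<bar>conv f (\<eta> n) x - f x\<bar> * W x \<le> (LBINT z. \<eta> n z * (\<bar>f (x - z) - f x\<bar> * W x))" for x
    proof -
      have "conv f (\<eta> n) x = (LBINT z. \<eta> n z * f (x - z))"
        unfolding conv_def using lborel_integral_reflect[of "\<lambda>y. f y * \<eta> n (x - y)" x] by (simp add: mult.commute)
      moreover have "f x = (LBINT z. \<eta> n z * f x)" using one[of n] by simp
      moreover have i3: "integrable lborel (\<lambda>z. \<eta> n z * f (x - z))"
        using lborel_integrable_reflect[OF conv_integrable[OF f \<eta>[of n], of x], of x] by (simp add: mult.commute)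
      ultimately have "conv f (\<eta> n) x - f x = (LBINT z. \<eta> n z * (f (x - z) - f x))"
        using i\<eta> by (simp add: right_diff_distrib)
      moreover have "\<bar>LBINT z. \<eta> n z * (f (x - z) - f x)\<bar> \<le> (LBINT z. \<bar>\<eta> n z * (f (x - z) - f x)\<bar>)"
        by (rule Bochner_Integration.integral_abs_bound)
      ultimately have "\<bar>conv f (\<eta> n) x - f x\<bar> \<le> (LBINT z. \<eta> n z * \<bar>f (x - z) - f x\<bar>)"
        using nn by (simp add: abs_mult)
      then have "\<bar>conv f (\<eta> n) x - f x\<bar> * W x \<le> (LBINT z. \<eta> n z * \<bar>f (x - z) - f x\<bar>) * W x"
        using W_pos[of x] by (intro mult_right_mono) auto
      then show ?thesis by (simp add: mult.assoc[symmetric])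
    qed
    have [measurable]: "conv f (\<eta> n) \<in> borel_measurable borel" by (intro conv_measurable) measurable
    have i0: "integrable lborel (\<lambda>x. \<bar>conv f (\<eta> n) x - f x\<bar> * W x)"
      by (rule Bochner_Integration.integrable_bound[OF i2])
        (use pt W_pos in \<open>auto intro!: always_eventually order_trans[OF _ abs_ge_self] simp: abs_mult abs_of_pos\<close>)
    have "(LBINT x. \<bar>conv f (\<eta> n) x - f x\<bar> * W x) \<le> (LBINT x. LBINT z. \<eta> n z * (\<bar>f (x - z) - f x\<bar> * W x))"
      by (rule integral_mono[OF i0 i2 pt])
    also have "\<dots> = (LBINT z. \<eta> n z * \<tau> z)"
      using lborel_pair.Fubini_integral[OF H] by (simp add: \<tau>_def)
    finally show "(LBINT x. \<bar>conv f (\<eta> n) x - f x\<bar> * W x) \<le> (LBINT z. \<eta> n z * \<tau> z)" .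
  qed
  show ?thesis
  proof (rule LIMSEQ_I)
    fix e :: real assume e: "e > 0"
    obtain d where d: "d > 0" "\<And>z. norm z < d \<Longrightarrow> \<tau> z < e / 2"
      using wL1_translation_small[OF f, of "e / 2"] e unfolding \<tau>_def by auto
    obtain n0 where n0: "\<And>n. n \<ge> n0 \<Longrightarrow> \<rho> n < d"
      using order_tendstoD(2)[OF \<rho> d(1)] by (auto simp: eventually_sequentially)
    have "norm ((LBINT x. \<bar>conv f (\<eta> n) x - f x\<bar> * W x) - 0) < e" if "n \<ge> n0" for n
    proof -
      have "(LBINT z. \<eta> n z * \<tau> z) \<le> (LBINT z. \<eta> n z * (e / 2))"
      proof (rule integral_mono[OF i\<tau>])
        show "integrable lborel (\<lambda>z. \<eta> n z * (e / 2))" using bump_integrable[OF \<eta>] by simp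
        fix z
        show "\<eta> n z * \<tau> z \<le> \<eta> n z * (e / 2)"
        proof (cases "norm z > \<rho> n")
          case True
          then have "\<eta> n z = 0" using \<eta>[of n] by (simp add: bump_def)
          then show ?thesis by simp
        next
          case False
          then have "\<tau> z < e / 2" using n0[OF that] by (intro d(2)) simp
          then show ?thesis using nn by (intro mult_left_mono) auto
        qed
      qed
      also have "\<dots> = e / 2" using one[of n] by simp
      also have "\<dots> < e" using e by simp
      finally have "(LBINT x. \<bar>conv f (\<eta> n) x - f x\<bar> * W x) < e" using main[of n] by linarith
      moreover have "0 \<le> (LBINT x. \<bar>conv f (\<eta> n) x - f x\<bar> * W x)"
        using W_pos by (intro Bochner_Integration.integral_nonneg) (simp add: less_imp_le)
      ultimately show ?thesis by simp
    qed
    then show "\<exists>n0. \<forall>n\<ge>n0. norm ((LBINT x. \<bar>conv f (\<eta> n) x - f x\<bar> * W x) - 0) < e" by blast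
  qed
qed


section \<open>Kato's inequality for an abstract kernel\<close>

text \<open>On the right-hand side \<open>\<beta>' (u * \<eta>\<^sub>n)\<close> has to converge almost everywhere, which holds along a subsequence;
  this is where the continuity of \<open>\<beta>'\<close> is needed, so that the absolute value is not admissible yet.\<close>

lemma convex_inequality:
  fixes \<beta> \<beta>' :: "real \<Rightarrow> real" and u F \<xi> :: "'a \<Rightarrow> real" and \<eta> :: "nat \<Rightarrow> 'a \<Rightarrow> real"
  assumes u: "wL1 u" and F: "wL1 F" and \<xi>: "tame R \<xi>" and \<xi>_nonneg: "\<And>x. 0 \<le> \<xi> x"
    and \<eta>: "\<And>n. tame (\<rho> n) (\<eta> n)" and nn: "\<And>n z. 0 \<le> \<eta> n z"
    and one: "\<And>n. (LBINT z. \<eta> n z) = 1" and \<rho>: "\<rho> \<longlonglongrightarrow> 0"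
    and eq: "\<And>n x. \<xi> x \<noteq> 0 \<Longrightarrow> - conv u (Lop (\<eta> n)) x = conv F (\<eta> n) x"
    and convex: "\<And>a b. \<beta> b - \<beta> a \<ge> \<beta>' a * (b - a)"
    and \<beta>_le: "\<And>t. \<bar>\<beta> t\<bar> \<le> \<bar>t\<bar>" and \<beta>'_le: "\<And>t. \<bar>\<beta>' t\<bar> \<le> 1"
    and \<beta>'_cont: "continuous_on UNIV \<beta>'"
  shows "(LBINT x. \<beta> (u x) * (- Lop \<xi> x)) \<le> (LBINT x. \<xi> x * \<beta>' (u x) * F x)"
proof -
  define v where "v n = conv u (\<eta> n)" for n
  define G where "G n = conv F (\<eta> n)" for n
  have b\<eta>: "bump (\<rho> n) (\<eta> n)" for n using \<eta> by (simp add: tame_def)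
  have b\<xi>: "bump R \<xi>" using \<xi> by (simp add: tame_def)
  have lip: "\<bar>\<beta> a - \<beta> b\<bar> \<le> \<bar>a - b\<bar>" for a b
  proof -
    have "\<bar>\<beta>' a * (b - a)\<bar> \<le> 1 * \<bar>b - a\<bar>" "\<bar>\<beta>' b * (a - b)\<bar> \<le> 1 * \<bar>a - b\<bar>"
      unfolding abs_mult by (intro mult_right_mono \<beta>'_le abs_ge_zero)+
    then have p: "\<bar>\<beta>' a * (b - a)\<bar> \<le> \<bar>a - b\<bar>" "\<bar>\<beta>' b * (a - b)\<bar> \<le> \<bar>a - b\<bar>"
      by (simp_all only: mult_1 abs_minus_commute)
    have "\<bar>z\<bar> \<le> B" if "\<bar>p\<bar> \<le> B" "\<bar>q\<bar> \<le> B" "p \<le> - z" "q \<le> z" for p q z B :: real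
      using that by linarith
    from this[OF p] show ?thesis using convex[where a=a and b=b] convex[where a=b and b=a] by simp
  qed
  have "continuous_on UNIV \<beta>"
  proof (rule continuous_onI)
    fix x e :: real assume "e > 0"
    then show "\<exists>d>0. \<forall>x'\<in>UNIV. dist x' x < d \<longrightarrow> dist (\<beta> x') (\<beta> x) \<le> e"
      using lip by (intro exI[of _ e]) (auto simp: dist_real_def intro: order_trans[OF lip less_imp_le])
  qed
  then have mb [measurable]: "\<beta> \<in> borel_measurable borel" by (rule borel_measurable_continuous_onI)
  have mb' [measurable]: "\<beta>' \<in> borel_measurable borel" by (rule borel_measurable_continuous_onI[OF \<beta>'_cont])
  have wv: "wL1 (v n)" and wG: "wL1 (G n)" for n
    unfolding v_def G_def by (intro wL1_conv[OF u b\<eta>] wL1_conv[OF F b\<eta>])+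
  have m [measurable]: "\<xi> \<in> borel_measurable borel" "u \<in> borel_measurable borel" "F \<in> borel_measurable borel"
      "\<And>n. v n \<in> borel_measurable borel" "\<And>n. G n \<in> borel_measurable borel"
    using b\<xi> u F wv wG by (simp_all add: bump_def wL1_def)
  note [measurable] = Lop_measurable[OF m(1)]
  have step: "(LBINT x. \<beta> (v n x) * (- Lop \<xi> x)) \<le> (LBINT x. \<xi> x * \<beta>' (v n x) * G n x)" for n
    unfolding v_def G_def
    by (rule convex_mollified_inequality[OF u \<eta> \<xi> \<xi>_nonneg convex \<beta>_le \<beta>'_le mb mb' eq])
  have v_lim: "(\<lambda>n. LBINT x. \<bar>v n x - u x\<bar> * W x) \<longlonglongrightarrow> 0"
    unfolding v_def by (rule conv_approx_identity[OF u b\<eta> nn one \<rho>])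
  have G_lim: "(\<lambda>n. LBINT x. \<bar>G n x - F x\<bar> * W x) \<longlonglongrightarrow> 0"
    unfolding G_def by (rule conv_approx_identity[OF F b\<eta> nn one \<rho>])
  have iu: "integrable lborel (\<lambda>x. u x * W x)" "integrable lborel (\<lambda>x. F x * W x)"
      "\<And>n. integrable lborel (\<lambda>x. v n x * W x)" "\<And>n. integrable lborel (\<lambda>x. G n x * W x)"
    using u F wv wG by (simp_all add: wL1_def)
  have id: "integrable lborel (\<lambda>x. (v n x - u x) * W x)" "integrable lborel (\<lambda>x. (G n x - F x) * W x)" for n
    unfolding left_diff_distrib using iu by simp_all
  have id': "integrable lborel (\<lambda>x. \<bar>v n x - u x\<bar> * W x)" "integrable lborel (\<lambda>x. \<bar>G n x - F x\<bar> * W x)" for n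
    using integrable_abs[OF id(1)[of n]] integrable_abs[OF id(2)[of n]] W_pos by (simp_all add: abs_mult abs_of_pos)
  obtain r where r: "strict_mono r" and ae: "AE x in lborel. (\<lambda>n. (v (r n) x - u x) * W x) \<longlonglongrightarrow> 0"
  proof -
    have "(\<lambda>n. LBINT x. norm ((v n x - u x) * W x)) \<longlonglongrightarrow> 0"
      using v_lim W_pos by (simp add: abs_mult abs_of_pos)
    from tendsto_L1_AE_subseq[OF id(1) this] show ?thesis using that by blast
  qed
  have ae': "AE x in lborel. (\<lambda>n. v (r n) x) \<longlonglongrightarrow> u x"
    using ae
  proof eventually_elim
    case (elim x)
    have "(\<lambda>n. (v (r n) x - u x) * W x * inverse (W x) + u x) \<longlonglongrightarrow> 0 * inverse (W x) + u x"
      by (intro tendsto_intros elim)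
    then show ?case using W_pos[of x] by (simp add: mult.assoc)
  qed
  obtain C where C: "C > 0" "\<And>\<delta> x. \<delta> > 0 \<Longrightarrow> \<bar>trunc \<delta> \<xi> x\<bar> \<le> C * W x" "\<And>x. \<bar>Lop \<xi> x\<bar> \<le> C * W x"
    using Lop_le_W[OF \<xi>] by blast
  obtain C' where C': "C' > 0" "\<And>x. \<xi> x \<le> C' * W x"
  proof -
    obtain B where B: "\<And>x. \<bar>\<xi> x\<bar> \<le> B" using b\<xi> by (auto simp: bump_def)
    obtain D where D: "D > 0" "\<And>x y. norm (x - y) \<le> R \<Longrightarrow> W x \<le> D * W y" using W_shift'[of R] by blast
    have B0: "0 \<le> B" using B[of 0] by linarith
    have "\<xi> x \<le> (B * D / W 0 + 1) * W x" for x
    proof (cases "norm x > R")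
      case True
      then have "\<xi> x = 0" using b\<xi> by (simp add: bump_def)
      moreover have "0 \<le> B * D / W 0 + 1" using B0 D(1) W_pos[of 0] by simp
      ultimately show ?thesis using W_pos[of x] by simp
    next
      case False
      then have "1 \<le> D * W x / W 0" using D(2)[of 0 x] W_pos[of 0] by simp
      then have "B * 1 \<le> B * (D * W x / W 0)" using B0 by (intro mult_left_mono) auto
      also have "\<dots> \<le> (B * D / W 0 + 1) * W x" using W_pos[of x] by (simp add: algebra_simps)
      finally show ?thesis using B[of x] by linarith
    qed
    moreover have "0 < B * D / W 0 + 1" using B0 D(1) W_pos[of 0] by (simp add: add_nonneg_pos)
    ultimately show ?thesis using that by blast
  qed
  have \<beta>_int: "integrable lborel (\<lambda>x. \<beta> (f x) * Lop \<xi> x)" if "wL1 f" for f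
    by (rule wL1_mult_Lop_integrable[OF wL1_comp[OF that mb \<beta>_le] \<xi>])
  have lhs: "(\<lambda>n. LBINT x. \<beta> (v n x) * (- Lop \<xi> x)) \<longlonglongrightarrow> (LBINT x. \<beta> (u x) * (- Lop \<xi> x))"
  proof (rule LIM_zero_cancel, rule tendsto_rabs_zero_cancel, rule tendsto_sandwich[OF _ _ tendsto_const])
    show "(\<lambda>n. C * (LBINT x. \<bar>v n x - u x\<bar> * W x)) \<longlonglongrightarrow> 0"
      using tendsto_mult_right_zero[OF v_lim] .
    have "\<bar>(LBINT x. \<beta> (v n x) * (- Lop \<xi> x)) - (LBINT x. \<beta> (u x) * (- Lop \<xi> x))\<bar>
        \<le> C * (LBINT x. \<bar>v n x - u x\<bar> * W x)" for n
    proof -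
      have "(LBINT x. \<beta> (v n x) * (- Lop \<xi> x)) - (LBINT x. \<beta> (u x) * (- Lop \<xi> x))
         = (LBINT x. \<beta> (u x) * Lop \<xi> x - \<beta> (v n x) * Lop \<xi> x)"
        using \<beta>_int[OF u] \<beta>_int[OF wv[of n]] by simp
      also have "\<bar>\<dots>\<bar> \<le> (LBINT x. C * (\<bar>v n x - u x\<bar> * W x))"
      proof (rule Bochner_Integration.integral_abs_bound_integral)
        show "integrable lborel (\<lambda>x. \<beta> (u x) * Lop \<xi> x - \<beta> (v n x) * Lop \<xi> x)"
          using \<beta>_int[OF u] \<beta>_int[OF wv[of n]] by simp
        show "integrable lborel (\<lambda>x. C * (\<bar>v n x - u x\<bar> * W x))" using id'(1)[of n] by simp
        fix x
        have "\<bar>\<beta> (u x) - \<beta> (v n x)\<bar> * \<bar>Lop \<xi> x\<bar> \<le> \<bar>u x - v n x\<bar> * (C * W x)"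
          by (intro mult_mono lip C(3)) auto
        then show "\<bar>\<beta> (u x) * Lop \<xi> x - \<beta> (v n x) * Lop \<xi> x\<bar> \<le> C * (\<bar>v n x - u x\<bar> * W x)"
          unfolding left_diff_distrib[symmetric] abs_mult abs_minus_commute[of "v n x"] by (simp only: mult_ac)
      qed
      also have "\<dots> = C * (LBINT x. \<bar>v n x - u x\<bar> * W x)" by simp
      finally show ?thesis .
    qed
    then show "\<forall>\<^sub>F n in sequentially. \<bar>(LBINT x. \<beta> (v n x) * (- Lop \<xi> x)) - (LBINT x. \<beta> (u x) * (- Lop \<xi> x))\<bar>
        \<le> C * (LBINT x. \<bar>v n x - u x\<bar> * W x)" by simp
  qed simp
  have \<xi>_int: "integrable lborel (\<lambda>x. \<xi> x * \<beta>' (f x) * g x)"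
    if "wL1 g" and [measurable]: "f \<in> borel_measurable borel" for f g
  proof (rule Bochner_Integration.integrable_bound)
    have [measurable]: "g \<in> borel_measurable borel" using that by (simp add: wL1_def)
    show "integrable lborel (\<lambda>x. C' * (g x * W x))" using that by (simp add: wL1_def)
    show "(\<lambda>x. \<xi> x * \<beta>' (f x) * g x) \<in> borel_measurable lborel" by measurable
    have "norm (\<xi> x * \<beta>' (f x) * g x) \<le> norm (C' * (g x * W x))" for x
    proof -
      have "\<xi> x * \<bar>\<beta>' (f x)\<bar> * \<bar>g x\<bar> \<le> C' * W x * 1 * \<bar>g x\<bar>"
        using C' \<xi>_nonneg W_pos[of x] by (intro mult_mono \<beta>'_le) auto
      then show ?thesis using C'(1) W_pos[of x] \<xi>_nonneg by (simp add: abs_mult mult_ac)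
    qed
    then show "AE x in lborel. norm (\<xi> x * \<beta>' (f x) * g x) \<le> norm (C' * (g x * W x))" by simp
  qed
  have rhs1: "(\<lambda>n. (LBINT x. \<xi> x * \<beta>' (v n x) * G n x) - (LBINT x. \<xi> x * \<beta>' (v n x) * F x)) \<longlonglongrightarrow> 0"
  proof (rule tendsto_rabs_zero_cancel, rule tendsto_sandwich[OF _ _ tendsto_const])
    show "(\<lambda>n. C' * (LBINT x. \<bar>G n x - F x\<bar> * W x)) \<longlonglongrightarrow> 0"
      using tendsto_mult_right_zero[OF G_lim] .
    have "\<bar>(LBINT x. \<xi> x * \<beta>' (v n x) * G n x) - (LBINT x. \<xi> x * \<beta>' (v n x) * F x)\<bar>
       \<le> C' * (LBINT x. \<bar>G n x - F x\<bar> * W x)" for n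
    proof -
      have "(LBINT x. \<xi> x * \<beta>' (v n x) * G n x) - (LBINT x. \<xi> x * \<beta>' (v n x) * F x)
        = (LBINT x. \<xi> x * \<beta>' (v n x) * G n x - \<xi> x * \<beta>' (v n x) * F x)"
        using \<xi>_int[OF wG] \<xi>_int[OF F] by simp
      also have "\<bar>\<dots>\<bar> \<le> (LBINT x. C' * (\<bar>G n x - F x\<bar> * W x))"
      proof (rule Bochner_Integration.integral_abs_bound_integral)
        show "integrable lborel (\<lambda>x. \<xi> x * \<beta>' (v n x) * G n x - \<xi> x * \<beta>' (v n x) * F x)"
          using \<xi>_int[OF wG] \<xi>_int[OF F] by simp
        show "integrable lborel (\<lambda>x. C' * (\<bar>G n x - F x\<bar> * W x))" using id'(2)[of n] by simp
        fix x
        have "\<xi> x * \<bar>\<beta>' (v n x)\<bar> * \<bar>G n x - F x\<bar> \<le> C' * W x * 1 * \<bar>G n x - F x\<bar>"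
          using C' \<xi>_nonneg W_pos[of x] by (intro mult_mono \<beta>'_le) auto
        then show "\<bar>\<xi> x * \<beta>' (v n x) * G n x - \<xi> x * \<beta>' (v n x) * F x\<bar> \<le> C' * (\<bar>G n x - F x\<bar> * W x)"
          unfolding right_diff_distrib[symmetric] abs_mult abs_of_nonneg[OF \<xi>_nonneg] by (simp only: mult_ac mult_1)
      qed
      also have "\<dots> = C' * (LBINT x. \<bar>G n x - F x\<bar> * W x)" by simp
      finally show ?thesis .
    qed
    then show "\<forall>\<^sub>F n in sequentially. \<bar>(LBINT x. \<xi> x * \<beta>' (v n x) * G n x) - (LBINT x. \<xi> x * \<beta>' (v n x) * F x)\<bar>
       \<le> C' * (LBINT x. \<bar>G n x - F x\<bar> * W x)" by simp
  qed simp
  have rhs2: "(\<lambda>n. LBINT x. \<xi> x * \<beta>' (v (r n) x) * F x) \<longlonglongrightarrow> (LBINT x. \<xi> x * \<beta>' (u x) * F x)"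
  proof (rule integral_dominated_convergence)
    show "integrable lborel (\<lambda>x. C' * \<bar>F x * W x\<bar>)" using iu(2) by simp
    show "AE x in lborel. (\<lambda>n. \<xi> x * \<beta>' (v (r n) x) * F x) \<longlonglongrightarrow> \<xi> x * \<beta>' (u x) * F x"
      using ae'
    proof eventually_elim
      case (elim x)
      have "isCont \<beta>' (u x)" using \<beta>'_cont by (simp add: continuous_on_eq_continuous_at)
      from isCont_tendsto_compose[OF this elim] show ?case by (intro tendsto_intros)
    qed
    fix n
    have "norm (\<xi> x * \<beta>' (v (r n) x) * F x) \<le> C' * \<bar>F x * W x\<bar>" for x
    proof -
      have "\<xi> x * \<bar>\<beta>' (v (r n) x)\<bar> * \<bar>F x\<bar> \<le> C' * W x * 1 * \<bar>F x\<bar>"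
        using C' \<xi>_nonneg W_pos[of x] by (intro mult_mono \<beta>'_le) auto
      then show ?thesis using W_pos[of x] \<xi>_nonneg by (simp add: abs_mult mult_ac)
    qed
    then show "AE x in lborel. norm (\<xi> x * \<beta>' (v (r n) x) * F x) \<le> C' * \<bar>F x * W x\<bar>" by simp
  qed measurable
  have rhs: "(\<lambda>n. LBINT x. \<xi> x * \<beta>' (v (r n) x) * G (r n) x) \<longlonglongrightarrow> (LBINT x. \<xi> x * \<beta>' (u x) * F x)"
    using tendsto_add[OF LIMSEQ_subseq_LIMSEQ[OF rhs1 r] rhs2] by (simp add: comp_def)
  have lhs': "(\<lambda>n. LBINT x. \<beta> (v (r n) x) * (- Lop \<xi> x)) \<longlonglongrightarrow> (LBINT x. \<beta> (u x) * (- Lop \<xi> x))"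
    using LIMSEQ_subseq_LIMSEQ[OF lhs r] by (simp add: comp_def)
  show ?thesis
    by (rule LIMSEQ_le[OF lhs' rhs]) (use step in auto)
qed

text \<open>The convex functions are \<open>\<beta>\<^sub>n(t) = sqrt (t\<^sup>2 + e\<^sub>n\<^sup>2) - e\<^sub>n\<close> with \<open>e\<^sub>n \<rightarrow> 0\<close>.\<close>

theorem Kato_inequality:
  fixes u F \<xi> :: "'a \<Rightarrow> real" and \<eta> :: "nat \<Rightarrow> 'a \<Rightarrow> real"
  assumes u: "wL1 u" and F: "wL1 F" and \<xi>: "tame R \<xi>" and \<xi>_nonneg: "\<And>x. 0 \<le> \<xi> x"
    and \<eta>: "\<And>n. tame (\<rho> n) (\<eta> n)" and nn: "\<And>n z. 0 \<le> \<eta> n z"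
    and one: "\<And>n. (LBINT z. \<eta> n z) = 1" and \<rho>: "\<rho> \<longlonglongrightarrow> 0"
    and eq: "\<And>n x. \<xi> x \<noteq> 0 \<Longrightarrow> - conv u (Lop (\<eta> n)) x = conv F (\<eta> n) x"
  shows "(LBINT x. \<bar>u x\<bar> * (- Lop \<xi> x)) \<le> (LBINT x. \<xi> x * sgn (u x) * F x)"
proof -
  define e where "e n = inverse (real (Suc n))" for n
  have e: "e n > 0" for n by (simp add: e_def)
  have e0: "e \<longlonglongrightarrow> 0" unfolding e_def[abs_def] by (rule LIMSEQ_inverse_real_of_nat)
  define s where "s n t = sqrt (t\<^sup>2 + (e n)\<^sup>2)" for n t
  define \<beta> where "\<beta> n t = s n t - e n" for n t
  define \<beta>' where "\<beta>' n t = t / s n t" for n t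
  have s_pos: "s n t > 0" for n t
    using e[of n] by (simp add: s_def add_nonneg_pos)
  have s_sq: "(s n t)\<^sup>2 = t\<^sup>2 + (e n)\<^sup>2" for n t by (simp add: s_def)
  have s_ge: "\<bar>t\<bar> \<le> s n t" "e n \<le> s n t" for n t
    using e[of n] by (auto simp: s_def intro!: real_le_rsqrt)
  have s_le: "s n t \<le> \<bar>t\<bar> + e n" for n t
    unfolding s_def using sqrt_add_le_add_sqrt[of "t\<^sup>2" "(e n)\<^sup>2"] e[of n] by simp
  have \<beta>_le: "\<bar>\<beta> n t\<bar> \<le> \<bar>t\<bar>" for n t
    using s_ge(1)[of t n] s_ge(2)[of n t] s_le[of n t] by (simp add: \<beta>_def)
  have \<beta>'_le: "\<bar>\<beta>' n t\<bar> \<le> 1" for n t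
    using s_ge(1)[of t n] s_pos[of n t] by (simp add: \<beta>'_def)
  have convex: "\<beta> n b - \<beta> n a \<ge> \<beta>' n a * (b - a)" for n a b
  proof -
    \<comment> \<open>the Cauchy-Schwarz inequality for the vectors \<open>(a, e\<^sub>n)\<close> and \<open>(b, e\<^sub>n)\<close>\<close>
    have "(a * b + (e n)\<^sup>2)\<^sup>2 \<le> (a\<^sup>2 + (e n)\<^sup>2) * (b\<^sup>2 + (e n)\<^sup>2)"
    proof -
      have "(a\<^sup>2 + (e n)\<^sup>2) * (b\<^sup>2 + (e n)\<^sup>2) - (a * b + (e n)\<^sup>2)\<^sup>2 = (e n * (a - b))\<^sup>2"
        by (simp add: power2_eq_square algebra_simps)
      then show ?thesis using zero_le_power2[of "e n * (a - b)"] by linarith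
    qed
    then have "(a * b + (e n)\<^sup>2)\<^sup>2 \<le> (s n a * s n b)\<^sup>2" by (simp add: power_mult_distrib s_sq)
    then have "a * b + (e n)\<^sup>2 \<le> s n a * s n b"
      by (rule power2_le_imp_le) (intro mult_nonneg_nonneg less_imp_le s_pos)
    then have "a * (b - a) \<le> s n a * (s n b - s n a)"
      using s_sq[of n a] by (simp add: algebra_simps power2_eq_square)
    then show ?thesis using s_pos[of n a] by (simp add: \<beta>_def \<beta>'_def field_simps)
  qed
  have cont: "continuous_on UNIV (\<beta>' n)" for n
  proof -
    have "\<forall>t\<in>UNIV. s n t \<noteq> 0" using s_pos by (metis less_irrefl)
    then show ?thesis unfolding \<beta>'_def s_def by (intro continuous_intros)
  qed
  have step: "(LBINT x. \<beta> n (u x) * (- Lop \<xi> x)) \<le> (LBINT x. \<xi> x * \<beta>' n (u x) * F x)" for n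
    by (rule convex_inequality[OF assms convex \<beta>_le \<beta>'_le cont])
  have b\<xi>: "bump R \<xi>" using \<xi> by (simp add: tame_def)
  have m [measurable]: "\<xi> \<in> borel_measurable borel" "u \<in> borel_measurable borel" "F \<in> borel_measurable borel"
    using b\<xi> u F by (simp_all add: bump_def wL1_def)
  note [measurable] = Lop_measurable[OF m(1)]
  have [measurable]: "\<beta> n \<in> borel_measurable borel" "\<beta>' n \<in> borel_measurable borel" for n
    unfolding \<beta>_def[abs_def] \<beta>'_def[abs_def] s_def[abs_def] by measurable
  have s_lim: "(\<lambda>n. s n t) \<longlonglongrightarrow> \<bar>t\<bar>" for t
  proof -
    have "(\<lambda>n. s n t) \<longlonglongrightarrow> sqrt (t\<^sup>2 + 0\<^sup>2)" unfolding s_def by (intro tendsto_intros e0)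
    then show ?thesis by simp
  qed
  have lhs: "(\<lambda>n. LBINT x. \<beta> n (u x) * (- Lop \<xi> x)) \<longlonglongrightarrow> (LBINT x. \<bar>u x\<bar> * (- Lop \<xi> x))"
  proof (rule integral_dominated_convergence)
    show "integrable lborel (\<lambda>x. \<bar>u x * Lop \<xi> x\<bar>)"
      using wL1_mult_Lop_integrable[OF u \<xi>] by simp
    have "(\<lambda>n. \<beta> n t) \<longlonglongrightarrow> \<bar>t\<bar> - 0" for t
      unfolding \<beta>_def by (intro tendsto_intros s_lim e0)
    then show "AE x in lborel. (\<lambda>n. \<beta> n (u x) * (- Lop \<xi> x)) \<longlonglongrightarrow> \<bar>u x\<bar> * (- Lop \<xi> x)"
      by (intro always_eventually allI tendsto_mult tendsto_const) simp
    show "AE x in lborel. norm (\<beta> n (u x) * (- Lop \<xi> x)) \<le> \<bar>u x * Lop \<xi> x\<bar>" for n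
      using \<beta>_le[of n] by (simp add: abs_mult mult_right_mono)
  qed measurable
  have rhs: "(\<lambda>n. LBINT x. \<xi> x * \<beta>' n (u x) * F x) \<longlonglongrightarrow> (LBINT x. \<xi> x * sgn (u x) * F x)"
  proof (rule integral_dominated_convergence)
    show "integrable lborel (\<lambda>x. \<bar>\<xi> x * F x\<bar>)" using integrable_bump_mult[OF F b\<xi>] by simp
    have "(\<lambda>n. \<beta>' n t) \<longlonglongrightarrow> sgn t" for t
    proof (cases "t = 0")
      case False
      then have "(\<lambda>n. t / s n t) \<longlonglongrightarrow> t / \<bar>t\<bar>" by (intro tendsto_intros s_lim) simp
      then show ?thesis using False by (simp add: \<beta>'_def sgn_div_norm divide_inverse mult.commute)
    qed (simp add: \<beta>'_def)
    then show "AE x in lborel. (\<lambda>n. \<xi> x * \<beta>' n (u x) * F x) \<longlonglongrightarrow> \<xi> x * sgn (u x) * F x"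
      by (intro always_eventually allI tendsto_mult tendsto_const)
    have "norm (\<xi> x * \<beta>' n (u x) * F x) \<le> \<bar>\<xi> x * F x\<bar>" for n x
    proof -
      have "\<bar>\<xi> x * F x\<bar> * \<bar>\<beta>' n (u x)\<bar> \<le> \<bar>\<xi> x * F x\<bar> * 1" by (intro mult_left_mono \<beta>'_le) auto
      then show ?thesis by (simp add: abs_mult mult_ac)
    qed
    then show "AE x in lborel. norm (\<xi> x * \<beta>' n (u x) * F x) \<le> \<bar>\<xi> x * F x\<bar>" for n by simp
  qed measurable
  show ?thesis by (rule LIMSEQ_le[OF lhs rhs]) (use step in auto)
qed

end

section \<open>Test functions\<close>

lemma Ck_cmult: "Ck k f \<Longrightarrow> Ck k (\<lambda>x. c * f x)"
proof (induction k arbitrary: f)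
  case 0
  then show ?case by (simp add: continuous_on_mult_left)
next
  case (Suc k)
  have d: "(f has_derivative frechet_derivative f (at x)) (at x)" for x
    using Suc.prems by (simp add: frechet_derivative_works)
  have "((\<lambda>x. c * f x) has_derivative (\<lambda>h. c * frechet_derivative f (at x) h)) (at x)" for x
    by (intro derivative_intros d)
  then have "(\<lambda>x. c * f x) differentiable (at x)"
      "frechet_derivative (\<lambda>x. c * f x) (at x) = (\<lambda>h. c * frechet_derivative f (at x) h)" for x
    using frechet_derivative_at[symmetric] differentiableI by blast+
  then show ?case using Suc by simp
qed

lemma Ck_affine: "Ck k f \<Longrightarrow> Ck k (\<lambda>x. f (a + c *\<^sub>R x))"
proof (induction k arbitrary: f)
  case 0
  then show ?case
    by (auto intro!: continuous_on_compose2[of UNIV f] continuous_intros)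
next
  case (Suc k)
  have d: "(f has_derivative frechet_derivative f (at x)) (at x)" for x
    using Suc.prems by (simp add: frechet_derivative_works)
  have "((\<lambda>x. f (a + c *\<^sub>R x)) has_derivative (\<lambda>h. c * frechet_derivative f (at (a + c *\<^sub>R x)) h)) (at x)" for x
  proof -
    have "((\<lambda>x. a + c *\<^sub>R x) has_derivative (\<lambda>h. c *\<^sub>R h)) (at x)"
      by (auto intro!: derivative_eq_intros)
    from has_derivative_compose[OF this d]
    have "((\<lambda>x. f (a + c *\<^sub>R x)) has_derivative (\<lambda>h. frechet_derivative f (at (a + c *\<^sub>R x)) (c *\<^sub>R h))) (at x)" .
    moreover have "linear (frechet_derivative f (at (a + c *\<^sub>R x)))"
      using d by (rule has_derivative_linear)
    ultimately show ?thesis by (simp add: linear_scale)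
  qed
  then have "(\<lambda>x. f (a + c *\<^sub>R x)) differentiable (at x)"
      "frechet_derivative (\<lambda>x. f (a + c *\<^sub>R x)) (at x) = (\<lambda>h. c * frechet_derivative f (at (a + c *\<^sub>R x)) h)" for x
    using frechet_derivative_at[symmetric] differentiableI by blast+
  moreover have "Ck k (\<lambda>x. c * frechet_derivative f (at (a + c *\<^sub>R x)) b)" if "b \<in> Basis" for b
    using Suc.prems that by (intro Ck_cmult Suc.IH[of "\<lambda>x. frechet_derivative f (at x) b"]) simp
  ultimately show ?case by simp
qed

lemma Ck_continuous: "Ck k f \<Longrightarrow> continuous_on UNIV f"
  by (cases k) (auto intro!: continuous_at_imp_continuous_on differentiable_imp_continuous_within)

lemma continuous_compact_support_bounded:
  fixes f :: "'a::euclidean_space \<Rightarrow> real"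
  assumes "continuous_on UNIV f" "\<And>x. norm x > r \<Longrightarrow> f x = 0"
  shows "\<exists>B. \<forall>x. \<bar>f x\<bar> \<le> B"
proof -
  have "compact (f ` cball 0 r)"
    using assms(1) by (intro compact_continuous_image) (auto intro: continuous_on_subset)
  then have "bounded (f ` cball 0 r)" by (rule compact_imp_bounded)
  then obtain B where B: "\<forall>x\<in>cball 0 r. \<bar>f x\<bar> \<le> B"
    unfolding bounded_iff by auto
  have "\<bar>f x\<bar> \<le> max B 0" for x
    using bspec[OF B, of x] assms(2)[of x] by (cases "norm x > r") auto
  then show ?thesis by (intro exI allI)
qed

lemma frechet_derivative_outside_support:
  fixes f :: "'a::euclidean_space \<Rightarrow> real"
  assumes "\<And>x. norm x > r \<Longrightarrow> f x = 0" "norm x > r"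
  shows "frechet_derivative f (at x) b = 0"
proof -
  have "((\<lambda>x. 0 :: real) has_derivative (\<lambda>h. 0)) (at x)" by simp
  then have "(f has_derivative (\<lambda>h. 0)) (at x)"
  proof (rule has_derivative_transform_within_open)
    show "open (- cball 0 r)" by (intro open_Compl) simp
  qed (use assms in auto)
  from frechet_derivative_at[OF this] show ?thesis by (metis (full_types))
qed

lemma derivative_le_partials:
  fixes f' :: "'a::euclidean_space \<Rightarrow> real"
  assumes "linear f'" "\<And>b. b \<in> Basis \<Longrightarrow> \<bar>f' b\<bar> \<le> B"
  shows "\<bar>f' h\<bar> \<le> real DIM('a) * B * norm h"
proof -
  have "f' h = f' (\<Sum>b\<in>Basis. (h \<bullet> b) *\<^sub>R b)" by (simp add: euclidean_representation)
  also have "\<dots> = (\<Sum>b\<in>Basis. (h \<bullet> b) * f' b)"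
    using assms(1) by (simp add: linear_sum linear_scale)
  also have "\<bar>\<dots>\<bar> \<le> (\<Sum>b\<in>(Basis :: 'a set). norm h * B)"
    using assms(2) by (intro order_trans[OF sum_abs] sum_mono) (auto simp: abs_mult Basis_le_norm intro!: mult_mono)
  finally show ?thesis by (simp add: mult_ac)
qed

lemma Ck_1_Lipschitz:
  fixes f :: "'a::euclidean_space \<Rightarrow> real"
  assumes f: "Ck 1 f" "\<And>x. norm x > r \<Longrightarrow> f x = 0"
  shows "\<exists>L\<ge>0. \<forall>x y. \<bar>f x - f y\<bar> \<le> L * norm (x - y)"
proof -
  have d: "(f has_derivative frechet_derivative f (at x)) (at x)" for x
    using f(1) by (simp add: frechet_derivative_works)
  have "\<exists>B. \<forall>x. \<bar>frechet_derivative f (at x) b\<bar> \<le> B" if "b \<in> Basis" for b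
    using f that by (intro continuous_compact_support_bounded[of _ r] frechet_derivative_outside_support[of r]) auto
  then obtain B where B: "\<And>b x. b \<in> Basis \<Longrightarrow> \<bar>frechet_derivative f (at x) b\<bar> \<le> B b" by metis
  define M where "M = (\<Sum>b\<in>(Basis :: 'a set). \<bar>B b\<bar>)"
  have M: "\<bar>frechet_derivative f (at x) b\<bar> \<le> M" if "b \<in> Basis" for b x
  proof -
    have "\<bar>B b\<bar> \<le> M" unfolding M_def using that by (intro member_le_sum) auto
    then show ?thesis using B[OF that, of x] by linarith
  qed
  have "M \<ge> 0" by (simp add: M_def sum_nonneg)
  have "norm (f x - f y) \<le> real DIM('a) * M * norm (x - y)" for x y
  proof (rule differentiable_bound[where S=UNIV and f'="\<lambda>x. frechet_derivative f (at x)"])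
    fix x :: 'a
    show "onorm (frechet_derivative f (at x)) \<le> real DIM('a) * M"
      by (rule onorm_bound) (use \<open>M \<ge> 0\<close> derivative_le_partials[OF has_derivative_linear[OF d] M] in auto)
  qed (use d in auto)
  then show ?thesis using \<open>M \<ge> 0\<close> by (intro exI[of _ "real DIM('a) * M"]) auto
qed

text \<open>The derivative of \<open>z \<mapsto> f(x + z) + f(x - z)\<close> at \<open>z\<close> is \<open>O(|z|)\<close>, since the first derivatives of \<open>f\<close> are
  Lipschitz continuous.\<close>

lemma Ck_2_second_difference:
  fixes f :: "'a::euclidean_space \<Rightarrow> real"
  assumes f: "Ck 2 f" "\<And>x. norm x > r \<Longrightarrow> f x = 0"
  shows "\<exists>M. \<forall>x z. \<bar>f (x + z) + f (x - z) - 2 * f x\<bar> \<le> M * (norm z)\<^sup>2"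
proof -
  let ?D = "\<lambda>x. frechet_derivative f (at x)"
  have f2: "\<And>x. f differentiable (at x)" "\<And>b. b \<in> Basis \<Longrightarrow> Ck 1 (\<lambda>x. ?D x b)"
    using f(1) by (simp_all add: numeral_2_eq_2)
  have d: "(f has_derivative ?D x) (at x)" for x
    using f2(1) by (simp add: frechet_derivative_works)
  have "\<exists>L\<ge>0. \<forall>x y. \<bar>?D x b - ?D y b\<bar> \<le> L * norm (x - y)" if "b \<in> Basis" for b
    using f2(2)[OF that] f(2) by (intro Ck_1_Lipschitz[of _ r] frechet_derivative_outside_support[of r]) auto
  then obtain L where L: "\<And>b. b \<in> Basis \<Longrightarrow> L b \<ge> 0"
      "\<And>b x y. b \<in> Basis \<Longrightarrow> \<bar>?D x b - ?D y b\<bar> \<le> L b * norm (x - y)" by metis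
  define M where "M = (\<Sum>b\<in>(Basis :: 'a set). L b)"
  have M: "\<bar>?D x b - ?D y b\<bar> \<le> M * norm (x - y)" if "b \<in> Basis" for b x y
  proof -
    have "L b \<le> M" unfolding M_def using that L(1) by (intro member_le_sum) auto
    then have "L b * norm (x - y) \<le> M * norm (x - y)" by (intro mult_right_mono) auto
    then show ?thesis using L(2)[OF that, of x y] by linarith
  qed
  have "M \<ge> 0" unfolding M_def using L(1) by (intro sum_nonneg)
  have "\<bar>f (x + z) + f (x - z) - 2 * f x\<bar> \<le> (real DIM('a) * M * 2) * (norm z)\<^sup>2" for x z
  proof -
    define \<phi> where "\<phi> y = f (x + y) + f (x - y)" for y
    have "norm (\<phi> z - \<phi> 0) \<le> (real DIM('a) * (M * (2 * norm z))) * norm (z - 0)"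
    proof (rule differentiable_bound[where S="cball 0 (norm z)" and f'="\<lambda>y h. ?D (x + y) h - ?D (x - y) h"])
      fix y :: 'a assume y: "y \<in> cball 0 (norm z)"
      have 1: "((\<lambda>y. f (x + y)) has_derivative (\<lambda>h. ?D (x + y) h)) (at y)"
        by (rule has_derivative_compose[OF _ d]) (auto intro!: derivative_eq_intros)
      have 2: "((\<lambda>y. f (x - y)) has_derivative (\<lambda>h. ?D (x - y) (- h))) (at y)"
        by (rule has_derivative_compose[OF _ d]) (auto intro!: derivative_eq_intros)
      have lin: "linear (?D w)" for w using has_derivative_linear[OF d] .
      show "(\<phi> has_derivative (\<lambda>h. ?D (x + y) h - ?D (x - y) h)) (at y within cball 0 (norm z))"
        unfolding \<phi>_def[abs_def]
        using has_derivative_add[OF 1 2] by (simp add: linear_neg[OF lin] has_derivative_at_withinI)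
      have lin2: "linear (\<lambda>h. ?D (x + y) h - ?D (x - y) h)"
        by (intro linear_compose_sub lin)
      show "onorm (\<lambda>h. ?D (x + y) h - ?D (x - y) h) \<le> real DIM('a) * (M * (2 * norm z))"
      proof (rule onorm_bound)
        show "0 \<le> real DIM('a) * (M * (2 * norm z))" using \<open>M \<ge> 0\<close> by simp
        fix h
        have "\<bar>?D (x + y) b - ?D (x - y) b\<bar> \<le> M * (2 * norm z)" if "b \<in> Basis" for b
        proof -
          have "norm (x + y - (x - y)) = 2 * norm y"
            by (simp add: scaleR_2[symmetric])
          then have "\<bar>?D (x + y) b - ?D (x - y) b\<bar> \<le> M * (2 * norm y)"
            using M[OF that, of "x + y" "x - y"] by simp
          also have "\<dots> \<le> M * (2 * norm z)" using y \<open>M \<ge> 0\<close> by (intro mult_left_mono) auto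
          finally show ?thesis .
        qed
        from derivative_le_partials[OF lin2 this]
        show "norm (?D (x + y) h - ?D (x - y) h) \<le> real DIM('a) * (M * (2 * norm z)) * norm h" by simp
      qed
    qed auto
    then show ?thesis by (simp add: \<phi>_def power2_eq_square mult_ac)
  qed
  then show ?thesis by blast
qed

lemma tame_smooth:
  fixes f :: "'a::euclidean_space \<Rightarrow> real"
  assumes f: "\<And>k. Ck k f" "\<And>x. norm x > r \<Longrightarrow> f x = 0"
  shows "tame r f"
proof -
  have c: "continuous_on UNIV f" using Ck_continuous[OF f(1)] .
  show ?thesis
    unfolding tame_def bump_def
    using borel_measurable_continuous_onI[OF c] continuous_compact_support_bounded[OF c f(2)]
      Ck_2_second_difference[OF f] f(2) by blast
qed

lemma integral_pos_continuous:
  fixes f :: "'a::euclidean_space \<Rightarrow> real"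
  assumes f: "continuous_on UNIV f" "integrable lborel f" "\<And>x. 0 \<le> f x" "f a \<noteq> 0"
  shows "0 < (LBINT x. f x)"
proof -
  have "(LBINT x. f x) \<noteq> 0"
  proof
    assume "(LBINT x. f x) = 0"
    then have "AE x in lborel. f x = 0"
      using integral_nonneg_eq_0_iff_AE[OF f(2)] f(3) by simp
    then have "AE x in lebesgue. x \<notin> {x. f x \<noteq> 0}"
      by (intro AE_completion) simp
    moreover have o: "open {x. f x \<noteq> 0}"
      using f(1) by (intro open_Collect_neq) auto
    then have "{x. f x \<noteq> 0} \<in> sets lebesgue" by (intro sets_completionI_sets) simp
    ultimately have "negligible {x. f x \<noteq> 0}"
      by (simp only: negligible_iff_null_sets AE_iff_null_sets)
    moreover note o
    ultimately show False using open_not_negligible[of "{x. f x \<noteq> 0}"] f(4) by auto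
  qed
  moreover have "0 \<le> (LBINT x. f x)" using f(3) by (intro Bochner_Integration.integral_nonneg)
  ultimately show ?thesis by simp
qed

section \<open>The operator of the jump kernel\<close>

context cm_levy_density begin


lemma jump_kernel_isCont:
  assumes r: "r > 0"
  shows "isCont (jump_kernel d \<nu>) r"
  unfolding continuous_at_sequentially
proof (intro allI impI)
  fix X assume X: "X \<longlonglongrightarrow> r"
  obtain C where C: "C > 0" "\<And>q s. q\<^sup>2 / 4 \<ge> r\<^sup>2 / 16 \<Longrightarrow> dens d q s \<le> C * (min 1 s * ext s)"
    using dens_le[of "r\<^sup>2 / 16" d] r by auto
  define Y where "Y n = max (X n) (r / 2)" for n
  have Y: "Y \<longlonglongrightarrow> max r (r / 2)" unfolding Y_def by (intro tendsto_intros X)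
  then have Y: "Y \<longlonglongrightarrow> r" using r by simp
  have "(\<lambda>n. LBINT s. dens d (Y n) s) \<longlonglongrightarrow> (LBINT s. dens d r s)"
  proof (rule integral_dominated_convergence)
    show "integrable lborel (\<lambda>s. C * (min 1 s * ext s))" using ext_integrable by simp
    have "(\<lambda>n. dens d (Y n) s) \<longlonglongrightarrow> dens d r s" for s
      unfolding dens_def by (cases "s = 0") (auto intro!: tendsto_intros Y)
    then show "AE s in lborel. (\<lambda>n. dens d (Y n) s) \<longlonglongrightarrow> dens d r s" by simp
    fix n
    have "(r / 2)\<^sup>2 \<le> (Y n)\<^sup>2" using r by (intro power_mono) (auto simp: Y_def)
    then have "(Y n)\<^sup>2 / 4 \<ge> r\<^sup>2 / 16" by (simp add: power_divide)
    from C(2)[OF this] show "AE s in lborel. norm (dens d (Y n) s) \<le> C * (min 1 s * ext s)"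
      using dens_nonneg by simp
  qed simp_all
  then have "(\<lambda>n. jump_kernel d \<nu> (Y n)) \<longlonglongrightarrow> jump_kernel d \<nu> r" by (simp add: jump_kernel_eq)
  moreover have "\<forall>\<^sub>F n in sequentially. jump_kernel d \<nu> (Y n) = (jump_kernel d \<nu> \<circ> X) n"
  proof -
    have "\<forall>\<^sub>F n in sequentially. X n > r / 2" using order_tendstoD(1)[OF X, of "r / 2"] r by simp
    then show ?thesis by eventually_elim (simp add: Y_def)
  qed
  ultimately show "(jump_kernel d \<nu> \<circ> X) \<longlonglongrightarrow> jump_kernel d \<nu> r"
    by (rule Lim_transform_eventually)
qed

text \<open>The shift by \<open>2\<close> keeps the weight away from the singularity of the jump kernel at \<open>0\<close>.\<close>

lemma nonlocal_kernel_jump_kernel: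
  "nonlocal_kernel (\<lambda>z :: 'a::euclidean_space. jump_kernel DIM('a) \<nu> (norm z))
    (\<lambda>x. jump_kernel DIM('a) \<nu> (norm x + 2))"
proof
  let ?d = "DIM('a)"
  let ?j = "jump_kernel ?d \<nu>"
  show "(\<lambda>z :: 'a. ?j (norm z)) \<in> borel_measurable borel" by measurable
  show "0 \<le> ?j (norm z)" "?j (norm (- z)) = ?j (norm z)" "?j (norm (- z) + 2) = ?j (norm z + 2)"
      "0 < ?j (norm z + 2)" for z :: 'a
    by (auto intro!: jump_kernel_nonneg jump_kernel_pos add_nonneg_pos)
  show "integrable lborel (\<lambda>z :: 'a. min 1 ((norm z)\<^sup>2) * ?j (norm z))"
    by (rule integrable_min_square_jump_kernel)
  show "isCont (\<lambda>x :: 'a. ?j (norm x + 2)) x" for x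
    by (rule isCont_o2[where g="?j"]) (auto intro!: jump_kernel_isCont add_nonneg_pos)
  show "integrable lborel (\<lambda>x :: 'a. ?j (norm x + 2))"
  proof (rule Bochner_Integration.integrable_bound)
    show "integrable lborel (\<lambda>x :: 'a. ?j 2 * indicator (cball 0 1) x + min 1 ((norm x)\<^sup>2) * ?j (norm x))"
      using emeasure_compact_finite[of "cball (0 :: 'a) 1"]
      by (intro Bochner_Integration.integrable_add integrable_mult_right integrable_min_square_jump_kernel)
        (simp add: integrable_indicator_iff)
    have "?j (norm x + 2) \<le> ?j 2 * indicator (cball 0 1) x + min 1 ((norm x)\<^sup>2) * ?j (norm x)" for x :: 'a
    proof (cases "norm x \<le> 1")
      case True
      have "?j (norm x + 2) \<le> ?j 2" by (intro jump_kernel_antimono) auto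
      moreover have "0 \<le> min 1 ((norm x)\<^sup>2) * ?j (norm x)" by (simp add: jump_kernel_nonneg)
      ultimately show ?thesis using True by simp
    next
      case False
      then have "?j (norm x + 2) \<le> ?j (norm x)" by (intro jump_kernel_antimono) auto
      moreover have "1 \<le> (norm x)\<^sup>2" using False by (simp add: one_le_power)
      ultimately show ?thesis using False by simp
    qed
    then show "AE x in lborel. norm (?j (norm (x :: 'a) + 2)) \<le>
        norm (?j 2 * indicator (cball 0 1) x + min 1 ((norm x)\<^sup>2) * ?j (norm x))"
      by (simp add: jump_kernel_nonneg)
  qed measurable
  show "\<exists>C>0. \<forall>(x :: 'a) h. norm h \<le> R \<longrightarrow> ?j (norm (x + h) + 2) \<le> C * ?j (norm x + 2)" for R
  proof -
    obtain n :: nat where n: "R \<le> real n" using real_arch_simple by blast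
    obtain C where C: "C > 0" "\<And>r. r > 1 \<Longrightarrow> ?j r \<le> C * ?j (r + real n)"
      using jump_kernel_comparison[of 1 ?d n] by auto
    have "?j (norm (x + h) + 2) \<le> C * ?j (norm x + 2)" if "norm h \<le> R" for x h :: 'a
    proof -
      have "1 < norm (x + h) + 2" using norm_ge_zero[of "x + h"] by linarith
      then have "?j (norm (x + h) + 2) \<le> C * ?j (norm (x + h) + 2 + real n)" by (rule C(2))
      also have "\<dots> \<le> C * ?j (norm x + 2)"
      proof -
        have "norm x \<le> norm (x + h) + norm h" using norm_triangle_ineq4[of "x + h" h] by simp
        then have "norm x + 2 \<le> norm (x + h) + 2 + real n" using that n by linarith
        then show ?thesis using C(1) by (intro mult_left_mono jump_kernel_antimono) (auto intro: add_nonneg_pos)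
      qed
      finally show ?thesis .
    qed
    then show ?thesis using C(1) by blast
  qed
  show "\<exists>C>0. \<forall>z :: 'a. \<delta> < norm z \<longrightarrow> ?j (norm z) \<le> C * ?j (norm z + 2)" if "0 < \<delta>" for \<delta>
    using jump_kernel_comparison[OF that, of ?d 2] by auto
qed


lemma nonlocal_op_eq_Lop:
  fixes g :: "'a::euclidean_space \<Rightarrow> real"
  assumes g: "tame r g"
  shows "nonlocal_op \<nu> g x = nonlocal_kernel.Lop (\<lambda>z. jump_kernel DIM('a) \<nu> (norm z)) g x"
proof -
  let ?J = "\<lambda>z :: 'a. jump_kernel DIM('a) \<nu> (norm z)"
  interpret nonlocal_kernel ?J "\<lambda>x. jump_kernel DIM('a) \<nu> (norm x + 2)"
    by (rule nonlocal_kernel_jump_kernel)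
  have [measurable]: "g \<in> borel_measurable borel" using g by (simp add: tame_def bump_def)
  have "(LINT y:{y. \<epsilon> < norm (y - x)}|lebesgue. (g y - g x) * ?J (y - x)) = trunc \<epsilon> g x" for \<epsilon>
  proof -
    define H where "H y = (g y - g x) * K \<epsilon> (y - x)" for y
    have [measurable]: "H \<in> borel_measurable borel" unfolding H_def[abs_def] by measurable
    have "(LINT y:{y. \<epsilon> < norm (y - x)}|lebesgue. (g y - g x) * ?J (y - x)) = (\<integral>y. H y \<partial>lebesgue)"
      unfolding set_lebesgue_integral_def
      by (intro Bochner_Integration.integral_cong) (auto simp: H_def K_def indicator_def)
    also have "\<dots> = (LBINT y. H y)" by (rule integral_completion) simp
    also have "\<dots> = (LBINT z. H (x + z))" by (rule lborel_integral_translate[symmetric]) simp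
    finally show ?thesis by (simp add: H_def trunc_def)
  qed
  then have "nonlocal_op \<nu> g x = Lim (at_right 0) (\<lambda>\<epsilon>. trunc \<epsilon> g x)"
    by (simp add: nonlocal_op_def)
  moreover have "((\<lambda>\<epsilon>. trunc \<epsilon> g x) \<longlongrightarrow> Lop g x) (at_right 0)"
    unfolding tendsto_at_iff_sequentially comp_def by (auto intro!: trunc_tendsto_Lop[OF g])
  ultimately show ?thesis by (simp add: tendsto_Lim)
qed

end

lemma nonlocal_op_zero: "nonlocal_op \<nu> (\<lambda>_. 0) x = 0"
  unfolding nonlocal_op_def by (simp add: tendsto_Lim)

theorem proposition5p1:
  fixes \<phi> \<nu> :: "real \<Rightarrow> real"
    and \<Omega> :: "'a::euclidean_space set"
    and F u \<xi> :: "'a \<Rightarrow> real"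
  assumes "DIM('a) \<ge> 2"
    and "complete_bernstein_no_drift \<phi> \<nu>"
    and "weak_scaling \<phi>"
    and "bounded \<Omega>"
    and "C11_open \<Omega>"
    and "F \<in> L1_loc \<Omega>"
    and "u \<in> weighted_L1 \<nu>"
    and "distributional_solution \<nu> \<Omega> F u"
    and "\<xi> \<in> test_functions \<Omega>"
    and "\<And>x. 0 \<le> \<xi> x"
  shows "(LINT x|lebesgue. \<bar>u x\<bar> * (- nonlocal_op \<nu> \<xi> x))
           \<le> (LINT x:\<Omega>|lebesgue. \<xi> x * sgn (u x) * F x)"
proof (cases "\<forall>x. \<xi> x = 0")
  case True
  then have "\<xi> = (\<lambda>_. 0)" by auto
  then show ?thesis by (simp add: nonlocal_op_zero set_lebesgue_integral_def)
next
  case False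
  then obtain a where a: "\<xi> a \<noteq> 0" by blast
  have cm: "completely_monotone \<nu>" and levy: "levy_density \<nu>"
    and \<phi>: "\<And>x. x \<ge> 0 \<Longrightarrow> \<phi> x = (LINT s:{0<..}|lebesgue. (1 - exp (- (x * s))) * \<nu> s)"
    using assms(2) by (auto simp: complete_bernstein_no_drift_def)
  have pos: "\<nu> s > 0" if "s > 0" for s
  proof (rule ccontr)
    assume "\<not> \<nu> s > 0"
    then have "\<nu> s = 0" using completely_monotone_nonneg[OF cm that] by simp
    then have z: "\<nu> t = 0" if "t > 0" for t
      using completely_monotone_zero_spreads[OF cm \<open>s > 0\<close> _ that] by blast
    \<comment> \<open>a vanishing density makes \<open>\<phi>\<close> vanish, in contradiction to the lower scaling bound at \<open>1\<close>\<close>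
    have "indicator {0<..} t *\<^sub>R ((1 - exp (- (1 * t))) * \<nu> t) = 0" for t
      by (auto simp: indicator_def z)
    then have "\<phi> 1 = 0" using \<phi>[of 1] by (simp only: set_lebesgue_integral_def) simp
    moreover obtain a1 \<delta>1 where "0 < a1" "\<And>x t. x \<ge> 1 \<Longrightarrow> t \<ge> 1 \<Longrightarrow> a1 * x powr \<delta>1 \<le> \<phi> (x * t) / \<phi> t"
      using assms(3) unfolding weak_scaling_def by blast
    from this(1) this(2)[of 1 1] have "\<phi> 1 \<noteq> 0" by auto
    ultimately show False by simp
  qed
  interpret cm_levy_density \<nu> by standard (use cm levy pos in auto)
  let ?j = "jump_kernel DIM('a) \<nu>"
  let ?W = "\<lambda>x :: 'a. ?j (norm x + 2)"
  interpret N: nonlocal_kernel "\<lambda>z :: 'a. ?j (norm z)" ?W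
    by (rule nonlocal_kernel_jump_kernel)

  define S where "S = closure {x. \<xi> x \<noteq> 0}"
  have Ck: "Ck k \<xi>" and S: "compact S" "S \<subseteq> \<Omega>" for k
    using assms(9) by (auto simp: test_functions_def S_def)
  have inS: "x \<in> S" if "\<xi> x \<noteq> 0" for x
    using that closure_subset[of "{x. \<xi> x \<noteq> 0}"] by (auto simp: S_def)
  obtain R where R: "R > 0" "\<And>x. x \<in> S \<Longrightarrow> norm x \<le> R"
    using compact_imp_bounded[OF S(1)] unfolding bounded_pos by blast
  have \<xi>R: "\<xi> x = 0" if "norm x > R" for x using R(2)[of x] inS[of x] that by force
  have tame_\<xi>: "tame R \<xi>" by (rule tame_smooth[OF Ck \<xi>R])
  have c\<xi>: "continuous_on UNIV \<xi>" by (rule Ck_continuous[OF Ck])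
  then have [measurable]: "\<xi> \<in> borel_measurable borel" by (rule borel_measurable_continuous_onI)

  have "open \<Omega>" using assms(5) by (simp add: C11_open_def)
  then obtain d where d: "d > 0" "(\<Union>x\<in>S. ball x d) \<subseteq> \<Omega>"
    using compact_subset_open_imp_ball_epsilon_subset[OF S(1) _ S(2)] by blast
  \<comment> \<open>\<open>T\<close> is a compact neighbourhood in \<open>\<Omega>\<close> of the support of \<open>\<xi>\<close>, on which \<open>F\<close> is integrable\<close>
  define T where "T = {x + y |x y. x \<in> S \<and> y \<in> cball 0 (d / 2)}"
  have "compact T" unfolding T_def by (intro compact_sums S(1) compact_cball)
  have T: "y \<in> T" if "x \<in> S" "norm (y - x) \<le> d / 2" for x y
    unfolding T_def using that by (intro CollectI exI[of _ x] exI[of _ "y - x"]) auto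
  have "T \<subseteq> \<Omega>"
  proof
    fix w assume "w \<in> T"
    then obtain x y where "w = x + y" "x \<in> S" "norm y \<le> d / 2" by (auto simp: T_def)
    then have "w \<in> ball x d" using d(1) by (simp add: dist_norm)
    then show "w \<in> \<Omega>" using d(2) \<open>x \<in> S\<close> by blast
  qed

  \<comment> \<open>the mollifiers are dilates of \<open>\<xi>\<close>, by factors \<open>k n\<close> that bring the support into the ball of radius \<open>\<rho> n\<close>\<close>
  define k where "k n = 2 * R * real (Suc n) / d" for n
  define \<rho> where "\<rho> n = d / 2 * inverse (real (Suc n))" for n
  have k: "k n > 0" "k n * \<rho> n = R" for n
    using R(1) d(1) by (simp_all add: k_def \<rho>_def del: of_nat_Suc)
  have \<rho>_le: "\<rho> n \<le> d / 2" for n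
    using d(1) unfolding \<rho>_def by (intro mult_right_le_one_le) (auto simp: field_simps)
  have \<rho>_lim: "\<rho> \<longlonglongrightarrow> 0"
    unfolding \<rho>_def[abs_def] by (rule tendsto_mult_right_zero[OF LIMSEQ_inverse_real_of_nat])
  define I where "I n = (LBINT z. \<xi> (k n *\<^sub>R z))" for n
  have tame_scaled: "tame (\<rho> n) (\<lambda>z. \<xi> (k n *\<^sub>R z))" for n
  proof (rule tame_smooth)
    show "Ck m (\<lambda>z. \<xi> (k n *\<^sub>R z))" for m using Ck_affine[OF Ck, of m 0 "k n"] by simp
    fix z :: 'a assume "norm z > \<rho> n"
    then have "k n * norm z > R" using k(1)[of n] unfolding k(2)[symmetric, of n] by simp
    then show "\<xi> (k n *\<^sub>R z) = 0" using k(1)[of n] by (intro \<xi>R) simp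
  qed
  have I: "I n > 0" for n
    unfolding I_def
  proof (rule integral_pos_continuous)
    show "continuous_on UNIV (\<lambda>z. \<xi> (k n *\<^sub>R z))"
      by (intro continuous_on_compose2[OF c\<xi>] continuous_intros) auto
    show "integrable lborel (\<lambda>z. \<xi> (k n *\<^sub>R z))" using tame_scaled[of n] by (intro bump_integrable[of "\<rho> n"]) (simp add: tame_def)
    show "\<xi> (k n *\<^sub>R (inverse (k n) *\<^sub>R a)) \<noteq> 0" using a k(1)[of n] by simp
  qed (rule assms(10))
  \<comment> \<open>the summand \<open>0\<close> displays an affine substitution, as in \<open>Ck_affine\<close>\<close>
  define \<eta> where "\<eta> n z = inverse (I n) * \<xi> (0 + k n *\<^sub>R z)" for n z
  have \<eta>0: "\<eta> n z = 0" if "norm z > \<rho> n" for n z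
    using tame_scaled[of n] that by (simp add: \<eta>_def tame_def bump_def)
  have tame_\<eta>: "tame (\<rho> n) (\<eta> n)" for n
    by (rule tame_smooth[OF _ \<eta>0]) (simp_all add: \<eta>_def[abs_def] Ck_cmult Ck_affine Ck del: add_0_left)
  have \<eta>_nonneg: "0 \<le> \<eta> n z" for n z
    unfolding \<eta>_def using I[of n] assms(10) by simp
  have \<eta>_one: "(LBINT z. \<eta> n z) = 1" for n
    unfolding \<eta>_def using I[of n] by (simp add: I_def)
  have [measurable]: "\<eta> n \<in> borel_measurable borel" for n
    using tame_\<eta>[of n] by (simp add: tame_def bump_def)

  have um: "u \<in> borel_measurable lebesgue"
    using assms(7) by (auto simp: weighted_L1_def)
  have "integrable lebesgue (\<lambda>x. min 1 (?j (norm x)) *\<^sub>R u x)"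
  proof (subst integrable_density[symmetric])
    show "integrable (density lebesgue (\<lambda>x. ennreal (min 1 (?j (norm x))))) u"
      using assms(7) by (simp add: weighted_L1_def)
    show "(\<lambda>x :: 'a. min 1 (?j (norm x))) \<in> borel_measurable lebesgue"
      by (rule measurable_completion) measurable
  qed (use um in \<open>auto simp: jump_kernel_nonneg\<close>)
  then have ui: "integrable lebesgue (\<lambda>x. min 1 (?j (norm x)) * u x)" by simp
  \<comment> \<open>a Borel representative of \<open>u\<close>, for use with \<open>lborel\<close>; \<open>F\<close> is treated likewise below\<close>
  obtain u' where u'm [measurable]: "u' \<in> borel_measurable borel" and u': "AE x in lebesgue. u x = u' x"
    using completion_ex_borel_measurable_real[OF um] AE_completion by (metis (mono_tags, lifting) measurable_lborel2)
  have u'l: "u' \<in> borel_measurable lebesgue" by (rule measurable_completion) simp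
  have wu: "N.wL1 u'"
    unfolding N.wL1_def
  proof
    have "integrable lebesgue (\<lambda>x. min 1 (?j (norm x)) * u' x)"
    proof (rule integrable_cong_AE_imp[OF ui])
      show "(\<lambda>x. min 1 (?j (norm x)) * u' x) \<in> borel_measurable lebesgue"
        by (rule measurable_completion) measurable
      show "AE x in lebesgue. min 1 (?j (norm x)) * u x = min 1 (?j (norm x)) * u' x"
        using u' by eventually_elim simp
    qed
    then have i: "integrable lborel (\<lambda>x. min 1 (?j (norm x)) * u' x)"
      by (subst (asm) integrable_completion) auto
    show "integrable lborel (\<lambda>x. u' x * ?W x)"
    proof (rule Bochner_Integration.integrable_bound)
      show "integrable lborel (\<lambda>x. max 1 (?j 2) * (min 1 (?j (norm x)) * u' x))" using i by simp
      have "AE x in lborel. x \<noteq> (0 :: 'a)" by (rule AE_lborel_singleton)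
      then show "AE x in lborel. norm (u' x * ?W x) \<le> norm (max 1 (?j 2) * (min 1 (?j (norm x)) * u' x))"
      proof eventually_elim
        case (elim x)
        have "?W x \<le> ?j 2" "?W x \<le> ?j (norm x)"
          using elim by (auto intro!: jump_kernel_antimono)
        then have "?W x \<le> max 1 (?j 2) * min 1 (?j (norm x))"
          using jump_kernel_nonneg[of "DIM('a)" "norm x"]
            mult_right_mono[of 1 "max 1 (?j 2)" "?j (norm x)"] by (auto simp: min_def)
        then have "\<bar>u' x\<bar> * ?W x \<le> \<bar>u' x\<bar> * (max 1 (?j 2) * min 1 (?j (norm x)))"
          by (intro mult_left_mono) auto
        then show ?case
          using jump_kernel_nonneg[of "DIM('a)" "norm x"] jump_kernel_nonneg[of "DIM('a)" "norm x + 2"]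
          by (simp add: abs_mult mult_ac)
      qed
    qed measurable
  qed simp

  define FT where "FT x = indicator T x * F x" for x
  have "set_integrable lebesgue T F"
    using assms(6) \<open>compact T\<close> \<open>T \<subseteq> \<Omega>\<close> by (auto simp: L1_loc_def)
  then have Fi: "integrable lebesgue FT" by (simp add: set_integrable_def FT_def[abs_def])
  then have Fm: "FT \<in> borel_measurable lebesgue" by simp
  obtain F' where F'm [measurable]: "F' \<in> borel_measurable borel" and F': "AE x in lebesgue. FT x = F' x"
    using completion_ex_borel_measurable_real[OF Fm] AE_completion by (metis (mono_tags, lifting) measurable_lborel2)
  have F'l: "F' \<in> borel_measurable lebesgue" by (rule measurable_completion) simp
  have F'i: "integrable lborel F'"
    using integrable_cong_AE_imp[OF Fi F'l F'] by (subst (asm) integrable_completion) auto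
  have wF: "N.wL1 F'"
    unfolding N.wL1_def
  proof
    show "integrable lborel (\<lambda>x. F' x * ?W x)"
    proof (rule Bochner_Integration.integrable_bound)
      show "integrable lborel (\<lambda>x. ?j 2 * F' x)" using F'i by simp
      have "\<bar>F' x\<bar> * ?W x \<le> \<bar>F' x\<bar> * ?j 2" for x
        by (intro mult_left_mono jump_kernel_antimono) auto
      then show "AE x in lborel. norm (F' x * ?W x) \<le> norm (?j 2 * F' x)"
        by (simp add: abs_mult jump_kernel_nonneg mult_ac)
    qed measurable
  qed simp

  \<comment> \<open>the equation tested with \<open>y \<mapsto> \<eta> n (x - y)\<close>, which is supported in \<open>T\<close> if \<open>\<xi> x \<noteq> 0\<close>\<close>
  have eq: "- conv u' (N.Lop (\<eta> n)) x = conv F' (\<eta> n) x" if "\<xi> x \<noteq> 0" for n x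
  proof -
    define g where "g y = \<eta> n (x - y)" for y
    have "x \<in> S" using inS[OF that] .
    have g_alt: "g = (\<lambda>y. inverse (I n) * \<xi> (k n *\<^sub>R x + (- k n) *\<^sub>R y))"
      by (auto simp: g_def \<eta>_def algebra_simps)
    have Ckg: "Ck m g" for m unfolding g_alt by (intro Ck_cmult Ck_affine Ck)
    have g0: "g y = 0" if "\<not> norm (y - x) \<le> \<rho> n" for y
      unfolding g_def using that by (intro \<eta>0) (simp add: norm_minus_commute)
    have "tame (norm x + \<rho> n) g"
    proof (rule tame_smooth[OF Ckg])
      fix y :: 'a assume "norm y > norm x + \<rho> n"
      then show "g y = 0" using norm_triangle_ineq2[of y x] by (intro g0) simp
    qed
    note gL = nonlocal_op_eq_Lop[OF this]
    have "norm (y - x) \<le> \<rho> n" if "g y \<noteq> 0" for y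
      using g0[of y] that by linarith
    then have cl: "closure {y. g y \<noteq> 0} \<subseteq> cball x (\<rho> n)"
      by (intro closure_minimal) (auto simp: dist_norm norm_minus_commute)
    moreover have "cball x (\<rho> n) \<subseteq> T"
      using T[OF \<open>x \<in> S\<close>] \<rho>_le[of n] by (auto simp: dist_norm norm_minus_commute)
    ultimately have "g \<in> test_functions \<Omega>"
      using Ckg \<open>T \<subseteq> \<Omega>\<close> unfolding test_functions_def
      by (auto intro: bounded_subset[OF bounded_cball cl] simp: compact_eq_bounded_closed)
    then have "(LINT y|lebesgue. u y * (- nonlocal_op \<nu> g y)) = (LINT y:\<Omega>|lebesgue. F y * g y)"
      using assms(8) by (simp add: distributional_solution_def)
    moreover have "(LINT y|lebesgue. u y * (- nonlocal_op \<nu> g y)) = - conv u' (N.Lop (\<eta> n)) x"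
    proof -
      have L: "nonlocal_op \<nu> g y = N.Lop (\<eta> n) (x - y)" for y
        unfolding gL N.Lop_def g_def by (simp add: algebra_simps)
      have [measurable]: "N.Lop (\<eta> n) \<in> borel_measurable borel" by (rule N.Lop_measurable) simp
      have Lm [measurable]: "(\<lambda>y. N.Lop (\<eta> n) (x - y)) \<in> borel_measurable lebesgue"
        by (rule measurable_completion) measurable
      have "(LINT y|lebesgue. u y * (- nonlocal_op \<nu> g y)) = (LINT y|lebesgue. u' y * (- N.Lop (\<eta> n) (x - y)))"
        unfolding L using u' um u'l by (intro integral_cong_AE) (auto intro!: borel_measurable_times)
      also have "\<dots> = (LINT y|lborel. u' y * (- N.Lop (\<eta> n) (x - y)))"
        by (rule integral_completion) measurable
      finally show ?thesis by (simp add: conv_def)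
    qed
    moreover have "(LINT y:\<Omega>|lebesgue. F y * g y) = conv F' (\<eta> n) x"
    proof -
      have [measurable]: "g \<in> borel_measurable borel" unfolding g_def[abs_def] by measurable
      have gm: "g \<in> borel_measurable lebesgue" by (rule measurable_completion) simp
      have "indicator \<Omega> y *\<^sub>R (F y * g y) = FT y * g y" for y
      proof (cases "g y = 0")
        case False
        then have "norm (y - x) \<le> d / 2" using g0[of y] \<rho>_le[of n] by linarith
        then have "y \<in> T" by (rule T[OF \<open>x \<in> S\<close>])
        then show ?thesis using \<open>T \<subseteq> \<Omega>\<close> by (auto simp: FT_def)
      qed simp
      then have "(LINT y:\<Omega>|lebesgue. F y * g y) = (LINT y|lebesgue. FT y * g y)"
        by (simp only: set_lebesgue_integral_def)
      also have "\<dots> = (LINT y|lebesgue. F' y * g y)"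
        using F' Fm F'l gm by (intro integral_cong_AE) auto
      also have "\<dots> = (LINT y|lborel. F' y * g y)" by (rule integral_completion) measurable
      finally show ?thesis by (simp add: conv_def g_def)
    qed
    ultimately show ?thesis by simp
  qed

  have "(LBINT x. \<bar>u' x\<bar> * (- N.Lop \<xi> x)) \<le> (LBINT x. \<xi> x * sgn (u' x) * F' x)"
    by (rule N.Kato_inequality[OF wu wF tame_\<xi> assms(10) tame_\<eta> \<eta>_nonneg \<eta>_one \<rho>_lim eq])
  moreover have "(LINT x|lebesgue. \<bar>u x\<bar> * (- nonlocal_op \<nu> \<xi> x)) = (LBINT x. \<bar>u' x\<bar> * (- N.Lop \<xi> x))"
  proof -
    have [measurable]: "N.Lop \<xi> \<in> borel_measurable borel" by (rule N.Lop_measurable) simp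
    have Lm: "N.Lop \<xi> \<in> borel_measurable lebesgue" by (rule measurable_completion) simp
    have "(LINT x|lebesgue. \<bar>u x\<bar> * (- nonlocal_op \<nu> \<xi> x)) = (LINT x|lebesgue. \<bar>u' x\<bar> * (- N.Lop \<xi> x))"
      unfolding nonlocal_op_eq_Lop[OF tame_\<xi>] using u' um u'l Lm by (intro integral_cong_AE) auto
    also have "\<dots> = (LINT x|lborel. \<bar>u' x\<bar> * (- N.Lop \<xi> x))" by (rule integral_completion) measurable
    finally show ?thesis .
  qed
  moreover have "(LINT x:\<Omega>|lebesgue. \<xi> x * sgn (u x) * F x) = (LBINT x. \<xi> x * sgn (u' x) * F' x)"
  proof -
    have \<xi>m: "\<xi> \<in> borel_measurable lebesgue" by (rule measurable_completion) simp
    have sm: "(\<lambda>x. sgn (u x)) \<in> borel_measurable lebesgue" "(\<lambda>x. sgn (u' x)) \<in> borel_measurable lebesgue"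
      using um u'l by (auto intro: borel_measurable_sgn)
    have "indicator \<Omega> x *\<^sub>R (\<xi> x * sgn (u x) * F x) = \<xi> x * sgn (u x) * FT x" for x
    proof (cases "\<xi> x = 0")
      case False
      then have "x \<in> T" using T[OF inS[OF False], of x] d(1) by simp
      then show ?thesis using \<open>T \<subseteq> \<Omega>\<close> by (auto simp: FT_def)
    qed simp
    then have "(LINT x:\<Omega>|lebesgue. \<xi> x * sgn (u x) * F x) = (LINT x|lebesgue. \<xi> x * sgn (u x) * FT x)"
      by (simp only: set_lebesgue_integral_def)
    also have "\<dots> = (LINT x|lebesgue. \<xi> x * sgn (u' x) * F' x)"
    proof (rule integral_cong_AE)
      show "AE x in lebesgue. \<xi> x * sgn (u x) * FT x = \<xi> x * sgn (u' x) * F' x"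
        using u' F' by eventually_elim simp
    qed (use \<xi>m sm Fm F'l in \<open>auto intro!: borel_measurable_times\<close>)
    also have "\<dots> = (LINT x|lborel. \<xi> x * sgn (u' x) * F' x)" by (rule integral_completion) measurable
    finally show ?thesis .
  qed
  ultimately show ?thesis by simp
qed

end
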